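(* Let $\mu_1,\ldots,\mu_n$ be pairwise different nonzero complex numbers and let $z_1,\ldots,z_n\in\mathbb{C}^n$ be nonzero linearly independent vectors. Denote $$\widetilde{\lambda}_k^m=\ln|\mu_m|+\mathrm{i}(\operatorname{Arg}\mu_m+2\pi k),\qquad m=1,\ldots,n,\ k\in\mathbb{Z}.$$ Let $\{\lambda_k^m\}_{k\in\mathbb{Z},\,m=1,\ldots,n}$ be an arbitrary sequence of pairwise different complex numbers such that $$\sum_{k\in\mathbb{Z}}|\lambda_k^m-\widetilde{\lambda}_k^m|^2<\infty,\qquad m=1,\ldots,n,$$ indexed so that if $\lambda_{k_0}^{m_0}=\widetilde{\lambda}_k^m$ for some indices, then $m_0=m$ and $k_0=k$. Then there is a small enough $\varepsilon>0$ such that for any sequence of nonzero vectors $\{d_k^m\}_{k\in\mathbb{Z},\,m=1,\ldots,n}\subset\mathbb{C}^n$ satisfying $$\sum_{k\in\mathbb{Z}}\|d_k^m-z_m\|^2<\varepsilon,\qquad m=1,\ldots,n,$$ one can choose matrices $A_{-1},A_2(\theta),A_3(\theta)$ such that the characteristic matrix $\Delta(\lambda)$ of the neutral type system with these matrices satisfies the following two conditions: (i) all the numbers $\lambda_k^m$ are roots of the characteristic equation, i.e. $\det\Delta(\lambda_k^m)=0$ for $k\in\mathbb{Z}$, $m=1,\ldots,n$; (ii) the vectors $d_k^m$ are degenerating vectors for $\Delta(\lambda_k^m)$, in the sense that $(d_k^m)^*\Delta(\lambda_k^m)=0$ for $k\in\mathbb{Z}$, $m=1,\ldots,n$. Such a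 choice is unique if one imposes the following additional condition on the matrix $A_3(\theta)$: $$\int_{-1}^{0}A_3(\theta)\,\mathrm{d}\theta=0.$$
   Context: The neutral type system is $$\dot z(t)=A_{-1}\dot z(t-1)+\int_{-1}^0A_2(\theta)\dot z(t+\theta)\,\mathrm{d}\theta+\int_{-1}^0A_3(\theta)z(t+\theta)\,\mathrm{d}\theta,$$ where $A_{-1}$ is a constant complex $n\times n$ matrix and $A_2(\cdot),A_3(\cdot)$ are $n\times n$ matrices whose (complex-valued) entries belong to $L_2[-1,0]$. Its characteristic matrix is $$\Delta(\lambda)=\lambda I-\lambda \mathrm{e}^{-\lambda}A_{-1}-\int_{-1}^0\lambda \mathrm{e}^{\lambda\theta}A_2(\theta)\,\mathrm{d}\theta-\int_{-1}^0\mathrm{e}^{\lambda\theta}A_3(\theta)\,\mathrm{d}\theta,\qquad\lambda\in\mathbb{C}.$$ Here $v^*$ denotes the conjugate transpose of a vector $v$, and $\operatorname{Arg}$ the principal argument.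
   Formalization: Uniqueness of (A_{-1},A_2,A_3) is false: adding (C,C') with C(-1)=C(0)=0 to (A_2,A_3) keeps Δ and ∫A_3=0. Proved instead: A_{-1} is unique and, if no λ_k^m is 0 (else Δ is not unique), so are A_2(θ)-∫_{-1}^θ A_3 (a.e.) and Δ. *)

theory Defs
  imports "HOL-Analysis.Analysis"
begin

definition L2_fun :: "(real \<Rightarrow> complex) \<Rightarrow> bool" where
  "L2_fun f \<longleftrightarrow> f \<in> borel_measurable (lebesgue_on {-1..0}) \<and>
     integrable (lebesgue_on {-1..0}) (\<lambda>\<theta>. (cmod (f \<theta>))\<^sup>2)"

definition L2_matrix :: "(real \<Rightarrow> complex^'n^'n) \<Rightarrow> bool" where
  "L2_matrix A \<longleftrightarrow> (\<forall>i j. L2_fun (\<lambda>\<theta>. A \<theta> $ i $ j))"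

definition char_matrix ::
  "complex^'n^'n \<Rightarrow> (real \<Rightarrow> complex^'n^'n) \<Rightarrow> (real \<Rightarrow> complex^'n^'n) \<Rightarrow> complex \<Rightarrow> complex^'n^'n" where
  "char_matrix A1 A2 A3 s =
     mat s - map_matrix (\<lambda>a. s * exp (- s) * a) A1
     - (LINT \<theta>|lebesgue_on {-1..0}. map_matrix (\<lambda>a. s * exp (s * of_real \<theta>) * a) (A2 \<theta>))
     - (LINT \<theta>|lebesgue_on {-1..0}. map_matrix (\<lambda>a. exp (s * of_real \<theta>) * a) (A3 \<theta>))"

definition lambda_tilde :: "complex \<Rightarrow> int \<Rightarrow> complex" where
  "lambda_tilde \<mu> k = of_real (ln (cmod \<mu>)) + \<i> * of_real (Arg \<mu> + 2 * pi * of_int k)"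

definition cnj_vec :: "complex^'n \<Rightarrow> complex^'n" where
  "cnj_vec v = (\<chi> i. cnj (v $ i))"

text \<open>The row vector \<open>v\<^sup>* M\<close> is \<open>cnj_vec v v* M\<close>, where \<open>v*\<close> is the
  row-vector-by-matrix product, which does not conjugate.\<close>

definition spectral_assignment ::
  "('n \<Rightarrow> int \<Rightarrow> complex) \<Rightarrow> ('n \<Rightarrow> int \<Rightarrow> complex^'n) \<Rightarrow>
   complex^'n^'n \<Rightarrow> (real \<Rightarrow> complex^'n^'n) \<Rightarrow> (real \<Rightarrow> complex^'n^'n) \<Rightarrow> bool" where
  "spectral_assignment lam d A1 A2 A3 \<longleftrightarrow>
     L2_matrix A2 \<and> L2_matrix A3 \<and>
     (\<forall>m k. det (char_matrix A1 A2 A3 (lam m k)) = 0) \<and>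
     (\<forall>m k. cnj_vec (d m k) v* char_matrix A1 A2 A3 (lam m k) = 0)"

definition zero_mean :: "(real \<Rightarrow> complex^'n^'n) \<Rightarrow> bool" where
  "zero_mean A3 \<longleftrightarrow> (LINT \<theta>|lebesgue_on {-1..0}. A3 \<theta>) = 0"

text \<open>If \<open>A3\<close> has zero mean, integrating by parts in the neutral equation replaces the pair
  \<open>(A2, A3)\<close> by \<open>(neutral_kernel A2 A3, 0)\<close> without changing the equation or its
  characteristic matrix. Hence pairs \<open>(A2, A3)\<close> with the same kernel (for instance
  \<open>(A2, A3)\<close> and \<open>(A2 + C, A3 + C')\<close> with \<open>C\<close> smooth, \<open>C (-1) = C 0 = 0\<close>) give the same
  system, and the kernel is the strongest invariant of the pair that a uniqueness claim can
  concern.\<close>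

definition neutral_kernel ::
  "(real \<Rightarrow> complex^'n^'n) \<Rightarrow> (real \<Rightarrow> complex^'n^'n) \<Rightarrow> real \<Rightarrow> complex^'n^'n" where
  "neutral_kernel A2 A3 \<theta> = A2 \<theta> - (LINT s|lebesgue_on {-1..\<theta>}. A3 s)"

end

theory Submission
  imports Defs
begin

text \<open>
If \<open>A3\<close> has zero mean, an integration by parts gives
\<open>\<Delta>(\<lambda>) = \<lambda> (I - e\<^bsup>-\<lambda>\<^esup> A - \<integral> e\<^bsup>\<lambda>\<theta>\<^esup> K(\<theta>) d\<theta>)\<close> with \<open>A = A1\<close> and \<open>K\<close> the neutral kernel. At a node
\<open>\<lambda> \<noteq> 0\<close> the requirement \<open>d\<^sup>* \<Delta>(\<lambda>) = 0\<close> therefore says that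
\<open>d\<^sup>* (I - e\<^bsup>-\<lambda>\<^esup> A - \<integral> e\<^bsup>\<lambda>\<theta>\<^esup> K) = 0\<close>. Along \<open>k \<rightarrow> \<infinity>\<close> the integral tends to \<open>0\<close>, the vectors tend
to \<open>z\<^sub>m\<close> and \<open>e\<^bsup>\<lambda>\<^esup>\<close> tends to \<open>\<mu>\<^sub>m\<close>, so \<open>z\<^sub>m\<^sup>* A = \<mu>\<^sub>m z\<^sub>m\<^sup>*\<close> for all \<open>m\<close>; this determines \<open>A\<close>
(\<open>neutral_matrix_unique\<close>), and the same equations define \<open>A\<close> in the existence part. With this
\<open>A\<close> the vectors \<open>d\<^sup>* (I - e\<^bsup>-\<lambda>\<^esup> A)\<close> are square summable (\<open>sqsum_target\<close>), and each column \<open>f\<close> of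
\<open>K\<close> has to solve a moment problem \<open>d\<^sup>* \<integral> e\<^bsup>\<lambda>\<theta>\<^esup> f(\<theta>) d\<theta> = y\<close> with square summable data \<open>y\<close>. The
theorem follows once this problem has exactly one solution in \<open>L\<^sub>2\<close>, which is
\<open>exponential_interpolation\<close>; existence and uniqueness of the kernel are its two halves.
A node at \<open>0\<close> imposes no condition on the kernel, hence the uniqueness of the kernel for nonzero
nodes.

For the moment problem write \<open>z\<^sub>m\<^sup>* f(\<theta>) = e\<^bsup>-a\<theta>\<^esup> g\<^sub>m(\<theta>)\<close> with \<open>a = a\<^sub>m = ln |\<mu>\<^sub>m| + i Arg \<mu>\<^sub>m\<close> and
take the Fourier coefficients of all \<open>g\<^sub>m\<close> as unknowns. By the Riesz-Fischer theorem and the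
uniqueness theorem for Fourier series the problem becomes a linear system in \<open>\<ell>\<^sub>2\<close> over the index
pairs \<open>(m, j)\<close>. If \<open>d = z\<close>, it is block diagonal, and the row with index \<open>(m, k)\<close> has the entries
\<open>(1 - e\<^bsup>-s\<^esup>) / (s - 2\<pi>ij)\<close>, where \<open>s = \<lambda> - a\<^sub>m = 2\<pi>ik + \<delta>\<close> with square summable \<open>\<delta>\<close>. By Bessel's
inequality this row differs from the unit vector by \<open>O(|\<delta>|)\<close>, so the system is the identity plus a
Hilbert-Schmidt operator.

It is invertible (\<open>block_rows_invertible\<close>): keep the unit vectors in finitely many rows, so that the
rest is a small perturbation of the identity, and then exchange these rows one by one, moving the
node \<open>2\<pi>ik\<close> to \<open>2\<pi>ik + \<delta>\<close>. An exchange can only destroy invertibility if the new row annihilates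
the solution \<open>h\<close> of the system with the \<open>(m, k)\<close>-th unit vector on the right; a partial fraction
computation then produces a kernel vector of the old system (\<open>block_row_swap_nonzero\<close>), provided the
nodes stay distinct. That no perturbed node coincides with another unperturbed one is exactly what
keeps them distinct during the exchange. Finally, replacing \<open>z\<^sub>m\<close> by \<open>d\<close> perturbs the
system by an operator whose norm is controlled by the square sums of \<open>\<parallel>d - z\<^sub>m\<parallel>\<close>, and \<open>\<epsilon>\<close> is
chosen so that invertibility survives.
\<close>

section \<open>The Hilbert space of square summable families\<close>

definition sqsum :: "('i \<Rightarrow> complex) \<Rightarrow> bool" where
  "sqsum f \<longleftrightarrow> (\<lambda>i. (cmod (f i))\<^sup>2) summable_on UNIV"

lemma summable_squares_iff:
  fixes f :: "'i \<Rightarrow> real"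
  shows "(\<lambda>i. (f i)\<^sup>2) summable_on UNIV \<longleftrightarrow> (\<exists>B. \<forall>F. finite F \<longrightarrow> L2_set f F \<le> B)"
proof
  assume s: "(\<lambda>i. (f i)\<^sup>2) summable_on UNIV"
  have "L2_set f F \<le> sqrt (infsum (\<lambda>i. (f i)\<^sup>2) UNIV)" if "finite F" for F
    unfolding L2_set_def
    by (intro real_sqrt_le_mono finite_sum_le_infsum s that) auto
  then show "\<exists>B. \<forall>F. finite F \<longrightarrow> L2_set f F \<le> B" by blast
next
  assume "\<exists>B. \<forall>F. finite F \<longrightarrow> L2_set f F \<le> B"
  then obtain B where B: "\<And>F. finite F \<Longrightarrow> L2_set f F \<le> B" by blast
  have "sum (\<lambda>i. (f i)\<^sup>2) F \<le> B\<^sup>2" if "finite F" for F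
    using power_mono[OF B[OF that], of 2] by (simp add: L2_set_def sum_nonneg)
  then show "(\<lambda>i. (f i)\<^sup>2) summable_on UNIV"
    by (intro nonneg_bdd_above_summable_on bdd_aboveI2[where M="B\<^sup>2"]) auto
qed

lemma sqsumI: "(\<And>F. finite F \<Longrightarrow> L2_set (\<lambda>i. cmod (f i)) F \<le> B) \<Longrightarrow> sqsum f"
  unfolding sqsum_def summable_squares_iff by blast

lemma sqsumE:
  assumes "sqsum f"
  obtains B where "\<And>F. finite F \<Longrightarrow> L2_set (\<lambda>i. cmod (f i)) F \<le> B"
  using assms unfolding sqsum_def summable_squares_iff by blast

lemma sqsum_zero [simp]: "sqsum (\<lambda>_. 0)"
  by (rule sqsumI[where B=0]) (simp add: L2_set_0')

lemma sqsum_add: "sqsum f \<Longrightarrow> sqsum g \<Longrightarrow> sqsum (\<lambda>i. f i + g i)"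
proof -
  assume "sqsum f" "sqsum g"
  then obtain A B where A: "\<And>F. finite F \<Longrightarrow> L2_set (\<lambda>i. cmod (f i)) F \<le> A"
    and B: "\<And>F. finite F \<Longrightarrow> L2_set (\<lambda>i. cmod (g i)) F \<le> B"
    by (metis sqsumE)
  show ?thesis
  proof (rule sqsumI[where B="A + B"])
    fix F :: "'a set" assume F: "finite F"
    have "L2_set (\<lambda>i. cmod (f i + g i)) F \<le> L2_set (\<lambda>i. cmod (f i) + cmod (g i)) F"
      by (intro L2_set_mono norm_triangle_ineq) auto
    also have "\<dots> \<le> L2_set (\<lambda>i. cmod (f i)) F + L2_set (\<lambda>i. cmod (g i)) F"
      by (rule L2_set_triangle_ineq)
    finally show "L2_set (\<lambda>i. cmod (f i + g i)) F \<le> A + B"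
      using A[OF F] B[OF F] by linarith
  qed
qed

lemma sqsum_bounded_mult:
  assumes "sqsum f" "\<And>i. cmod (g i) \<le> C * cmod (f i)"
  shows "sqsum g"
proof -
  have "cmod (g i) \<le> \<bar>C\<bar> * cmod (f i)" for i
    by (rule order_trans[OF assms(2)]) (simp add: mult_right_mono)
  moreover from assms(1) obtain A where "\<And>F. finite F \<Longrightarrow> L2_set (\<lambda>i. cmod (f i)) F \<le> A"
    by (metis sqsumE)
  ultimately have "L2_set (\<lambda>i. cmod (g i)) F \<le> \<bar>C\<bar> * A" if "finite F" for F
    using that L2_set_mono[of F "\<lambda>i. cmod (g i)" "\<lambda>i. \<bar>C\<bar> * cmod (f i)"]
    by (simp flip: L2_set_right_distrib) (meson abs_ge_zero mult_left_mono order_trans)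
  then show ?thesis by (rule sqsumI)
qed

lemma sqsum_cmult: "sqsum f \<Longrightarrow> sqsum (\<lambda>i. c * f i)"
  by (erule sqsum_bounded_mult[where C="cmod c"]) (simp add: norm_mult)

lemma sqsum_minus: "sqsum f \<Longrightarrow> sqsum (\<lambda>i. - f i)"
  using sqsum_cmult[of f "-1"] by simp

lemma sqsum_diff: "sqsum f \<Longrightarrow> sqsum g \<Longrightarrow> sqsum (\<lambda>i. f i - g i)"
  using sqsum_add[of f "\<lambda>i. - g i"] by (simp add: sqsum_minus)

text \<open>A type of its own makes the notions of bounded linear map and complete metric space, and
with them the fixed point theorem for contractions, applicable to square summable
families.\<close>

typedef 'i ell2 = "{f :: 'i \<Rightarrow> complex. sqsum f}"
  morphisms coord Abs_ell2
  by (rule exI[of _ "\<lambda>_. 0"]) simp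

lemma sqsum_coord [simp]: "sqsum (coord x)"
  using coord[of x] by simp

lemma coord_Abs [simp]: "sqsum f \<Longrightarrow> coord (Abs_ell2 f) = f"
  by (simp add: Abs_ell2_inverse)

lemma ell2_eqI: "(\<And>i. coord x i = coord y i) \<Longrightarrow> x = y"
  by (metis coord_inject ext)

instantiation ell2 :: (type) real_normed_vector
begin

definition "0 = Abs_ell2 (\<lambda>_. 0)"
definition "x + y = Abs_ell2 (\<lambda>i. coord x i + coord y i)"
definition "x - y = Abs_ell2 (\<lambda>i. coord x i - coord y i)"
definition "- x = Abs_ell2 (\<lambda>i. - coord x i)"
definition "r *\<^sub>R x = Abs_ell2 (\<lambda>i. of_real r * coord x i)"
definition "norm x = sqrt (infsum (\<lambda>i. (cmod (coord x i))\<^sup>2) UNIV)"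
definition "sgn x = (inverse (norm x)) *\<^sub>R x" for x :: "'a ell2"
definition "dist x y = norm (x - y)" for x :: "'a ell2"
definition "uniformity = (INF e\<in>{0 <..}. principal {(x :: 'a ell2, y). dist x y < e})"
definition "open U \<longleftrightarrow> (\<forall>x\<in>U. eventually (\<lambda>(x', y). x' = x \<longrightarrow> y \<in> U) uniformity)"
  for U :: "'a ell2 set"

lemma coord_zero [simp]: "coord 0 i = 0"
  by (simp add: zero_ell2_def)

lemma coord_add [simp]: "coord (x + y) i = coord x i + coord y i"
  by (simp add: plus_ell2_def sqsum_add)

lemma coord_diff [simp]: "coord (x - y) i = coord x i - coord y i"
  by (simp add: minus_ell2_def sqsum_diff)

lemma coord_minus [simp]: "coord (- x) i = - coord x i"
  by (simp add: uminus_ell2_def sqsum_minus)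

lemma coord_scaleR [simp]: "coord (r *\<^sub>R x) i = of_real r * coord x i"
  by (simp add: scaleR_ell2_def sqsum_cmult)

lemma L2_set_coord_le_norm: "finite F \<Longrightarrow> L2_set (\<lambda>i. cmod (coord x i)) F \<le> norm x"
  unfolding L2_set_def norm_ell2_def
  by (intro real_sqrt_le_mono finite_sum_le_infsum) (use sqsum_coord[of x] in \<open>auto simp: sqsum_def\<close>)

lemma norm_ell2_leI:
  assumes "\<And>F. finite F \<Longrightarrow> L2_set (\<lambda>i. cmod (coord x i)) F \<le> B"
  shows "norm x \<le> B"
proof -
  have "0 \<le> B" using assms[of "{}"] by simp
  moreover have "sum (\<lambda>i. (cmod (coord x i))\<^sup>2) F \<le> B\<^sup>2" if "finite F" for F
    using power_mono[OF assms[OF that], of 2] by (simp add: L2_set_def sum_nonneg)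
  then have "infsum (\<lambda>i. (cmod (coord x i))\<^sup>2) UNIV \<le> B\<^sup>2"
    by (intro infsum_le_finite_sums) (use sqsum_coord[of x] in \<open>auto simp: sqsum_def\<close>)
  ultimately show ?thesis
    unfolding norm_ell2_def by (simp add: real_le_lsqrt)
qed

lemma cmod_coord_le_norm: "cmod (coord x i) \<le> norm x"
  using L2_set_coord_le_norm[of "{i}" x] by simp

instance
proof
  fix x y z :: "'a ell2" and a b :: real
  show "x + y + z = x + (y + z)" "x + y = y + x" "0 + x = x" "- x + x = 0" "x - y = x + - y"
    by (auto intro!: ell2_eqI)
  show "a *\<^sub>R (x + y) = a *\<^sub>R x + a *\<^sub>R y" "(a + b) *\<^sub>R x = a *\<^sub>R x + b *\<^sub>R x"
    "a *\<^sub>R b *\<^sub>R x = (a * b) *\<^sub>R x" "1 *\<^sub>R x = x"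
    by (auto intro!: ell2_eqI simp: algebra_simps)
  show "dist x y = norm (x - y)" by (rule dist_ell2_def)
  show "sgn x = inverse (norm x) *\<^sub>R x" by (rule sgn_ell2_def)
  show "uniformity = (INF e\<in>{0<..}. principal {(x :: 'a ell2, y). dist x y < e})"
    by (rule uniformity_ell2_def)
  show "open U \<longleftrightarrow> (\<forall>x\<in>U. eventually (\<lambda>(x', y). x' = x \<longrightarrow> y \<in> U) uniformity)" for U :: "'a ell2 set"
    by (rule open_ell2_def)
  show "norm x = 0 \<longleftrightarrow> x = 0"
  proof
    assume "norm x = 0"
    then show "x = 0"
      using cmod_coord_le_norm[of x] by (auto intro!: ell2_eqI)
  qed (simp add: norm_ell2_def)
  show "norm (x + y) \<le> norm x + norm y"
  proof (rule norm_ell2_leI)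
    fix F :: "'a set" assume F: "finite F"
    have "L2_set (\<lambda>i. cmod (coord (x + y) i)) F \<le> L2_set (\<lambda>i. cmod (coord x i) + cmod (coord y i)) F"
      by (intro L2_set_mono) (auto intro: norm_triangle_ineq)
    also have "\<dots> \<le> L2_set (\<lambda>i. cmod (coord x i)) F + L2_set (\<lambda>i. cmod (coord y i)) F"
      by (rule L2_set_triangle_ineq)
    finally show "L2_set (\<lambda>i. cmod (coord (x + y) i)) F \<le> norm x + norm y"
      using L2_set_coord_le_norm[OF F, of x] L2_set_coord_le_norm[OF F, of y] by linarith
  qed
  show "norm (a *\<^sub>R x) = \<bar>a\<bar> * norm x"
    by (simp add: norm_ell2_def norm_mult power_mult_distrib infsum_cmult_right' real_sqrt_mult)
qed

end

text \<open>The coordinates of a Cauchy sequence converge. Letting one index tend to infinity in a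
finite partial sum of squares shows that the coordinatewise limit is square summable and
is the limit in norm.\<close>

instance ell2 :: (type) banach
proof
  fix X :: "nat \<Rightarrow> 'a ell2"
  assume X: "Cauchy X"
  have "Cauchy (\<lambda>n. coord (X n) i)" for i
  proof (rule metric_CauchyI)
    fix e :: real assume "e > 0"
    then obtain N where "\<forall>m\<ge>N. \<forall>n\<ge>N. dist (X m) (X n) < e"
      using X unfolding Cauchy_def by blast
    moreover have "dist (coord (X m) i) (coord (X n) i) \<le> dist (X m) (X n)" for m n
      using cmod_coord_le_norm[of "X m - X n" i] by (simp add: dist_norm)
    ultimately show "\<exists>M. \<forall>m\<ge>M. \<forall>n\<ge>M. dist (coord (X m) i) (coord (X n) i) < e"
      by (meson le_less_trans)
  qed
  then have "\<exists>l. (\<lambda>n. coord (X n) i) \<longlonglongrightarrow> l" for i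
    using Cauchy_convergent_iff convergent_def by blast
  then obtain f where f: "\<And>i. (\<lambda>n. coord (X n) i) \<longlonglongrightarrow> f i" by metis
  have close: "L2_set (\<lambda>i. cmod (coord (X n) i - f i)) F \<le> e"
    if "\<forall>m\<ge>N. \<forall>n\<ge>N. dist (X m) (X n) < e" "n \<ge> N" "finite F" for e N n F
  proof (rule tendsto_upperbound)
    show "(\<lambda>m. L2_set (\<lambda>i. cmod (coord (X n) i - coord (X m) i)) F)
        \<longlonglongrightarrow> L2_set (\<lambda>i. cmod (coord (X n) i - f i)) F"
      unfolding L2_set_def by (intro tendsto_intros f)
    have "L2_set (\<lambda>i. cmod (coord (X n) i - coord (X m) i)) F \<le> e" if "m \<ge> N" for m
      using L2_set_coord_le_norm[OF \<open>finite F\<close>, of "X n - X m"] that \<open>n \<ge> N\<close>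
        \<open>\<forall>m\<ge>N. \<forall>n\<ge>N. dist (X m) (X n) < e\<close>
      by (fastforce simp: dist_norm)
    then show "\<forall>\<^sub>F m in sequentially. L2_set (\<lambda>i. cmod (coord (X n) i - coord (X m) i)) F \<le> e"
      by (auto simp: eventually_sequentially)
  qed simp
  have "sqsum f"
  proof -
    obtain N where N: "\<forall>m\<ge>N. \<forall>n\<ge>N. dist (X m) (X n) < 1"
      using X unfolding Cauchy_def by (meson zero_less_one)
    have "sqsum (\<lambda>i. coord (X N) i - f i)"
      using close[OF N order_refl] by (rule sqsumI)
    from sqsum_diff[OF sqsum_coord[of "X N"] this] show ?thesis by simp
  qed
  have "X \<longlonglongrightarrow> Abs_ell2 f"
  proof (rule metric_LIMSEQ_I)
    fix r :: real assume "r > 0"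
    then obtain N where N: "\<forall>m\<ge>N. \<forall>n\<ge>N. dist (X m) (X n) < r / 2"
      using X unfolding Cauchy_def by (meson half_gt_zero)
    have "dist (X n) (Abs_ell2 f) \<le> r / 2" if "n \<ge> N" for n
      unfolding dist_norm
      by (rule norm_ell2_leI) (use close[OF N that] \<open>sqsum f\<close> in simp)
    then show "\<exists>N. \<forall>n\<ge>N. dist (X n) (Abs_ell2 f) < r"
      using \<open>r > 0\<close> by (intro exI[of _ N]) fastforce
  qed
  then show "convergent X" by (rule convergentI)
qed

definition unit_vec :: "'i \<Rightarrow> 'i ell2" where
  "unit_vec i = Abs_ell2 (\<lambda>j. if j = i then 1 else 0)"

lemma coord_unit_vec [simp]: "coord (unit_vec i) j = (if j = i then 1 else 0)"
proof -
  have "L2_set (\<lambda>j. cmod (if j = i then 1 else 0)) F \<le> 1" if "finite F" for F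
    using that by (simp add: L2_set_def if_distrib[of cmod] if_distrib[of "\<lambda>x. x\<^sup>2"] cong: if_cong)
  then have "sqsum (\<lambda>j. if j = i then 1 else (0::complex))" by (rule sqsumI)
  then show ?thesis by (simp add: unit_vec_def)
qed

text \<open>The type class only provides multiplication by real scalars.\<close>

definition cscale :: "complex \<Rightarrow> 'i ell2 \<Rightarrow> 'i ell2" where
  "cscale a x = Abs_ell2 (\<lambda>i. a * coord x i)"

lemma coord_cscale [simp]: "coord (cscale a x) i = a * coord x i"
  by (simp add: cscale_def sqsum_cmult)

lemma norm_cscale [simp]: "norm (cscale a x) = cmod a * norm x"
  by (simp add: norm_ell2_def norm_mult power_mult_distrib infsum_cmult_right' real_sqrt_mult)

text \<open>The pairing is bilinear: a row of a complex matrix acts on a vector without conjugation.\<close>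

definition dot :: "'i ell2 \<Rightarrow> 'i ell2 \<Rightarrow> complex" where
  "dot r x = (\<Sum>\<^sub>\<infinity>i. coord r i * coord x i)"

lemma dot_finite_bound:
  assumes "finite F"
  shows "(\<Sum>i\<in>F. cmod (coord r i * coord x i)) \<le> norm r * norm x"
proof -
  have "(\<Sum>i\<in>F. cmod (coord r i * coord x i))
      \<le> L2_set (\<lambda>i. cmod (coord r i)) F * L2_set (\<lambda>i. cmod (coord x i)) F"
    using L2_set_mult_ineq[of "\<lambda>i. cmod (coord r i)" "\<lambda>i. cmod (coord x i)" F] by (simp add: norm_mult)
  also have "\<dots> \<le> norm r * norm x"
    using assms by (intro mult_mono L2_set_coord_le_norm) auto
  finally show ?thesis .
qed

lemma dot_abs_summable: "(\<lambda>i. cmod (coord r i * coord x i)) summable_on UNIV"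
  by (rule nonneg_bdd_above_summable_on)
     (auto intro!: bdd_aboveI2[where M="norm r * norm x"] dot_finite_bound)

lemma dot_summable: "(\<lambda>i. coord r i * coord x i) summable_on UNIV"
  by (rule abs_summable_summable) (rule dot_abs_summable)

lemma cmod_dot_le: "cmod (dot r x) \<le> norm r * norm x"
proof -
  have "cmod (dot r x) \<le> (\<Sum>\<^sub>\<infinity>i. cmod (coord r i * coord x i))"
    unfolding dot_def by (rule norm_infsum_bound) (rule dot_abs_summable)
  also have "\<dots> \<le> norm r * norm x"
    by (rule infsum_le_finite_sums) (use dot_abs_summable dot_finite_bound in auto)
  finally show ?thesis .
qed

lemma dot_add_right: "dot r (x + y) = dot r x + dot r y"
  by (simp add: dot_def distrib_left infsum_add dot_summable)

lemma dot_add_left: "dot (r + s) x = dot r x + dot s x"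
  by (simp add: dot_def distrib_right infsum_add dot_summable)

lemma dot_cscale_right: "dot r (cscale a x) = a * dot r x"
  by (simp add: dot_def mult.left_commute infsum_cmult_right')

lemma dot_scaleR_right: "dot r (a *\<^sub>R x) = of_real a * dot r x"
  by (simp add: dot_def mult.left_commute infsum_cmult_right')

lemma dot_diff_right: "dot r (x - y) = dot r x - dot r y"
  using dot_add_right[of r "x - y" y] by simp

lemma dot_diff_left: "dot (r - s) x = dot r x - dot s x"
  using dot_add_left[of "r - s" s x] by simp

lemma dot_unit_vec [simp]: "dot (unit_vec i) x = coord x i"
proof -
  have "dot (unit_vec i) x = (\<Sum>\<^sub>\<infinity>j\<in>{i}. coord x j)"
    unfolding dot_def by (rule infsum_cong_neutral) auto
  then show ?thesis by simp
qed

section \<open>Boundedly invertible systems of linear equations\<close>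

lemma surjI2: "(\<And>y. \<exists>x. y = f x) \<Longrightarrow> surj f" by (auto simp: surj_def)

text \<open>The lower bound measures how large a perturbation may be without destroying
invertibility.\<close>

definition bdd_invertible :: "('a::real_normed_vector \<Rightarrow> 'b::real_normed_vector) \<Rightarrow> bool" where
  "bdd_invertible T \<longleftrightarrow> bounded_linear T \<and> surj T \<and> (\<exists>r>0. \<forall>x. r * norm x \<le> norm (T x))"

lemma bdd_invertibleI:
  "bounded_linear T \<Longrightarrow> surj T \<Longrightarrow> r > 0 \<Longrightarrow> (\<And>x. r * norm x \<le> norm (T x)) \<Longrightarrow> bdd_invertible T"
  unfolding bdd_invertible_def by blast

text \<open>The equation \<open>T x + K x = y\<close> says that \<open>x\<close> is a fixed point of
\<open>x \<mapsto> T\<^sup>-\<^sup>1 (y - K x)\<close>, a contraction with constant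
\<open>q / r\<close>.\<close>

lemma bdd_invertible_perturb:
  fixes T K :: "'a::banach \<Rightarrow> 'b::real_normed_vector"
  assumes T: "bounded_linear T" "surj T" and r: "\<And>x. r * norm x \<le> norm (T x)"
    and K: "bounded_linear K" and q: "\<And>x. norm (K x) \<le> q * norm x" "0 \<le> q" "q < r"
  shows "bdd_invertible (\<lambda>x. T x + K x)"
proof (rule bdd_invertibleI)
  show "bounded_linear (\<lambda>x. T x + K x)" using T(1) K by (rule bounded_linear_add)
  show "r - q > 0" using q by simp
  fix x
  have "norm (T x) \<le> norm (T x + K x) + norm (K x)"
    using norm_triangle_ineq4[of "T x + K x" "K x"] by simp
  then show "(r - q) * norm x \<le> norm (T x + K x)"
    using r[of x] q(1)[of x] by (simp add: algebra_simps)
next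
  interpret T: bounded_linear T by fact
  interpret K: bounded_linear K by fact
  have "r > 0" using q by simp
  define S where "S = inv T"
  have TS [simp]: "T (S y) = y" for y
    using T(2) by (simp add: S_def surj_f_inv_f)
  have S: "norm (S u - S v) \<le> norm (u - v) / r" for u v
    using r[of "S u - S v"] \<open>r > 0\<close> by (simp add: T.diff field_simps)
  show "surj (\<lambda>x. T x + K x)"
  proof (rule surjI2)
    fix y
    have "\<exists>!x. S (y - K x) = x"
    proof (rule banach_fix_type)
      show "0 \<le> q / r" "q / r < 1" using q \<open>r > 0\<close> by auto
      have "dist (S (y - K u)) (S (y - K v)) \<le> q / r * dist u v" for u v
      proof -
        have "dist (S (y - K u)) (S (y - K v)) \<le> norm (K (v - u)) / r"
          using S[of "y - K u" "y - K v"] by (simp add: dist_norm K.diff)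
        also have "\<dots> \<le> q * norm (v - u) / r"
          using q(1) \<open>r > 0\<close> by (simp add: divide_right_mono)
        finally show ?thesis by (simp add: dist_norm norm_minus_commute)
      qed
      then show "\<forall>u v. dist (S (y - K u)) (S (y - K v)) \<le> q / r * dist u v" by blast
    qed
    then obtain x where "S (y - K x) = x" by blast
    then have "T x = y - K x" by (metis TS)
    then show "\<exists>x. y = T x + K x" by (intro exI[of _ x]) simp
  qed
qed

text \<open>The infinite matrix with rows \<open>R i\<close>. Its value is meaningful only if the
products with all rows form a square summable family, as they do under
\<open>near_identity\<close> below.\<close>

definition row_op :: "('i \<Rightarrow> 'i ell2) \<Rightarrow> 'i ell2 \<Rightarrow> 'i ell2" where
  "row_op R x = Abs_ell2 (\<lambda>i. dot (R i) x)"

text \<open>The Hilbert-Schmidt norm bounds the operator norm.\<close>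

lemma row_op_small:
  fixes D :: "'i \<Rightarrow> 'i ell2"
  assumes B: "\<And>F. finite F \<Longrightarrow> L2_set (\<lambda>i. norm (D i)) F \<le> B"
  shows "sqsum (\<lambda>i. dot (D i) x)" "bounded_linear (row_op D)" "norm (row_op D x) \<le> B * norm x"
proof -
  have *: "L2_set (\<lambda>i. cmod (dot (D i) x)) F \<le> B * norm x" if "finite F" for F x
  proof -
    have "L2_set (\<lambda>i. cmod (dot (D i) x)) F \<le> L2_set (\<lambda>i. norm (D i) * norm x) F"
      by (intro L2_set_mono cmod_dot_le) auto
    also have "\<dots> = L2_set (\<lambda>i. norm (D i)) F * norm x"
      by (simp add: L2_set_left_distrib)
    finally show ?thesis using B[OF that] by (meson mult_right_mono norm_ge_zero order_trans)
  qed
  then show s: "sqsum (\<lambda>i. dot (D i) x)" for x by (rule sqsumI)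
  show n: "norm (row_op D x) \<le> B * norm x" for x
    by (rule norm_ell2_leI) (use * s in \<open>simp add: row_op_def\<close>)
  show "bounded_linear (row_op D)"
  proof (rule bounded_linear_intro)
    show "norm (row_op D x) \<le> norm x * B" for x using n[of x] by (simp add: mult.commute)
  qed (auto intro!: ell2_eqI simp: row_op_def s sqsum_add sqsum_cmult dot_add_right dot_scaleR_right)
qed

text \<open>The identity plus a Hilbert-Schmidt operator.\<close>

definition near_identity :: "('i \<Rightarrow> 'i ell2) \<Rightarrow> bool" where
  "near_identity R \<longleftrightarrow> (\<lambda>i. (norm (R i - unit_vec i))\<^sup>2) summable_on UNIV"

lemma near_identity_row_op:
  assumes "near_identity R"
  shows "coord (row_op R x) i = dot (R i) x" "bounded_linear (row_op R)"
    "row_op R x = x + row_op (\<lambda>i. R i - unit_vec i) x"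
proof -
  obtain B where B: "\<And>F. finite F \<Longrightarrow> L2_set (\<lambda>i. norm (R i - unit_vec i)) F \<le> B"
    using assms unfolding near_identity_def summable_squares_iff by blast
  note s = row_op_small[OF B]
  have "sqsum (\<lambda>i. coord x i + dot (R i - unit_vec i) x)" for x
    by (rule sqsum_add[OF sqsum_coord s(1)])
  then have sq: "sqsum (\<lambda>i. dot (R i) x)" for x by (simp add: dot_diff_left)
  then show c: "coord (row_op R x) i = dot (R i) x" for x i by (simp add: row_op_def)
  show e: "row_op R x = x + row_op (\<lambda>i. R i - unit_vec i) x" for x
  proof (rule ell2_eqI)
    fix i
    have "coord (row_op (\<lambda>i. R i - unit_vec i) x) i = dot (R i - unit_vec i) x"
      unfolding row_op_def by (subst coord_Abs[OF s(1)]) simp_all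
    then show "coord (row_op R x) i = coord (x + row_op (\<lambda>i. R i - unit_vec i) x) i"
      by (simp add: c dot_diff_left)
  qed
  then have "row_op R = (\<lambda>x. x + row_op (\<lambda>i. R i - unit_vec i) x)" by blast
  then show "bounded_linear (row_op R)"
    using bounded_linear_add[OF bounded_linear_ident s(2)] by simp
qed

text \<open>The required \<open>\<epsilon>\<close> is half of the lower bound of the given operator.\<close>

lemma row_op_perturb:
  fixes R :: "'i \<Rightarrow> 'i ell2"
  assumes R: "near_identity R" "bdd_invertible (row_op R)"
  shows "\<exists>\<epsilon>>0. \<forall>R'. (\<forall>F. finite F \<longrightarrow> L2_set (\<lambda>i. norm (R' i - R i)) F \<le> \<epsilon>) \<longrightarrow>
            near_identity R' \<and> bdd_invertible (row_op R')"
proof -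
  obtain r where r: "r > 0" "\<And>x. r * norm x \<le> norm (row_op R x)"
    using R(2) unfolding bdd_invertible_def by blast
  show ?thesis
  proof (intro exI[of _ "r/2"] conjI allI impI)
    show "r / 2 > 0" using r by simp
    fix R' :: "'i \<Rightarrow> 'i ell2"
    assume small: "\<forall>F. finite F \<longrightarrow> L2_set (\<lambda>i. norm (R' i - R i)) F \<le> r / 2"
    then have small': "\<And>F. finite F \<Longrightarrow> L2_set (\<lambda>i. norm (R' i - R i)) F \<le> r / 2" by blast
    note D = row_op_small[OF small']
    obtain B where B: "\<And>F. finite F \<Longrightarrow> L2_set (\<lambda>i. norm (R i - unit_vec i)) F \<le> B"
      using R(1) unfolding near_identity_def summable_squares_iff by blast
    have "L2_set (\<lambda>i. norm (R' i - unit_vec i)) F \<le> r / 2 + B" if "finite F" for F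
    proof -
      have "norm (R' i - unit_vec i) \<le> norm (R' i - R i) + norm (R i - unit_vec i)" for i
        using norm_triangle_ineq[of "R' i - R i" "R i - unit_vec i"] by simp
      then have "L2_set (\<lambda>i. norm (R' i - unit_vec i)) F
          \<le> L2_set (\<lambda>i. norm (R' i - R i) + norm (R i - unit_vec i)) F"
        by (intro L2_set_mono) auto
      also have "\<dots> \<le> L2_set (\<lambda>i. norm (R' i - R i)) F + L2_set (\<lambda>i. norm (R i - unit_vec i)) F"
        by (rule L2_set_triangle_ineq)
      finally show ?thesis using small'[OF that] B[OF that] by linarith
    qed
    then show near: "near_identity R'"
      unfolding near_identity_def summable_squares_iff by blast
    have eq: "row_op R' = (\<lambda>x. row_op R x + row_op (\<lambda>i. R' i - R i) x)"
    proof (intro ext ell2_eqI)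
      fix x i
      have "coord (row_op (\<lambda>i. R' i - R i) x) i = dot (R' i - R i) x"
        unfolding row_op_def by (subst coord_Abs[OF D(1)]) simp_all
      then show "coord (row_op R' x) i = coord (row_op R x + row_op (\<lambda>i. R' i - R i) x) i"
        by (simp add: near_identity_row_op(1)[OF near] near_identity_row_op(1)[OF R(1)] dot_diff_left)
    qed
    show "bdd_invertible (row_op R')"
      unfolding eq
      by (rule bdd_invertible_perturb[where r=r and q="r/2"])
         (use R(2) D r in \<open>auto simp: bdd_invertible_def\<close>)
  qed
qed

text \<open>Adding a multiple of \<open>h\<close> to a vector changes only the equation number
\<open>i0\<close> of the old system. Since the new row does not annihilate
\<open>h\<close>, this multiple can be chosen so as to satisfy the new equation, and it
is controlled by the norm of the right-hand side.\<close>

lemma row_op_replace_row: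
  fixes R :: "'i \<Rightarrow> 'i ell2"
  assumes R: "near_identity R" "bdd_invertible (row_op R)"
    and R': "near_identity R'" "\<And>i. i \<noteq> i0 \<Longrightarrow> R' i = R i"
    and h: "row_op R h = unit_vec i0" "dot (R' i0) h \<noteq> 0"
  shows "bdd_invertible (row_op R')"
proof -
  note c = near_identity_row_op(1)[OF R(1)] and c' = near_identity_row_op(1)[OF R'(1)]
  have h_i: "dot (R i) h = (if i = i0 then 1 else 0)" for i
    using c[of h i] h(1) by auto
  obtain r where r: "r > 0" "\<And>x. r * norm x \<le> norm (row_op R x)"
    using R(2) unfolding bdd_invertible_def by blast
  define \<alpha> where "\<alpha> = dot (R' i0) h"
  have "surj (row_op R')"
  proof (rule surjI2)
    fix y
    obtain x where x: "row_op R x = y" using R(2) unfolding bdd_invertible_def by (metis surjD)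
    define x' where "x' = x + cscale ((coord y i0 - dot (R' i0) x) / \<alpha>) h"
    have "row_op R' x' = y"
    proof (rule ell2_eqI)
      fix i
      show "coord (row_op R' x') i = coord y i"
      proof (cases "i = i0")
        case True
        then show ?thesis
          using h(2) by (simp add: c' x'_def dot_add_right dot_cscale_right \<alpha>_def)
      next
        case False
        then show ?thesis
          using x by (auto simp: c' c R'(2) x'_def dot_add_right dot_cscale_right h_i)
      qed
    qed
    then show "\<exists>x. y = row_op R' x" by blast
  qed
  define C where "C = 1 / r + (1 + norm (R' i0) / r) / cmod \<alpha> * norm h"
  have "norm x \<le> C * norm (row_op R' x)" for x
  proof -
    define t where "t = dot (R i0) x"
    define u where "u = x - cscale t h"
    have cu: "coord (row_op R u) i = (if i = i0 then 0 else coord (row_op R' x) i)" for i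
      by (auto simp: c c' u_def dot_diff_right dot_cscale_right h_i t_def R'(2))
    have "norm (row_op R u) \<le> norm (row_op R' x)"
    proof (rule norm_ell2_leI)
      fix F :: "'i set" assume "finite F"
      have "L2_set (\<lambda>i. cmod (coord (row_op R u) i)) F \<le> L2_set (\<lambda>i. cmod (coord (row_op R' x) i)) F"
        by (intro L2_set_mono) (auto simp: cu)
      also have "\<dots> \<le> norm (row_op R' x)" by (rule L2_set_coord_le_norm) fact
      finally show "L2_set (\<lambda>i. cmod (coord (row_op R u) i)) F \<le> norm (row_op R' x)" .
    qed
    with r(2)[of u] have nu: "norm u \<le> norm (row_op R' x) / r"
      using r(1) by (simp add: field_simps)
    have "t * \<alpha> = coord (row_op R' x) i0 - dot (R' i0) u"
      by (simp add: c' u_def dot_diff_right dot_cscale_right \<alpha>_def)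
    then have "cmod t * cmod \<alpha> \<le> cmod (coord (row_op R' x) i0) + cmod (dot (R' i0) u)"
      by (metis norm_mult norm_triangle_ineq4)
    also have "\<dots> \<le> norm (row_op R' x) + norm (R' i0) * (norm (row_op R' x) / r)"
      by (intro add_mono cmod_coord_le_norm order_trans[OF cmod_dot_le] mult_left_mono nu) auto
    finally have t: "cmod t \<le> (1 + norm (R' i0) / r) / cmod \<alpha> * norm (row_op R' x)"
      using h(2) by (simp add: \<alpha>_def field_simps)
    have "norm x \<le> norm u + cmod t * norm h"
      using norm_triangle_ineq[of u "cscale t h"] by (simp add: u_def)
    also have "\<dots> \<le> norm (row_op R' x) / r + (1 + norm (R' i0) / r) / cmod \<alpha> * norm (row_op R' x) * norm h"
      by (intro add_mono nu mult_right_mono t) auto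
    finally show ?thesis by (simp add: C_def algebra_simps)
  qed
  moreover have "C > 0" using r(1) by (auto simp: C_def intro!: add_pos_nonneg)
  ultimately have "1 / C * norm x \<le> norm (row_op R' x)" for x
    by (simp add: field_simps)
  with \<open>C > 0\<close> \<open>surj (row_op R')\<close> near_identity_row_op(2)[OF R'(1)] show ?thesis
    by (intro bdd_invertibleI[where r="1/C"]) auto
qed

section \<open>Fourier series on the interval from -1 to 0\<close>

abbreviation unit_interval :: "real measure" where
  "unit_interval \<equiv> lebesgue_on {-1..0}"

abbreviation sq_int :: "(real \<Rightarrow> complex) \<Rightarrow> real" where
  "sq_int f \<equiv> LINT \<theta>|unit_interval. (cmod (f \<theta>))\<^sup>2"

interpretation I: finite_measure unit_interval
  by (rule finite_measure_lebesgue_on) simp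

lemma measure_unit_interval [simp]: "measure unit_interval {-1..0} = 1"
  by (simp add: measure_restrict_space)

lemma L2_fun_measurable: "L2_fun f \<Longrightarrow> f \<in> borel_measurable unit_interval"
  by (simp add: L2_fun_def)

lemma L2_fun_sq_integrable: "L2_fun f \<Longrightarrow> integrable unit_interval (\<lambda>\<theta>. (cmod (f \<theta>))\<^sup>2)"
  by (simp add: L2_fun_def)

lemma L2_fun_mult_bounded:
  assumes "L2_fun f" and g: "g \<in> borel_measurable unit_interval"
    and C: "\<And>\<theta>. \<theta> \<in> {-1..0} \<Longrightarrow> cmod (g \<theta>) \<le> C"
  shows "L2_fun (\<lambda>\<theta>. g \<theta> * f \<theta>)"
  unfolding L2_fun_def
proof
  note f = L2_fun_measurable[OF assms(1)]
  show m: "(\<lambda>\<theta>. g \<theta> * f \<theta>) \<in> borel_measurable unit_interval"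
    using f g by simp
  have "AE \<theta> in unit_interval. norm ((cmod (g \<theta> * f \<theta>))\<^sup>2) \<le> norm (C\<^sup>2 * (cmod (f \<theta>))\<^sup>2)"
    by (rule AE_I2) (auto simp: norm_mult power_mult_distrib intro!: mult_right_mono power_mono C)
  then show "integrable unit_interval (\<lambda>\<theta>. (cmod (g \<theta> * f \<theta>))\<^sup>2)"
    using m by (intro Bochner_Integration.integrable_bound[OF integrable_mult_right[OF L2_fun_sq_integrable[OF assms(1)], of "C\<^sup>2"]]) auto
qed

lemma continuous_bounded_unit_interval:
  fixes g :: "real \<Rightarrow> complex"
  assumes "continuous_on {-1..0} g"
  obtains C where "\<And>\<theta>. \<theta> \<in> {-1..0} \<Longrightarrow> cmod (g \<theta>) \<le> C"
  using compact_imp_bounded[OF compact_continuous_image[OF assms compact_Icc]] that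
  unfolding bounded_iff by blast

lemma continuous_measurable_unit_interval:
  fixes g :: "real \<Rightarrow> complex"
  assumes "continuous_on {-1..0} g"
  shows "g \<in> borel_measurable unit_interval"
  using continuous_imp_integrable_real[OF assms] by (rule borel_measurable_integrable)

lemma L2_fun_mult_continuous:
  assumes "L2_fun f" "continuous_on {-1..0} g"
  shows "L2_fun (\<lambda>\<theta>. g \<theta> * f \<theta>)"
  by (rule continuous_bounded_unit_interval[OF assms(2)])
     (rule L2_fun_mult_bounded[OF assms(1) continuous_measurable_unit_interval[OF assms(2)]])

lemma L2_fun_const [simp]: "L2_fun (\<lambda>_. c)"
  unfolding L2_fun_def by simp

lemma L2_fun_cmult: "L2_fun f \<Longrightarrow> L2_fun (\<lambda>\<theta>. c * f \<theta>)"
  by (rule L2_fun_mult_continuous) auto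

lemma L2_fun_continuous: "continuous_on {-1..0} g \<Longrightarrow> L2_fun g"
  using L2_fun_mult_continuous[of "\<lambda>_. 1" g] by simp

lemma L2_fun_add:
  assumes "L2_fun f" "L2_fun g"
  shows "L2_fun (\<lambda>\<theta>. f \<theta> + g \<theta>)"
  unfolding L2_fun_def
proof
  note m = L2_fun_measurable[OF assms(1)] L2_fun_measurable[OF assms(2)]
  show "(\<lambda>\<theta>. f \<theta> + g \<theta>) \<in> borel_measurable unit_interval" using m by simp
  have "(cmod (a + b))\<^sup>2 \<le> 2 * (cmod a)\<^sup>2 + 2 * (cmod b)\<^sup>2" for a b
  proof -
    have "(cmod (a + b))\<^sup>2 \<le> (cmod a + cmod b)\<^sup>2" by (simp add: norm_triangle_ineq power_mono)
    also have "\<dots> \<le> 2 * (cmod a)\<^sup>2 + 2 * (cmod b)\<^sup>2"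
      using sum_squares_bound[of "cmod a" "cmod b"] by (simp add: power2_sum)
    finally show ?thesis .
  qed
  then have *: "AE \<theta> in unit_interval. norm ((cmod (f \<theta> + g \<theta>))\<^sup>2)
      \<le> norm (2 * (cmod (f \<theta>))\<^sup>2 + 2 * (cmod (g \<theta>))\<^sup>2)"
    by (intro AE_I2) simp
  show "integrable unit_interval (\<lambda>\<theta>. (cmod (f \<theta> + g \<theta>))\<^sup>2)"
  proof (rule Bochner_Integration.integrable_bound[OF _ _ *])
    show "integrable unit_interval (\<lambda>\<theta>. 2 * (cmod (f \<theta>))\<^sup>2 + 2 * (cmod (g \<theta>))\<^sup>2)"
      by (intro Bochner_Integration.integrable_add integrable_mult_right L2_fun_sq_integrable assms)
    show "(\<lambda>\<theta>. (cmod (f \<theta> + g \<theta>))\<^sup>2) \<in> borel_measurable unit_interval"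
      using m by simp
  qed
qed

lemma L2_fun_diff: "L2_fun f \<Longrightarrow> L2_fun g \<Longrightarrow> L2_fun (\<lambda>\<theta>. f \<theta> - g \<theta>)"
  using L2_fun_add[of f "\<lambda>\<theta>. - 1 * g \<theta>"] L2_fun_cmult[of g "-1"] by simp

lemma L2_fun_sum: "(\<And>i. i \<in> A \<Longrightarrow> L2_fun (f i)) \<Longrightarrow> L2_fun (\<lambda>\<theta>. \<Sum>i\<in>A. f i \<theta>)"
  by (induction A rule: infinite_finite_induct) (auto intro: L2_fun_add)

lemma L2_fun_integrable:
  assumes "L2_fun f"
  shows "integrable unit_interval f"
proof -
  have "integrable unit_interval (\<lambda>\<theta>. 1 + (cmod (f \<theta>))\<^sup>2)"
    using assms by (simp add: L2_fun_sq_integrable)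
  moreover have "cmod w \<le> 1 + (cmod w)\<^sup>2" for w
  proof -
    have "2 * cmod w \<le> 1 + (cmod w)\<^sup>2" using sum_squares_bound[of 1 "cmod w"] by simp
    then show ?thesis using norm_ge_zero[of w] by linarith
  qed
  ultimately show ?thesis
    using L2_fun_measurable[OF assms]
    by (rule_tac Bochner_Integration.integrable_bound) auto
qed

text \<open>The variance of \<open>|f|\<close> on an interval of length one is nonnegative.\<close>

lemma L1_le_L2:
  assumes "L2_fun f"
  shows "(LINT \<theta>|unit_interval. cmod (f \<theta>))\<^sup>2 \<le> sq_int f"
proof -
  define a where "a = (LINT \<theta>|unit_interval. cmod (f \<theta>))"
  note [simp] = L2_fun_sq_integrable[OF assms] integrable_norm[OF L2_fun_integrable[OF assms]]
  have "0 \<le> (LINT \<theta>|unit_interval. (cmod (f \<theta>) - a)\<^sup>2)" by simp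
  also have "\<dots> = (LINT \<theta>|unit_interval. (cmod (f \<theta>))\<^sup>2 - 2 * a * cmod (f \<theta>) + a\<^sup>2)"
    by (simp add: power2_diff algebra_simps)
  also have "\<dots> = sq_int f - 2 * a * a + a\<^sup>2"
    by (simp add: a_def)
  finally show ?thesis by (simp add: a_def power2_eq_square)
qed

text \<open>For a function on \<open>[-1, 0]\<close> this is its two-sided Laplace transform at
\<open>- s\<close>; at the points \<open>s = 2\<pi>ij\<close> its values are the Fourier
coefficients.\<close>

definition laplace :: "(real \<Rightarrow> complex) \<Rightarrow> complex \<Rightarrow> complex" where
  "laplace f s = (LINT \<theta>|unit_interval. exp (s * of_real \<theta>) * f \<theta>)"

lemma L2_fun_exp_mult: "L2_fun f \<Longrightarrow> L2_fun (\<lambda>\<theta>. exp (s * of_real \<theta>) * f \<theta>)"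
  by (rule L2_fun_mult_continuous) (auto intro!: continuous_intros)

lemma laplace_add: "L2_fun f \<Longrightarrow> L2_fun g \<Longrightarrow> laplace (\<lambda>\<theta>. f \<theta> + g \<theta>) s = laplace f s + laplace g s"
  by (simp add: laplace_def distrib_left L2_fun_integrable L2_fun_exp_mult)

lemma laplace_diff: "L2_fun f \<Longrightarrow> L2_fun g \<Longrightarrow> laplace (\<lambda>\<theta>. f \<theta> - g \<theta>) s = laplace f s - laplace g s"
  by (simp add: laplace_def right_diff_distrib L2_fun_integrable L2_fun_exp_mult)

lemma laplace_cmult: "laplace (\<lambda>\<theta>. c * f \<theta>) s = c * laplace f s"
  by (simp add: laplace_def mult.left_commute)

lemma laplace_sum:
  "(\<And>i. i \<in> A \<Longrightarrow> L2_fun (f i)) \<Longrightarrow> laplace (\<lambda>\<theta>. \<Sum>i\<in>A. f i \<theta>) s = (\<Sum>i\<in>A. laplace (f i) s)"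
  by (simp add: laplace_def sum_distrib_left L2_fun_integrable L2_fun_exp_mult)

lemma laplace_exp_mult: "laplace (\<lambda>\<theta>. exp (t * of_real \<theta>) * f \<theta>) s = laplace f (s + t)"
  by (simp add: laplace_def exp_add distrib_right mult.assoc)

lemma cmod_exp_le:
  assumes "\<theta> \<in> {-1..0}"
  shows "cmod (exp (s * of_real \<theta>)) \<le> exp \<bar>Re s\<bar>"
proof -
  have "Re s * \<theta> \<le> \<bar>Re s * \<theta>\<bar>" by simp
  also have "\<dots> = \<bar>Re s\<bar> * \<bar>\<theta>\<bar>" by (simp add: abs_mult)
  also have "\<dots> \<le> \<bar>Re s\<bar> * 1" using assms by (intro mult_left_mono) auto
  finally show ?thesis by simp
qed

lemma cmod_laplace_le:
  assumes "L2_fun f"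
  shows "cmod (laplace f s) \<le> exp \<bar>Re s\<bar> * sqrt (sq_int f)"
proof -
  have "cmod (laplace f s) \<le> (LINT \<theta>|unit_interval. cmod (exp (s * of_real \<theta>) * f \<theta>))"
    unfolding laplace_def by (rule integral_norm_bound)
  also have "\<dots> \<le> (LINT \<theta>|unit_interval. exp \<bar>Re s\<bar> * cmod (f \<theta>))"
  proof (rule integral_mono)
    show "integrable unit_interval (\<lambda>\<theta>. cmod (exp (s * of_real \<theta>) * f \<theta>))"
      by (intro integrable_norm L2_fun_integrable L2_fun_exp_mult assms)
    show "integrable unit_interval (\<lambda>\<theta>. exp \<bar>Re s\<bar> * cmod (f \<theta>))"
      by (intro integrable_mult_right integrable_norm L2_fun_integrable assms)
    show "cmod (exp (s * of_real \<theta>) * f \<theta>) \<le> exp \<bar>Re s\<bar> * cmod (f \<theta>)"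
      if "\<theta> \<in> space unit_interval" for \<theta>
      using cmod_exp_le[of \<theta> s] that by (auto simp: norm_mult intro!: mult_right_mono)
  qed
  also have "\<dots> = exp \<bar>Re s\<bar> * (LINT \<theta>|unit_interval. cmod (f \<theta>))" by simp
  also have "\<dots> \<le> exp \<bar>Re s\<bar> * sqrt (sq_int f)"
    using L1_le_L2[OF assms] by (intro mult_left_mono real_le_rsqrt) auto
  finally show ?thesis .
qed

definition freq :: "int \<Rightarrow> complex" where
  "freq j = \<i> * of_real (2 * pi * of_int j)"

lemma freq_eq_iff [simp]: "freq j = freq k \<longleftrightarrow> j = k"
  by (simp add: freq_def)

lemma exp_freq [simp]: "exp (freq j) = 1"
  unfolding freq_def exp_eq_1 by auto

lemma freq_add: "freq (j + k) = freq j + freq k"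
  by (simp add: freq_def algebra_simps)

lemma freq_minus: "freq (- k) = - freq k"
  by (simp add: freq_def)

lemma Re_freq [simp]: "Re (freq j) = 0" by (simp add: freq_def)

lemma cnj_exp_freq: "cnj (exp (freq j * of_real \<theta>)) = exp (- freq j * of_real \<theta>)"
  by (simp add: exp_cnj freq_def)

lemma cmod_exp_freq [simp]: "cmod (exp (freq j * of_real \<theta>)) = 1"
  by (simp add: freq_def norm_exp_eq_Re)

text \<open>The transform of the \<open>j\<close>-th exponential
\<open>e\<^bsup>-2\<pi>ij\<theta>\<^esup>\<close>, as shown in
\<open>cauchy_kernel_eq_laplace\<close>. In the variable \<open>2\<pi>ij\<close> it is a
Cauchy kernel, which is what makes partial fractions applicable.\<close>

definition cauchy_kernel :: "int \<Rightarrow> complex \<Rightarrow> complex" where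
  "cauchy_kernel j s = (if s = freq j then 1 else (1 - exp (- s)) / (s - freq j))"

lemma cauchy_kernel_freq [simp]: "cauchy_kernel j (freq k) = (if j = k then 1 else 0)"
  by (simp add: cauchy_kernel_def exp_minus)

lemma laplace_const_one: "laplace (\<lambda>_. 1) s = (if s = 0 then 1 else (1 - exp (- s)) / s)"
proof (cases "s = 0")
  case True
  then show ?thesis by (simp add: laplace_def)
next
  case False
  have "((\<lambda>\<theta>. exp (s * of_real \<theta>)) has_integral
      exp (s * of_real 0) / s - exp (s * of_real (-1)) / s) {-1..0}"
    by (rule fundamental_theorem_of_calculus)
       (use False in \<open>auto intro!: derivative_eq_intros has_vector_derivative_real_field simp: field_simps\<close>)
  moreover have "laplace (\<lambda>_. 1) s = integral {-1..0} (\<lambda>\<theta>. exp (s * of_real \<theta>))"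
    unfolding laplace_def
    by (subst lebesgue_integral_eq_integral) (auto intro!: continuous_imp_integrable_real continuous_intros)
  ultimately show ?thesis using False by (simp add: integral_unique diff_divide_distrib)
qed

lemma cauchy_kernel_eq_laplace: "cauchy_kernel j s = laplace (\<lambda>\<theta>. exp (- freq j * of_real \<theta>)) s"
proof -
  have "exp (- (s - freq j)) = exp (- s)"
    by (simp add: exp_diff exp_minus inverse_eq_divide)
  moreover have "laplace (\<lambda>\<theta>. exp (- freq j * of_real \<theta>)) s = laplace (\<lambda>_. 1) (s - freq j)"
    using laplace_exp_mult[of "- freq j" "\<lambda>_. 1" s] by simp
  ultimately show ?thesis by (auto simp: laplace_const_one cauchy_kernel_def)
qed

definition trig_poly :: "int set \<Rightarrow> (int \<Rightarrow> complex) \<Rightarrow> real \<Rightarrow> complex" where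
  "trig_poly F c \<theta> = (\<Sum>j\<in>F. c j * exp (- freq j * of_real \<theta>))"

lemma L2_fun_trig_poly: "L2_fun (trig_poly F c)"
  unfolding trig_poly_def by (intro L2_fun_continuous continuous_intros)

lemma laplace_trig_poly: "laplace (trig_poly F c) s = (\<Sum>j\<in>F. c j * cauchy_kernel j s)"
proof -
  have "laplace (trig_poly F c) s = (\<Sum>j\<in>F. laplace (\<lambda>\<theta>. c j * exp (- freq j * of_real \<theta>)) s)"
    unfolding trig_poly_def by (rule laplace_sum) (intro L2_fun_continuous continuous_intros)
  then show ?thesis by (simp add: laplace_cmult cauchy_kernel_eq_laplace)
qed

lemma integral_mult_cnj_trig_poly:
  assumes "L2_fun f"
  shows "(LINT \<theta>|unit_interval. f \<theta> * cnj (trig_poly F c \<theta>)) = (\<Sum>j\<in>F. cnj (c j) * laplace f (freq j))"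
proof -
  have "f \<theta> * cnj (trig_poly F c \<theta>) = (\<Sum>j\<in>F. cnj (c j) * (exp (freq j * of_real \<theta>) * f \<theta>))" for \<theta>
    by (simp add: trig_poly_def sum_distrib_left exp_cnj freq_def mult_ac)
  then show ?thesis
    using L2_fun_integrable[OF L2_fun_exp_mult[OF assms]]
    by (simp add: laplace_def)
qed

lemma sq_int_eq: "of_real (sq_int f) = (LINT \<theta>|unit_interval. f \<theta> * cnj (f \<theta>))"
  by (simp flip: integral_complex_of_real add: complex_norm_square del: of_real_power)

lemma sq_int_trig_poly:
  assumes "finite F"
  shows "sq_int (trig_poly F c) = (\<Sum>j\<in>F. (cmod (c j))\<^sup>2)"
proof -
  have "of_real (sq_int (trig_poly F c)) = (\<Sum>j\<in>F. cnj (c j) * laplace (trig_poly F c) (freq j))"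
    unfolding sq_int_eq by (rule integral_mult_cnj_trig_poly[OF L2_fun_trig_poly])
  also have "\<dots> = (\<Sum>j\<in>F. cnj (c j) * c j)"
    using assms by (intro sum.cong) (auto simp: laplace_trig_poly if_distrib[of "(*) _"] cong: if_cong)
  also have "\<dots> = of_real (\<Sum>j\<in>F. (cmod (c j))\<^sup>2)"
    by (simp add: complex_norm_square mult.commute del: of_real_power)
  finally show ?thesis by (simp only: of_real_eq_iff)
qed

text \<open>The remainder \<open>r\<close> of the Fourier sum \<open>p\<close> is orthogonal to
\<open>p\<close>, so \<open>\<parallel>f\<parallel>\<^sup>2 =
\<parallel>r\<parallel>\<^sup>2 + \<parallel>p\<parallel>\<^sup>2\<close>.\<close>

lemma bessel:
  assumes f: "L2_fun f" and "finite F"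
  shows "(\<Sum>j\<in>F. (cmod (laplace f (freq j)))\<^sup>2) \<le> sq_int f"
proof -
  define p where "p = trig_poly F (\<lambda>j. laplace f (freq j))"
  define r where "r = (\<lambda>\<theta>. f \<theta> - p \<theta>)"
  have p: "L2_fun p" unfolding p_def by (rule L2_fun_trig_poly)
  have r: "L2_fun r" unfolding r_def by (intro L2_fun_diff f p)
  have cont: "continuous_on {-1..0} (\<lambda>\<theta>. cnj (p \<theta>))"
    unfolding p_def trig_poly_def by (intro continuous_intros)
  have int: "integrable unit_interval (\<lambda>\<theta>. r \<theta> * cnj (p \<theta>))"
    using L2_fun_integrable[OF L2_fun_mult_continuous[OF r cont]] by (simp add: mult.commute)
  have "laplace r (freq j) = 0" if "j \<in> F" for j
    using that \<open>finite F\<close> unfolding r_def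
    by (simp add: laplace_diff f L2_fun_trig_poly p_def laplace_trig_poly if_distrib[of "(*) _"] cong: if_cong)
  then have 0: "(LINT \<theta>|unit_interval. r \<theta> * cnj (p \<theta>)) = 0"
    unfolding p_def integral_mult_cnj_trig_poly[OF r] by simp
  define q where "q = (\<lambda>\<theta>. r \<theta> * cnj (p \<theta>))"
  have "(cmod (f \<theta>))\<^sup>2 = (cmod (r \<theta>))\<^sup>2 + (cmod (p \<theta>))\<^sup>2 + 2 * Re (q \<theta>)" for \<theta>
    unfolding r_def q_def cmod_power2 by (simp add: power2_eq_square algebra_simps)
  moreover have "integrable unit_interval (\<lambda>\<theta>. Re (q \<theta>))"
    "(LINT \<theta>|unit_interval. Re (q \<theta>)) = 0"
    using int 0 integral_Re[OF int] by (simp_all only: q_def integrable_Re zero_complex.sel)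
  ultimately have "sq_int f = sq_int r + sq_int p"
    by (simp add: L2_fun_sq_integrable r p)
  moreover have "0 \<le> sq_int r" by simp
  ultimately have "sq_int p \<le> sq_int f" by simp
  then show ?thesis using sq_int_trig_poly[OF \<open>finite F\<close>] by (simp add: p_def)
qed

text \<open>A subsequence whose increments have \<open>L\<^sub>2\<close>-norms below a geometric
sequence converges almost everywhere, because the sum of the increments converges
absolutely in \<open>L\<^sub>1\<close>. Fatou's lemma turns its pointwise limit into a
limit in \<open>L\<^sub>2\<close> of the whole sequence.\<close>

lemma L2_complete:
  fixes u :: "nat \<Rightarrow> real \<Rightarrow> complex"
  assumes u: "\<And>n. L2_fun (u n)"
    and cauchy: "\<And>e. e > 0 \<Longrightarrow> \<exists>N. \<forall>m\<ge>N. \<forall>n\<ge>N. sq_int (\<lambda>\<theta>. u m \<theta> - u n \<theta>) < e"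
  shows "\<exists>f. L2_fun f \<and> (\<lambda>n. sq_int (\<lambda>\<theta>. u n \<theta> - f \<theta>)) \<longlonglongrightarrow> 0"
proof -
  have "\<exists>r. \<forall>k. (\<forall>m\<ge>r k. \<forall>n\<ge>r k. sq_int (\<lambda>\<theta>. u m \<theta> - u n \<theta>) < (1/4)^k) \<and> r k < r (Suc k)"
  proof (rule dependent_nat_choice)
    show "\<exists>x. \<forall>m\<ge>x. \<forall>n\<ge>x. sq_int (\<lambda>\<theta>. u m \<theta> - u n \<theta>) < (1/4)^0"
      by (rule cauchy) simp
    fix x k :: nat
    obtain N where "\<forall>m\<ge>N. \<forall>n\<ge>N. sq_int (\<lambda>\<theta>. u m \<theta> - u n \<theta>) < (1/4)^Suc k"
      using cauchy[of "(1/4)^Suc k"] by auto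
    then show "\<exists>y. (\<forall>m\<ge>y. \<forall>n\<ge>y. sq_int (\<lambda>\<theta>. u m \<theta> - u n \<theta>) < (1/4)^Suc k) \<and> x < y"
      by (intro exI[of _ "max N (Suc x)"]) auto
  qed
  then obtain r where r: "\<And>k m n. m \<ge> r k \<Longrightarrow> n \<ge> r k \<Longrightarrow> sq_int (\<lambda>\<theta>. u m \<theta> - u n \<theta>) < (1/4)^k"
    and mono: "\<And>k. r k < r (Suc k)"
    by blast
  have sm: "strict_mono r" using mono by (simp add: strict_mono_Suc_iff)
  define v where "v = (\<lambda>k \<theta>. u (r (Suc k)) \<theta> - u (r k) \<theta>)"
  have v: "L2_fun (v k)" for k unfolding v_def by (intro L2_fun_diff u)
  have v_bound: "(LINT \<theta>|unit_interval. cmod (v k \<theta>)) \<le> (1/2)^k" for k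
  proof -
    have "(LINT \<theta>|unit_interval. cmod (v k \<theta>))\<^sup>2 \<le> sq_int (v k)" by (rule L1_le_L2[OF v])
    also have "\<dots> \<le> (1/4)^k" using r[of k "r (Suc k)" "r k"] mono[of k] by (simp add: v_def)
    also have "\<dots> = ((1/2)^k)\<^sup>2" by (simp add: power2_eq_square flip: power_mult_distrib)
    finally show ?thesis by (rule power2_le_imp_le) simp
  qed
  have um: "u n \<in> borel_measurable unit_interval" for n by (rule L2_fun_measurable[OF u])
  note [measurable] = um L2_fun_measurable[OF v]
  have "(\<integral>\<^sup>+\<theta>. (\<Sum>k. ennreal (cmod (v k \<theta>))) \<partial>unit_interval)
      = (\<Sum>k. ennreal (LINT \<theta>|unit_interval. cmod (v k \<theta>)))"
    by (simp add: nn_integral_suminf nn_integral_eq_integral integrable_norm[OF L2_fun_integrable[OF v]])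
  moreover have "summable (\<lambda>k. LINT \<theta>|unit_interval. cmod (v k \<theta>))"
    by (rule summable_comparison_test'[of "\<lambda>k. (1/2::real)^k" 0]) (use v_bound in auto)
  ultimately have "(\<integral>\<^sup>+\<theta>. (\<Sum>k. ennreal (cmod (v k \<theta>))) \<partial>unit_interval) \<noteq> \<infinity>"
    by (simp add: ennreal_suminf_neq_top)
  then have "AE \<theta> in unit_interval. (\<Sum>k. ennreal (cmod (v k \<theta>))) \<noteq> \<infinity>"
    by (intro nn_integral_PInf_AE) auto
  then have conv: "AE \<theta> in unit_interval. convergent (\<lambda>k. u (r k) \<theta>)"
  proof eventually_elim
    case (elim \<theta>)
    then have "summable (\<lambda>k. cmod (v k \<theta>))" by (intro summable_suminf_not_top) auto
    then have "summable (\<lambda>k. v k \<theta>)" by (rule summable_norm_cancel)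
    then have "convergent (\<lambda>n. u (r 0) \<theta> + (\<Sum>k<n. v k \<theta>))"
      by (intro convergent_add convergent_const) (simp add: summable_iff_convergent)
    moreover have "u (r 0) \<theta> + (\<Sum>k<n. v k \<theta>) = u (r n) \<theta>" for n
      unfolding v_def using sum_lessThan_telescope[of "\<lambda>k. u (r k) \<theta>" n] by simp
    ultimately show ?case by simp
  qed
  define f where "f = (\<lambda>\<theta>. lim (\<lambda>k. u (r k) \<theta>))"
  have fm [measurable]: "f \<in> borel_measurable unit_interval"
    unfolding f_def by measurable
  \<comment> \<open>the pointwise limit of the squared distances to the subsequence is bounded by Fatou's lemma\<close>
  have fatou: "(\<integral>\<^sup>+\<theta>. ennreal ((cmod (u n \<theta> - f \<theta>))\<^sup>2) \<partial>unit_interval) \<le> ennreal ((1/4)^k)"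
    if "n \<ge> r k" for n k
  proof -
    have "(\<integral>\<^sup>+\<theta>. ennreal ((cmod (u n \<theta> - f \<theta>))\<^sup>2) \<partial>unit_interval)
        = (\<integral>\<^sup>+\<theta>. liminf (\<lambda>i. ennreal ((cmod (u n \<theta> - u (r i) \<theta>))\<^sup>2)) \<partial>unit_interval)"
    proof (rule nn_integral_cong_AE)
      show "AE \<theta> in unit_interval. ennreal ((cmod (u n \<theta> - f \<theta>))\<^sup>2)
          = liminf (\<lambda>i. ennreal ((cmod (u n \<theta> - u (r i) \<theta>))\<^sup>2))"
        using conv
      proof eventually_elim
        case (elim \<theta>)
        then have "(\<lambda>k. u (r k) \<theta>) \<longlonglongrightarrow> f \<theta>" by (simp add: f_def convergent_LIMSEQ_iff)
        then have "(\<lambda>i. ennreal ((cmod (u n \<theta> - u (r i) \<theta>))\<^sup>2)) \<longlonglongrightarrow> ennreal ((cmod (u n \<theta> - f \<theta>))\<^sup>2)"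
          by (intro tendsto_ennrealI tendsto_intros)
        then show ?case by (rule lim_imp_Liminf[symmetric, rotated]) simp
      qed
    qed
    also have "\<dots> \<le> liminf (\<lambda>i. \<integral>\<^sup>+\<theta>. ennreal ((cmod (u n \<theta> - u (r i) \<theta>))\<^sup>2) \<partial>unit_interval)"
      by (rule nn_integral_liminf) measurable
    also have "\<dots> \<le> ennreal ((1/4)^k)"
    proof (rule Liminf_le)
      show "\<forall>\<^sub>F i in sequentially. (\<integral>\<^sup>+\<theta>. ennreal ((cmod (u n \<theta> - u (r i) \<theta>))\<^sup>2) \<partial>unit_interval) \<le> ennreal ((1/4)^k)"
        using eventually_ge_at_top[of k]
      proof eventually_elim
        case (elim i)
        then have "r i \<ge> r k" using sm by (simp add: strict_mono_less_eq)
        then have "sq_int (\<lambda>\<theta>. u n \<theta> - u (r i) \<theta>) \<le> (1/4)^k" using r[OF that] by (simp add: less_imp_le)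
        moreover have "(\<integral>\<^sup>+\<theta>. ennreal ((cmod (u n \<theta> - u (r i) \<theta>))\<^sup>2) \<partial>unit_interval)
            = ennreal (sq_int (\<lambda>\<theta>. u n \<theta> - u (r i) \<theta>))"
          by (rule nn_integral_eq_integral) (auto intro!: L2_fun_sq_integrable L2_fun_diff u)
        ultimately show ?case by (simp add: ennreal_leI)
      qed
    qed simp
    finally show ?thesis .
  qed
  have diff: "L2_fun (\<lambda>\<theta>. u n \<theta> - f \<theta>)" "sq_int (\<lambda>\<theta>. u n \<theta> - f \<theta>) \<le> (1/4)^k" if "n \<ge> r k" for n k
  proof -
    show 1: "L2_fun (\<lambda>\<theta>. u n \<theta> - f \<theta>)"
      unfolding L2_fun_def
      using fatou[OF that] by (auto intro!: integrableI_bounded simp: le_less_trans[OF _ ennreal_less_top])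
    show "sq_int (\<lambda>\<theta>. u n \<theta> - f \<theta>) \<le> (1/4)^k"
      using fatou[OF that] nn_integral_eq_integral[OF L2_fun_sq_integrable[OF 1]] by simp
  qed
  have "L2_fun (\<lambda>\<theta>. u (r 0) \<theta> - (u (r 0) \<theta> - f \<theta>))"
    by (rule L2_fun_diff[OF u diff(1)[OF order_refl]])
  then have "L2_fun f" by simp
  moreover have "(\<lambda>n. sq_int (\<lambda>\<theta>. u n \<theta> - f \<theta>)) \<longlonglongrightarrow> 0"
  proof (rule LIMSEQ_I)
    fix e :: real assume "e > 0"
    then obtain k where "(1/4::real)^k < e" using real_arch_pow_inv[of e "1/4"] by auto
    then have "norm (sq_int (\<lambda>\<theta>. u n \<theta> - f \<theta>) - 0) < e" if "n \<ge> r k" for n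
      using diff(2)[OF that] by simp
    then show "\<exists>N. \<forall>n\<ge>N. norm (sq_int (\<lambda>\<theta>. u n \<theta> - f \<theta>) - 0) < e" by blast
  qed
  ultimately show ?thesis by blast
qed

lemma laplace_tendsto:
  assumes u: "\<And>n. L2_fun (u n)" and f: "L2_fun f"
    and lim: "(\<lambda>n. sq_int (\<lambda>\<theta>. u n \<theta> - f \<theta>)) \<longlonglongrightarrow> 0"
  shows "(\<lambda>n. laplace (u n) s) \<longlonglongrightarrow> laplace f s"
proof -
  have "(\<lambda>n. laplace (u n) s - laplace f s) \<longlonglongrightarrow> 0"
  proof (rule Lim_null_comparison)
    have "(\<lambda>n. exp \<bar>Re s\<bar> * sqrt (sq_int (\<lambda>\<theta>. u n \<theta> - f \<theta>))) \<longlonglongrightarrow> exp \<bar>Re s\<bar> * sqrt 0"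
      by (intro tendsto_intros lim)
    then show "(\<lambda>n. exp \<bar>Re s\<bar> * sqrt (sq_int (\<lambda>\<theta>. u n \<theta> - f \<theta>))) \<longlonglongrightarrow> 0" by simp
    show "\<forall>\<^sub>F n in sequentially. norm (laplace (u n) s - laplace f s)
        \<le> exp \<bar>Re s\<bar> * sqrt (sq_int (\<lambda>\<theta>. u n \<theta> - f \<theta>))"
      using cmod_laplace_le[OF L2_fun_diff[OF u f]] by (simp add: laplace_diff u f)
  qed
  then show ?thesis by (simp add: LIM_zero_iff)
qed

lemma sqsum_laplace_freq:
  assumes "L2_fun f"
  shows "sqsum (\<lambda>j. laplace f (freq j))"
  by (rule sqsumI[where B="sqrt (sq_int f)"])
     (simp add: L2_set_def bessel[OF assms])

lemma laplace_exp_freq: "laplace (\<lambda>\<theta>. exp (s * of_real \<theta>)) (freq j) = cauchy_kernel (- j) s"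
  by (simp add: cauchy_kernel_eq_laplace laplace_def freq_minus mult.commute)

lemma sqsum_cauchy_kernel: "sqsum (\<lambda>j. cauchy_kernel j s)"
proof -
  have "L2_fun (\<lambda>\<theta>. exp (s * of_real \<theta>))" by (intro L2_fun_continuous continuous_intros)
  then have "sqsum (\<lambda>j. cauchy_kernel (- j) s)"
    using sqsum_laplace_freq by (simp flip: laplace_exp_freq)
  then obtain B where B: "\<And>F. finite F \<Longrightarrow> L2_set (\<lambda>j. cmod (cauchy_kernel (- j) s)) F \<le> B"
    by (rule sqsumE) blast
  have "L2_set (\<lambda>j. cmod (cauchy_kernel j s)) F \<le> B" if "finite F" for F
    using B[of "uminus ` F"] that by (simp add: L2_set_def sum.reindex)
  then show ?thesis by (rule sqsumI)
qed

text \<open>Symmetric intervals exhaust the integers.\<close>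

lemma tendsto_infsum_int:
  fixes f :: "int \<Rightarrow> 'a :: {comm_monoid_add, t2_space}"
  assumes "f summable_on UNIV"
  shows "(\<lambda>n. \<Sum>j\<in>{-int n..int n}. f j) \<longlonglongrightarrow> infsum f UNIV"
proof (rule filterlim_compose[of "sum f" _ "finite_subsets_at_top UNIV"])
  show "(sum f \<longlongrightarrow> infsum f UNIV) (finite_subsets_at_top UNIV)"
    using assms has_sum_infsum[of f UNIV] by (simp add: has_sum_def)
  show "filterlim (\<lambda>n. {-int n..int n}) (finite_subsets_at_top UNIV) sequentially"
    unfolding filterlim_finite_subsets_at_top
  proof (intro allI impI)
    fix X :: "int set" assume "finite X \<and> X \<subseteq> UNIV"
    then have "\<bar>x\<bar> \<le> (\<Sum>x\<in>X. \<bar>x\<bar>)" if "x \<in> X" for x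
      using that by (intro member_le_sum[of x X abs]) auto
    then have "X \<subseteq> {-int n..int n}" if "n \<ge> nat (\<Sum>x\<in>X. \<bar>x\<bar>)" for n
      using that by fastforce
    then show "\<forall>\<^sub>F n in sequentially. finite {-int n..int n} \<and> X \<subseteq> {-int n..int n} \<and> {-int n..int n} \<subseteq> UNIV"
      by (auto simp: eventually_sequentially)
  qed
qed

text \<open>The partial sums of the series with coefficients \<open>c\<close> form a Cauchy sequence
in \<open>L\<^sub>2\<close>. The conclusion records the transform of the limit at every
\<open>s\<close>, not only at the points \<open>2\<pi>ij\<close>, since the nodes of the
moment problem need not lie on this lattice.\<close>

lemma riesz_fischer:
  assumes c: "sqsum c"
  shows "\<exists>f. L2_fun f \<and> (\<forall>s. laplace f s = (\<Sum>\<^sub>\<infinity>j. c j * cauchy_kernel j s))"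
proof -
  define p where "p = (\<lambda>n. trig_poly {-int n..int n} c)"
  have p: "L2_fun (p n)" for n unfolding p_def by (rule L2_fun_trig_poly)
  define S where "S = (\<lambda>n. \<Sum>j\<in>{-int n..int n}. (cmod (c j))\<^sup>2)"
  have S: "S \<longlonglongrightarrow> (\<Sum>\<^sub>\<infinity>j. (cmod (c j))\<^sup>2)"
    unfolding S_def using c by (intro tendsto_infsum_int) (simp add: sqsum_def)
  have le: "sq_int (\<lambda>\<theta>. p m \<theta> - p n \<theta>) = \<bar>S m - S n\<bar>" for m n
  proof (induction m n rule: linorder_wlog)
    case (le m n)
    have sub: "{-int m..int m} \<subseteq> {-int n..int n}" using le by auto
    define D where "D = {-int n..int n} - {-int m..int m}"
    have "p n \<theta> - p m \<theta> = trig_poly D c \<theta>" for \<theta>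
      unfolding p_def trig_poly_def D_def by (subst sum_diff[OF _ sub]) auto
    then have "cmod (p m \<theta> - p n \<theta>) = cmod (trig_poly D c \<theta>)" for \<theta>
      by (metis norm_minus_commute)
    then have "sq_int (\<lambda>\<theta>. p m \<theta> - p n \<theta>) = (\<Sum>j\<in>D. (cmod (c j))\<^sup>2)"
      by (simp add: sq_int_trig_poly D_def)
    also have "\<dots> = S n - S m" unfolding S_def D_def by (subst sum_diff[OF _ sub]) auto
    finally have eq: "sq_int (\<lambda>\<theta>. p m \<theta> - p n \<theta>) = S n - S m" .
    moreover have "0 \<le> sq_int (\<lambda>\<theta>. p m \<theta> - p n \<theta>)" by simp
    ultimately show ?case by simp
  next
    case (sym m n)
    then show ?case by (simp add: norm_minus_commute abs_minus_commute)
  qed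
  have "\<exists>f. L2_fun f \<and> (\<lambda>n. sq_int (\<lambda>\<theta>. p n \<theta> - f \<theta>)) \<longlonglongrightarrow> 0"
  proof (rule L2_complete[OF p])
    fix e :: real assume "e > 0"
    then show "\<exists>N. \<forall>m\<ge>N. \<forall>n\<ge>N. sq_int (\<lambda>\<theta>. p m \<theta> - p n \<theta>) < e"
      using LIMSEQ_imp_Cauchy[OF S] unfolding le Cauchy_def dist_real_def by blast
  qed
  then obtain f where f: "L2_fun f" "(\<lambda>n. sq_int (\<lambda>\<theta>. p n \<theta> - f \<theta>)) \<longlonglongrightarrow> 0" by blast
  have "laplace f s = (\<Sum>\<^sub>\<infinity>j. c j * cauchy_kernel j s)" for s
  proof (rule LIMSEQ_unique)
    show "(\<lambda>n. laplace (p n) s) \<longlonglongrightarrow> laplace f s" by (rule laplace_tendsto[OF p f])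
    have "(\<lambda>j. c j * cauchy_kernel j s) summable_on UNIV"
      using dot_summable[of "Abs_ell2 c" "Abs_ell2 (\<lambda>j. cauchy_kernel j s)"]
      by (simp add: c sqsum_cauchy_kernel)
    then show "(\<lambda>n. laplace (p n) s) \<longlonglongrightarrow> (\<Sum>\<^sub>\<infinity>j. c j * cauchy_kernel j s)"
      unfolding p_def laplace_trig_poly by (rule tendsto_infsum_int)
  qed
  with f(1) show ?thesis by blast
qed

text \<open>On the unit circle a real-linear function of \<open>w\<close> is a combination of
\<open>w\<close> and \<open>w\<^sup>-\<^sup>1\<close>. Multiplication by \<open>w =
e\<^bsup>2\<pi>i\<theta>\<^esup>\<close> or its inverse only shifts the Fourier
coefficients, so the space of functions with vanishing coefficients is closed under
multiplication by polynomials in the real and imaginary part of \<open>w\<close>.\<close>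

lemma laplace_mult_real_polynomial_eq_0:
  assumes "real_polynomial_function p" "L2_fun f" "\<And>j. laplace f (freq j) = 0"
  shows "L2_fun (\<lambda>\<theta>. of_real (p (exp (freq 1 * of_real \<theta>))) * f \<theta>)
    \<and> (\<forall>j. laplace (\<lambda>\<theta>. of_real (p (exp (freq 1 * of_real \<theta>))) * f \<theta>) (freq j) = 0)"
  using assms
proof (induction p arbitrary: f rule: real_polynomial_function.induct)
  case (linear p)
  then interpret bounded_linear p by simp
  \<comment> \<open>the Wirtinger derivative of \<open>p\<close>, so that \<open>p w = 2 Re (\<alpha> w)\<close>\<close>
  define \<alpha> where "\<alpha> = (of_real (p 1) - \<i> * of_real (p \<i>)) / 2"
  have p: "of_real (p w) = \<alpha> * w + cnj \<alpha> * cnj w" for w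
  proof -
    have "p w = p (Re w *\<^sub>R 1 + Im w *\<^sub>R \<i>)" by (intro arg_cong[of _ _ p]) (simp add: complex_eq_iff)
    also have "\<dots> = Re w * p 1 + Im w * p \<i>" unfolding add scaleR by simp
    finally show ?thesis by (simp add: \<alpha>_def complex_eq_iff field_simps)
  qed
  have "of_real (p (exp (freq 1 * of_real \<theta>))) * f \<theta>
    = \<alpha> * (exp (freq 1 * of_real \<theta>) * f \<theta>) + cnj \<alpha> * (exp (freq (-1) * of_real \<theta>) * f \<theta>)" for \<theta>
    unfolding p cnj_exp_freq by (simp add: freq_minus algebra_simps)
  then show ?case
    using linear.prems
    by (simp add: L2_fun_add L2_fun_cmult L2_fun_exp_mult laplace_add laplace_cmult laplace_exp_mult
        flip: freq_add)
next
  case (const c)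
  then show ?case by (simp add: L2_fun_cmult laplace_cmult)
next
  case (add p q)
  show ?case
    using add.IH(1)[OF add.prems] add.IH(2)[OF add.prems]
    by (simp add: distrib_right L2_fun_add laplace_add)
next
  case (mult p q)
  have q: "L2_fun (\<lambda>\<theta>. of_real (q (exp (freq 1 * of_real \<theta>))) * f \<theta>)"
    "\<And>j. laplace (\<lambda>\<theta>. of_real (q (exp (freq 1 * of_real \<theta>))) * f \<theta>) (freq j) = 0"
    using mult.IH(2)[OF mult.prems] by blast+
  from mult.IH(1)[OF q] show ?case by (simp add: mult.assoc)
qed

text \<open>By the Stone-Weierstrass theorem the polynomials of the previous lemma are uniformly
dense in the continuous functions on the circle.\<close>

lemma integral_mult_continuous_circle_eq_0:
  assumes f: "L2_fun f" "\<And>j. laplace f (freq j) = 0"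
    and \<phi>: "continuous_on (sphere 0 1) \<phi>"
  shows "(LINT \<theta>|unit_interval. of_real (\<phi> (exp (freq 1 * of_real \<theta>))) * f \<theta>) = (0::complex)" (is "?I \<phi> = 0")
proof (rule ccontr)
  assume ne: "?I \<phi> \<noteq> 0"
  define C where "C = (LINT \<theta>|unit_interval. cmod (f \<theta>))"
  have "C \<ge> 0" by (simp add: C_def)
  define e where "e = cmod (?I \<phi>) / (C + 1)"
  have "e > 0" using ne \<open>C \<ge> 0\<close> by (simp add: e_def)
  obtain p where p: "real_polynomial_function p" "\<And>x. x \<in> sphere 0 1 \<Longrightarrow> \<bar>\<phi> x - p x\<bar> < e"
    using Stone_Weierstrass_real_polynomial_function[OF compact_sphere \<phi> \<open>e > 0\<close>] by blast
  note P = laplace_mult_real_polynomial_eq_0[OF p(1) f]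
  have "?I p = 0" using P[THEN conjunct2, rule_format, of 0] by (simp add: laplace_def freq_def)
  have cont: "continuous_on {-1..0} (\<lambda>\<theta>. complex_of_real (\<phi> (exp (freq 1 * of_real \<theta>))))"
    by (intro continuous_intros continuous_on_compose2[OF \<phi>]) auto
  have int: "integrable unit_interval (\<lambda>\<theta>. of_real (\<phi> (exp (freq 1 * of_real \<theta>))) * f \<theta>)"
     "integrable unit_interval (\<lambda>\<theta>. of_real (p (exp (freq 1 * of_real \<theta>))) * f \<theta>)"
    using P by (auto intro!: L2_fun_integrable L2_fun_mult_continuous[OF f(1) cont])
  have "?I \<phi> = ?I \<phi> - ?I p" using \<open>?I p = 0\<close> by simp
  also have "\<dots> = (LINT \<theta>|unit_interval. of_real (\<phi> (exp (freq 1 * of_real \<theta>))) * f \<theta>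
      - of_real (p (exp (freq 1 * of_real \<theta>))) * f \<theta>)"
    using int by simp
  finally have "cmod (?I \<phi>) = cmod \<dots>" by simp
  also have "\<dots> \<le> (LINT \<theta>|unit_interval. cmod (of_real (\<phi> (exp (freq 1 * of_real \<theta>))) * f \<theta>
      - of_real (p (exp (freq 1 * of_real \<theta>))) * f \<theta>))"
    by (rule integral_norm_bound)
  also have "\<dots> \<le> (LINT \<theta>|unit_interval. e * cmod (f \<theta>))"
  proof (rule integral_mono)
    fix \<theta>
    have "cmod (of_real (\<phi> (exp (freq 1 * of_real \<theta>))) * f \<theta> - of_real (p (exp (freq 1 * of_real \<theta>))) * f \<theta>)
      = \<bar>\<phi> (exp (freq 1 * of_real \<theta>)) - p (exp (freq 1 * of_real \<theta>))\<bar> * cmod (f \<theta>)"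
      by (simp flip: left_diff_distrib of_real_diff add: norm_mult)
    also have "\<dots> \<le> e * cmod (f \<theta>)"
      using p(2)[of "exp (freq 1 * of_real \<theta>)"] by (intro mult_right_mono) auto
    finally show "cmod (of_real (\<phi> (exp (freq 1 * of_real \<theta>))) * f \<theta>
        - of_real (p (exp (freq 1 * of_real \<theta>))) * f \<theta>) \<le> e * cmod (f \<theta>)" .
  qed (use int f(1) in \<open>auto intro!: integrable_norm L2_fun_integrable\<close>)
  also have "\<dots> = e * C" by (simp add: C_def)
  also have "\<dots> < e * (C + 1)" using \<open>e > 0\<close> by simp
  also have "\<dots> = cmod (?I \<phi>)" using \<open>C \<ge> 0\<close> by (simp add: e_def)
  finally show False by simp
qed

text \<open>The map \<open>\<theta> \<mapsto> e\<^bsup>2\<pi>i\<theta>\<^esup>\<close> is injective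
on \<open>(-1, 0)\<close> and takes \<open>K\<close> to a closed subset \<open>T\<close>
of the circle. The indicator of \<open>T\<close> is the limit of the continuous
functions \<open>max 0 (1 - n dist(w, T))\<close>.\<close>

lemma set_integral_closed_eq_0:
  assumes f: "L2_fun f" "\<And>j. laplace f (freq j) = 0"
    and K: "closed K" "K \<subseteq> {-1<..<0}"
  shows "(LINT \<theta>|unit_interval. of_real (indicator K \<theta>) * f \<theta>) = 0"
proof (cases "K = {}")
  case False
  have "bounded K" using K(2) by (intro bounded_subset[OF compact_imp_bounded[OF compact_Icc[of "-1::real" 0]]]) auto
  then have "compact K" using K(1) by (simp add: compact_eq_bounded_closed)
  define T where "T = (\<lambda>\<theta>. exp (freq 1 * complex_of_real \<theta>)) ` K"
  have T: "closed T" "T \<noteq> {}"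
    unfolding T_def using False \<open>compact K\<close>
    by (auto intro!: compact_imp_closed compact_continuous_image continuous_intros)
  define \<phi> where "\<phi> = (\<lambda>(n::nat) w. max 0 (1 - real n * infdist w T))"
  have \<phi>: "continuous_on S (\<phi> n)" for n S unfolding \<phi>_def by (intro continuous_intros)
  \<comment> \<open>only the two end points of the interval have the same image, and \<open>K\<close> omits both\<close>
  have mem: "exp (freq 1 * of_real \<theta>) \<in> T \<longleftrightarrow> \<theta> \<in> K" if "\<theta> \<in> {-1..0}" for \<theta>
  proof
    assume "exp (freq 1 * of_real \<theta>) \<in> T"
    then obtain t where t: "t \<in> K" "exp (freq 1 * of_real \<theta>) = exp (freq 1 * of_real t)"
      by (auto simp: T_def)
    then obtain n :: int where n: "freq 1 * of_real \<theta> = freq 1 * of_real t + of_int (2 * n) * (of_real pi * \<i>)"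
      unfolding exp_eq by (auto simp: mult_ac)
    have "2 * pi * \<theta> = 2 * pi * t + 2 * pi * of_int n"
      using arg_cong[OF n, of Im] by (simp add: freq_def mult_ac)
    then have "2 * pi * (\<theta> - t - of_int n) = 0" by (simp add: algebra_simps)
    then have "\<theta> = t + of_int n" by simp
    moreover have "-1 < t" "t < 0" using t(1) K(2) by auto
    ultimately have "n < 1" "-1 < n" using that by auto
    then have "n = 0" by simp
    then show "\<theta> \<in> K" using \<open>\<theta> = t + of_int n\<close> t by simp
  qed (auto simp: T_def)
  have lim: "(\<lambda>n. \<phi> n (exp (freq 1 * of_real \<theta>))) \<longlonglongrightarrow> indicator K \<theta>" if "\<theta> \<in> {-1..0}" for \<theta>
  proof (cases "\<theta> \<in> K")
    case True
    then show ?thesis using mem[OF that] by (simp add: \<phi>_def)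
  next
    case False
    define d where "d = infdist (exp (freq 1 * of_real \<theta>)) T"
    have "d \<noteq> 0"
      using in_closed_iff_infdist_zero[OF T] mem[OF that] False by (simp add: d_def)
    then have "d > 0" by (simp add: d_def infdist_nonneg less_le)
    then obtain N :: nat where "1 < real N * d" using reals_Archimedean3 by blast
    then have "\<phi> n (exp (freq 1 * of_real \<theta>)) = 0" if "n \<ge> N" for n
    proof -
      have "real N * d \<le> real n * d" using that \<open>d > 0\<close> by simp
      with \<open>1 < real N * d\<close> show ?thesis by (simp add: \<phi>_def flip: d_def)
    qed
    then have "\<forall>\<^sub>F n in sequentially. \<phi> n (exp (freq 1 * of_real \<theta>)) = 0"
      by (auto simp: eventually_sequentially)
    then show ?thesis using False by (simp add: tendsto_eventually)
  qed
  have "(\<lambda>n. LINT \<theta>|unit_interval. of_real (\<phi> n (exp (freq 1 * of_real \<theta>))) * f \<theta>)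
      \<longlonglongrightarrow> (LINT \<theta>|unit_interval. of_real (indicator K \<theta>) * f \<theta>)"
  proof (rule integral_dominated_convergence[where w="\<lambda>\<theta>. cmod (f \<theta>)"])
    note [measurable] = L2_fun_measurable[OF f(1)]
    have "K \<inter> {-1..0} \<in> sets unit_interval"
      using K by (intro sets_restrict_space_iff[THEN iffD2]) auto
    then have "(indicator K :: real \<Rightarrow> real) \<in> borel_measurable unit_interval"
      by (subst borel_measurable_indicator_iff) (simp add: Int_commute)
    then show "(\<lambda>\<theta>. of_real (indicator K \<theta>) * f \<theta>) \<in> borel_measurable unit_interval"
      by measurable
    fix n
    have "continuous_on {-1..0} (\<lambda>\<theta>. complex_of_real (\<phi> n (exp (freq 1 * of_real \<theta>))))"
      by (intro continuous_intros continuous_on_compose2[OF \<phi>[of UNIV n]]) auto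
    then show "(\<lambda>\<theta>. of_real (\<phi> n (exp (freq 1 * of_real \<theta>))) * f \<theta>) \<in> borel_measurable unit_interval"
      using continuous_measurable_unit_interval by measurable
    have "\<bar>\<phi> n w\<bar> \<le> 1" for w by (simp add: \<phi>_def infdist_nonneg)
    then show "AE \<theta> in unit_interval. cmod (of_real (\<phi> n (exp (freq 1 * of_real \<theta>))) * f \<theta>) \<le> cmod (f \<theta>)"
      by (intro AE_I2) (simp add: norm_mult mult_left_le_one_le)
  next
    show "integrable unit_interval (\<lambda>\<theta>. cmod (f \<theta>))"
      by (intro integrable_norm L2_fun_integrable f)
    show "AE \<theta> in unit_interval. (\<lambda>n. of_real (\<phi> n (exp (freq 1 * of_real \<theta>))) * f \<theta>)
        \<longlonglongrightarrow> of_real (indicator K \<theta>) * f \<theta>"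
      by (intro AE_I2 tendsto_intros lim) simp
  qed
  then have "(\<lambda>n. 0) \<longlonglongrightarrow> (LINT \<theta>|unit_interval. of_real (indicator K \<theta>) * f \<theta>)"
    unfolding integral_mult_continuous_circle_eq_0[OF f \<phi>] .
  then show ?thesis by (rule LIMSEQ_unique) (rule tendsto_const)
qed simp

text \<open>Every closed subset of the set where the real part is positive is a null set, because
the integral over it vanishes. Inner regularity of Lebesgue measure passes this on to
the set itself.\<close>

lemma AE_Re_nonpos:
  assumes f: "L2_fun f" "\<And>j. laplace f (freq j) = 0"
  shows "AE \<theta> in unit_interval. Re (f \<theta>) \<le> 0"
proof -
  note [measurable] = L2_fun_measurable[OF f(1)]
  define A where "A = {\<theta> \<in> {-1<..<0}. 0 < Re (f \<theta>)}"
  have "{\<theta> \<in> space unit_interval. 0 < Re (f \<theta>)} \<in> sets unit_interval" by measurable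
  then have "{\<theta> \<in> {-1..0}. 0 < Re (f \<theta>)} \<in> sets lebesgue"
    by (simp add: sets_restrict_space_iff)
  then have "{\<theta> \<in> {-1..0}. 0 < Re (f \<theta>)} \<inter> {-1<..<0} \<in> sets lebesgue" by auto
  also have "{\<theta> \<in> {-1..0}. 0 < Re (f \<theta>)} \<inter> {-1<..<0} = A" by (auto simp: A_def)
  finally have A: "A \<in> sets lebesgue" .
  have "emeasure lebesgue A < ennreal e" if "e > 0" for e
  proof -
    obtain K where K: "closed K" "K \<subseteq> A" "A - K \<in> lmeasurable" "emeasure lebesgue (A - K) < ennreal e"
      using sets_lebesgue_inner_closed[OF A \<open>e > 0\<close>] by blast
    have K_int: "K \<subseteq> {-1<..<0}" using K(2) by (auto simp: A_def)
    have KM: "K \<in> sets unit_interval" using K(1) K_int by (auto simp: sets_restrict_space_iff)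
    have int: "integrable unit_interval (\<lambda>\<theta>. of_real (indicator K \<theta>) * f \<theta>)"
      using KM by (intro L2_fun_integrable L2_fun_mult_bounded[OF f(1), of _ 1]) (auto simp: indicator_def)
    have "(LINT \<theta>|unit_interval. Re (of_real (indicator K \<theta>) * f \<theta>)) = 0"
      using integral_Re[OF int] by (simp add: set_integral_closed_eq_0[OF f K(1) K_int])
    moreover have "integrable unit_interval (\<lambda>\<theta>. Re (of_real (indicator K \<theta>) * f \<theta>))"
      using int by (rule integrable_Re)
    moreover have "0 \<le> Re (of_real (indicator K \<theta>) * f \<theta>)" for \<theta>
      using K(2) by (auto simp: A_def indicator_def less_imp_le)
    ultimately have "AE \<theta> in unit_interval. Re (of_real (indicator K \<theta>) * f \<theta>) = 0"
      using integral_nonneg_eq_0_iff_AE by blast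
    then have "AE \<theta> in unit_interval. \<theta> \<notin> K"
      using K(2) by (auto simp: A_def indicator_def split: if_splits elim!: eventually_mono)
    then have "emeasure unit_interval K = 0"
      using AE_iff_null_sets[OF KM] by (simp add: null_sets_def)
    then have "emeasure lebesgue K = 0"
      using K_int by (subst (asm) emeasure_restrict_space) auto
    moreover have "emeasure lebesgue A \<le> emeasure lebesgue K + emeasure lebesgue (A - K)"
      using K A emeasure_subadditive[of K lebesgue "A - K"] by (simp add: Un_absorb1 sets.Diff)
    ultimately show ?thesis using K(4) by simp
  qed
  note small = this
  have "emeasure lebesgue A = 0"
  proof (cases "emeasure lebesgue A" rule: ennreal_cases)
    case (real r)
    then show ?thesis using small[of r] by (cases "r > 0") auto
  next
    case top
    then show ?thesis using small[of 1] by simp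
  qed
  then have "A \<in> null_sets lebesgue" using A by (simp add: null_sets_def)
  moreover have "{-1, 0::real} \<in> null_sets lebesgue" by (simp add: null_sets_completionI finite_imp_null_set_lborel)
  ultimately have "A \<union> {-1, 0} \<in> null_sets lebesgue" by (rule null_sets.Un)
  then have "AE \<theta> in lebesgue. \<theta> \<notin> A \<union> {-1, 0}" by (rule AE_not_in)
  then have "AE \<theta> in lebesgue. \<theta> \<in> {-1..0} \<longrightarrow> Re (f \<theta>) \<le> 0"
    by eventually_elim (auto simp: A_def)
  then show ?thesis by (simp add: AE_restrict_space_iff)
qed

proposition fourier_unique:
  assumes f: "L2_fun f" "\<And>j. laplace f (freq j) = 0"
  shows "AE \<theta> in unit_interval. f \<theta> = 0"
proof -
  have *: "AE \<theta> in unit_interval. Re (c * f \<theta>) \<le> 0" for c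
    by (rule AE_Re_nonpos) (simp_all add: f L2_fun_cmult laplace_cmult)
  show ?thesis
    using *[of 1] *[of "-1"] *[of \<i>] *[of "-\<i>"]
    by eventually_elim (simp add: complex_eq_iff)
qed

text \<open>The function provided by the Riesz-Fischer theorem for the Fourier coefficients of
\<open>f\<close> agrees with \<open>f\<close> almost everywhere.\<close>

corollary laplace_eq_infsum:
  assumes f: "L2_fun f"
  shows "laplace f s = (\<Sum>\<^sub>\<infinity>j. laplace f (freq j) * cauchy_kernel j s)"
proof -
  obtain g where g: "L2_fun g" "\<And>s. laplace g s = (\<Sum>\<^sub>\<infinity>j. laplace f (freq j) * cauchy_kernel j s)"
    using riesz_fischer[OF sqsum_laplace_freq[OF f]] by blast
  have "laplace g (freq k) = laplace f (freq k)" for k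
  proof -
    have "laplace g (freq k) = (\<Sum>\<^sub>\<infinity>j\<in>{k}. laplace f (freq j))"
      unfolding g by (rule infsum_cong_neutral) auto
    then show ?thesis by simp
  qed
  then have "AE \<theta> in unit_interval. f \<theta> - g \<theta> = 0"
    by (intro fourier_unique) (simp_all add: L2_fun_diff f g laplace_diff)
  then have "laplace f s = laplace g s"
    unfolding laplace_def by (intro integral_cong_AE)
      (auto intro!: L2_fun_measurable L2_fun_exp_mult f g(1) elim!: eventually_mono)
  then show ?thesis by (simp add: g)
qed

section \<open>Invertibility of the Cauchy-type system\<close>

text \<open>A finite set of pairs is covered by finitely many fibres, one over each first component.\<close>

lemma sum_prod_le:
  fixes g :: "'n::finite \<times> int \<Rightarrow> real"
  assumes "finite F" and g: "\<And>p. 0 \<le> g p"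
    and B: "\<And>l G. finite G \<Longrightarrow> (\<Sum>j\<in>G. g (l, j)) \<le> B l"
  shows "sum g F \<le> (\<Sum>l\<in>UNIV. B l)"
proof -
  have "sum g F \<le> sum g (UNIV \<times> snd ` F)"
    using \<open>finite F\<close> g by (intro sum_mono2) force+
  also have "\<dots> = (\<Sum>l\<in>UNIV. \<Sum>j\<in>snd ` F. g (l, j))"
    by (simp add: sum.cartesian_product)
  also have "\<dots> \<le> (\<Sum>l\<in>UNIV. B l)"
    using \<open>finite F\<close> by (intro sum_mono B) auto
  finally show ?thesis .
qed

lemma sqsumI_sum:
  assumes "\<And>F. finite F \<Longrightarrow> (\<Sum>i\<in>F. (cmod (f i))\<^sup>2) \<le> B"
  shows "sqsum f"
  by (rule sqsumI[where B="sqrt B"]) (simp add: L2_set_def assms)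

lemma sqsumE_sum:
  assumes "sqsum f"
  obtains B where "\<And>F. finite F \<Longrightarrow> (\<Sum>i\<in>F. (cmod (f i))\<^sup>2) \<le> B"
proof
  show "(\<Sum>i\<in>F. (cmod (f i))\<^sup>2) \<le> (\<Sum>\<^sub>\<infinity>i. (cmod (f i))\<^sup>2)" if "finite F" for F
    using assms that unfolding sqsum_def by (intro finite_sum_le_infsum) auto
qed

lemma sqsum_prod:
  fixes f :: "'n::finite \<times> int \<Rightarrow> complex"
  assumes "\<And>l. sqsum (\<lambda>j. f (l, j))"
  shows "sqsum f"
proof -
  have "\<exists>B. \<forall>G. finite G \<longrightarrow> (\<Sum>j\<in>G. (cmod (f (l, j)))\<^sup>2) \<le> B" for l
    by (rule sqsumE_sum[OF assms[of l]]) blast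
  then obtain B where "\<And>l G. finite G \<Longrightarrow> (\<Sum>j\<in>G. (cmod (f (l, j)))\<^sup>2) \<le> B l" by metis
  then show ?thesis
    by (intro sqsumI_sum[where B="\<Sum>l\<in>UNIV. B l"] sum_prod_le) auto
qed

lemma norm_ell2_le_sqrtI:
  assumes "\<And>F. finite F \<Longrightarrow> (\<Sum>i\<in>F. (cmod (coord x i))\<^sup>2) \<le> B"
  shows "norm x \<le> sqrt B"
  by (rule norm_ell2_leI) (simp add: L2_set_def assms)

lemma sq_int_le:
  assumes "L2_fun g" and M: "\<And>\<theta>. \<theta> \<in> {-1..0} \<Longrightarrow> cmod (g \<theta>) \<le> M"
  shows "sq_int g \<le> M\<^sup>2"
proof -
  have "sq_int g \<le> (LINT \<theta>|unit_interval. M\<^sup>2)"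
    using assms by (intro integral_mono L2_fun_sq_integrable) (auto intro!: power_mono)
  then show ?thesis by simp
qed

text \<open>The summands are the Fourier coefficients, in reverse order, of the function bounded by
\<open>M\<close>, so that Bessel's inequality applies.\<close>

lemma cauchy_kernel_diff_bound:
  assumes "finite G" and M: "\<And>\<theta>. \<theta> \<in> {-1..0} \<Longrightarrow> cmod (a * exp (s * of_real \<theta>) - b * exp (t * of_real \<theta>)) \<le> M"
  shows "(\<Sum>j\<in>G. (cmod (a * cauchy_kernel j s - b * cauchy_kernel j t))\<^sup>2) \<le> M\<^sup>2"
proof -
  define g where "g = (\<lambda>\<theta>. a * exp (s * of_real \<theta>) - b * exp (t * complex_of_real \<theta>))"
  have e: "L2_fun (\<lambda>\<theta>. c * exp (s * complex_of_real \<theta>))" for c s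
    by (intro L2_fun_continuous continuous_intros)
  have g: "L2_fun g" unfolding g_def by (intro L2_fun_diff e)
  have "laplace g (freq j) = a * cauchy_kernel (- j) s - b * cauchy_kernel (- j) t" for j
    unfolding g_def laplace_diff[OF e e] by (simp add: laplace_cmult laplace_exp_freq)
  then have "(\<Sum>j\<in>G. (cmod (a * cauchy_kernel j s - b * cauchy_kernel j t))\<^sup>2)
      = (\<Sum>j\<in>uminus ` G. (cmod (laplace g (freq j)))\<^sup>2)"
    by (simp add: sum.reindex)
  also have "\<dots> \<le> sq_int g" using \<open>finite G\<close> by (intro bessel g) simp
  also have "\<dots> \<le> M\<^sup>2" by (rule sq_int_le[OF g]) (simp add: g_def M)
  finally show ?thesis .
qed

text \<open>The row of the linear system that belongs to the functional \<open>g \<mapsto>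
\<Sum>\<^sub>l w\<^sub>l \<integral> e\<^bsup>s\<^sub>l\<theta>\<^esup>
g\<^sub>l(\<theta>) d\<theta>\<close>, expressed in the Fourier coefficients of the
functions \<open>g\<^sub>l\<close>.\<close>

definition kernel_row :: "('n::finite \<Rightarrow> complex) \<Rightarrow> ('n \<Rightarrow> complex) \<Rightarrow> ('n \<times> int) ell2" where
  "kernel_row w s = Abs_ell2 (\<lambda>p. w (fst p) * cauchy_kernel (snd p) (s (fst p)))"

lemma coord_kernel_row [simp]:
  "coord (kernel_row w s) p = w (fst p) * cauchy_kernel (snd p) (s (fst p))"
proof -
  have "sqsum (\<lambda>p. w (fst p) * cauchy_kernel (snd p) (s (fst p)))"
    by (rule sqsum_prod) (simp add: sqsum_cmult sqsum_cauchy_kernel)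
  then show ?thesis by (simp add: kernel_row_def)
qed

lemma norm_kernel_row_diff_le:
  fixes w v :: "'n::finite \<Rightarrow> complex"
  assumes M: "\<And>l \<theta>. \<theta> \<in> {-1..0} \<Longrightarrow> cmod (w l * exp (s l * of_real \<theta>) - v l * exp (t l * of_real \<theta>)) \<le> M l"
  shows "norm (kernel_row w s - kernel_row v t) \<le> sqrt (\<Sum>l\<in>UNIV. (M l)\<^sup>2)"
proof (rule norm_ell2_le_sqrtI)
  fix F :: "('n \<times> int) set" assume "finite F"
  then show "(\<Sum>i\<in>F. (cmod (coord (kernel_row w s - kernel_row v t) i))\<^sup>2) \<le> (\<Sum>l\<in>UNIV. (M l)\<^sup>2)"
    by (rule sum_prod_le) (auto intro!: cauchy_kernel_diff_bound M)
qed

text \<open>The special case in which only the function \<open>g\<^sub>m\<close> occurs, with weight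
one.\<close>

definition block_row :: "'n::finite \<Rightarrow> complex \<Rightarrow> ('n \<times> int) ell2" where
  "block_row m s = kernel_row (\<lambda>l. if l = m then 1 else 0) (\<lambda>_. s)"

lemma coord_block_row [simp]:
  "coord (block_row m s) p = (if fst p = m then cauchy_kernel (snd p) s else 0)"
  by (simp add: block_row_def)

lemma block_row_freq: "block_row m (freq k) = unit_vec (m, k)"
  by (rule ell2_eqI) (auto simp: prod_eq_iff)

lemma cmod_exp_minus_one_le:
  assumes "\<theta> \<in> {-1..0}"
  shows "cmod (exp (\<delta> * of_real \<theta>) - 1) \<le> exp (cmod \<delta>) * cmod \<delta>"
proof -
  have le: "cmod (\<delta> * of_real \<theta>) \<le> cmod \<delta>"
    using mult_left_mono[of "\<bar>\<theta>\<bar>" 1 "cmod \<delta>"] assms by (simp only: norm_mult norm_of_real) auto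
  have "cmod (exp (\<delta> * of_real \<theta>) - 1) \<le> exp \<bar>Re (\<delta> * of_real \<theta>)\<bar> * cmod (\<delta> * of_real \<theta>)"
    using Taylor_exp[of "\<delta> * of_real \<theta>" 0] by simp
  also have "\<dots> \<le> exp (cmod \<delta>) * cmod \<delta>"
    using le abs_Re_le_cmod[of "\<delta> * of_real \<theta>"] by (intro mult_mono) auto
  finally show ?thesis .
qed

lemma norm_block_row_diff_le:
  "norm (block_row m (freq k + \<delta>) - unit_vec (m, k)) \<le> exp (cmod \<delta>) * cmod \<delta>"
proof -
  let ?w = "\<lambda>l. if l = m then 1 else (0::complex)"
  have *: "cmod (exp ((freq k + \<delta>) * of_real \<theta>) - exp (freq k * of_real \<theta>)) \<le> exp (cmod \<delta>) * cmod \<delta>"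
    if "\<theta> \<in> {-1..0}" for \<theta>
  proof -
    have "exp ((freq k + \<delta>) * of_real \<theta>) - exp (freq k * of_real \<theta>)
        = exp (freq k * of_real \<theta>) * (exp (\<delta> * of_real \<theta>) - 1)"
      by (simp add: exp_add algebra_simps)
    then show ?thesis using cmod_exp_minus_one_le[OF that, of \<delta>] by (simp add: norm_mult)
  qed
  have "norm (block_row m (freq k + \<delta>) - block_row m (freq k))
      \<le> sqrt (\<Sum>l\<in>UNIV. (if l = m then exp (cmod \<delta>) * cmod \<delta> else 0)\<^sup>2)"
    unfolding block_row_def by (rule norm_kernel_row_diff_le) (use * in auto)
  also have "\<dots> = exp (cmod \<delta>) * cmod \<delta>"
    by (simp add: if_distrib[of "\<lambda>x. x\<^sup>2"] cong: if_cong)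
  finally show ?thesis by (simp add: block_row_freq)
qed

lemma exp_minus_neq_one:
  assumes "\<And>j. \<nu> \<noteq> freq j"
  shows "1 - exp (- \<nu>) \<noteq> 0"
proof
  assume "1 - exp (- \<nu>) = 0"
  then have "exp (- \<nu>) = 1" by simp
  then obtain n :: int where "Re \<nu> = 0" "- Im \<nu> = 2 * of_int n * pi"
    unfolding exp_eq_1 by auto
  then have "Re \<nu> = 0" "Im \<nu> = - (2 * of_int n * pi)" by linarith+
  then have "\<nu> = freq (- n)" by (simp add: complex_eq_iff freq_def)
  then show False using assms by blast
qed

text \<open>The coefficients are the same for all \<open>j\<close>. If \<open>s\<close> itself has
the form \<open>2\<pi>ij\<close>, the factor \<open>1 - e\<^bsup>-s\<^esup>\<close>
vanishes and the identity remains true.\<close>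

lemma cauchy_kernel_partial_fractions:
  assumes \<nu>: "\<And>j. \<nu> \<noteq> freq j" and "s \<noteq> \<nu>"
  shows "cauchy_kernel j s * ((freq k - freq j) / (\<nu> - freq j))
    = (freq k - s) / (\<nu> - s) * cauchy_kernel j s
      + (1 - exp (- s)) / (1 - exp (- \<nu>)) * ((freq k - \<nu>) / (s - \<nu>)) * cauchy_kernel j \<nu>"
proof (cases "s = freq j")
  case True
  then show ?thesis by (simp add: freq_minus[symmetric])
next
  case False
  define B where "B = 1 - exp (- \<nu>)"
  have "B \<noteq> 0" unfolding B_def by (rule exp_minus_neq_one[OF \<nu>])
  have nz: "\<nu> - freq j \<noteq> 0" "s - freq j \<noteq> 0" "\<nu> - s \<noteq> 0" "s - \<nu> \<noteq> 0"
    using \<nu>[of j] False \<open>s \<noteq> \<nu>\<close> by auto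
  have "(freq k - freq j) / ((s - freq j) * (\<nu> - freq j))
      = (freq k - s) / ((\<nu> - s) * (s - freq j)) + (freq k - \<nu>) / ((s - \<nu>) * (\<nu> - freq j))"
    using nz by (simp add: divide_simps) (simp add: algebra_simps)
  then have "(1 - exp (- s)) * ((freq k - freq j) / ((s - freq j) * (\<nu> - freq j)))
      = (1 - exp (- s)) * ((freq k - s) / ((\<nu> - s) * (s - freq j)) + (freq k - \<nu>) / ((s - \<nu>) * (\<nu> - freq j)))"
    by simp
  then show ?thesis
    using False \<nu>[of j] \<open>B \<noteq> 0\<close> by (simp add: cauchy_kernel_def distrib_left mult_ac flip: B_def)
qed

text \<open>Suppose that the transform of \<open>h\<close> vanishes at \<open>\<nu>\<close>. By
assumption it also vanishes at all nodes of the system in block \<open>m\<close> except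
\<open>2\<pi>ik\<close>. Multiplying it by \<open>(s - 2\<pi>ik) / (s - \<nu>)\<close>
removes the zero \<open>\<nu>\<close> and adds the missing zero. On coefficients this
multiplies the one with index \<open>j\<close> by \<open>(2\<pi>ik - 2\<pi>ij) / (\<nu>
- 2\<pi>ij)\<close>, and injectivity of the system forces the result to be
\<open>0\<close>. Hence \<open>h\<close> is the unit vector in block \<open>m\<close>,
whose transform at \<open>\<nu>\<close> is not zero.\<close>

lemma block_row_swap_nonzero:
  fixes R :: "'n::finite \<times> int \<Rightarrow> ('n \<times> int) ell2" and s :: "'n \<times> int \<Rightarrow> complex"
  assumes R: "\<And>i. R i = block_row (fst i) (s i)" "near_identity R" "inj (row_op R)"
    and h: "row_op R h = unit_vec (m, k)"
    and s: "s (m, k) = freq k" "\<And>j. s (m, j) \<noteq> \<nu>" and \<nu>: "\<And>j. \<nu> \<noteq> freq j"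
  shows "dot (block_row m \<nu>) h \<noteq> 0"
proof
  assume 0: "dot (block_row m \<nu>) h = 0"
  define B where "B = 1 - exp (- \<nu>)"
  have "B \<noteq> 0" unfolding B_def by (rule exp_minus_neq_one[OF \<nu>])
  have dot_h: "dot (R i) h = (if i = (m, k) then 1 else 0)" for i
    using near_identity_row_op(1)[OF R(2), of h i] h by simp
  \<comment> \<open>the coefficients of the modified transform; those of the other blocks are dropped\<close>
  define c where "c = (\<lambda>p. if fst p = m then coord h p * ((freq k - freq (snd p)) / (\<nu> - freq (snd p))) else 0)"
  define M where "M = 1 + cmod ((freq k - \<nu>) / B) * norm (block_row m \<nu>)"
  have "sqsum c"
  proof (rule sqsum_bounded_mult[OF sqsum_coord[of h]])
    fix p :: "'n \<times> int"
    define j where "j = snd p"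
    have "(freq k - freq j) / (\<nu> - freq j) = 1 + (freq k - \<nu>) / B * cauchy_kernel j \<nu>"
      using \<nu>[of j] \<open>B \<noteq> 0\<close> by (simp add: cauchy_kernel_def field_simps flip: B_def)
    then have "cmod ((freq k - freq j) / (\<nu> - freq j))
        \<le> cmod 1 + cmod ((freq k - \<nu>) / B) * cmod (cauchy_kernel j \<nu>)"
      using norm_triangle_ineq[of 1 "(freq k - \<nu>) / B * cauchy_kernel j \<nu>"] by (metis norm_mult)
    also have "\<dots> \<le> M"
      using cmod_coord_le_norm[of "block_row m \<nu>" "(m, j)"] unfolding M_def
      by (intro add_mono mult_left_mono) auto
    finally have "cmod ((freq k - freq j) / (\<nu> - freq j)) \<le> M" .
    moreover have "0 \<le> M" by (simp add: M_def)
    ultimately show "cmod (c p) \<le> M * cmod (coord h p)"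
      unfolding c_def j_def by (auto simp only: norm_mult mult.commute[of "cmod (coord h p)"] split: if_splits intro!: mult_right_mono) auto
  qed
  define c' where "c' = Abs_ell2 c"
  have c' [simp]: "coord c' p = c p" for p using \<open>sqsum c\<close> by (simp add: c'_def)
  have "dot (R i) c' = 0" for i
  proof (cases "fst i = m")
    case False
    then have "coord (R i) p * coord c' p = 0" for p by (auto simp: R(1) c_def)
    then show ?thesis unfolding dot_def by (intro infsum_0)
  next
    case True
    then obtain j where i: "i = (m, j)" by (cases i) auto
    define \<alpha> where "\<alpha> = (freq k - s i) / (\<nu> - s i)"
    define \<beta> where "\<beta> = (1 - exp (- s i)) / (1 - exp (- \<nu>)) * ((freq k - \<nu>) / (s i - \<nu>))"
    have "coord (R i) p * coord c' p
        = \<alpha> * (coord (R i) p * coord h p) + \<beta> * (coord (block_row m \<nu>) p * coord h p)" for p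
    proof (cases "fst p = m")
      case True
      then have "coord (R i) p * coord c' p
          = cauchy_kernel (snd p) (s i) * ((freq k - freq (snd p)) / (\<nu> - freq (snd p))) * coord h p"
        by (simp add: R(1) c_def i mult_ac)
      also have "\<dots> = (\<alpha> * cauchy_kernel (snd p) (s i) + \<beta> * cauchy_kernel (snd p) \<nu>) * coord h p"
        using cauchy_kernel_partial_fractions[OF \<nu>, of "s i" "snd p" k] s(2)[of j]
        by (simp add: i \<alpha>_def \<beta>_def)
      finally show ?thesis using True by (simp add: R(1) i algebra_simps)
    qed (simp add: R(1) c_def i)
    then have "dot (R i) c' = (\<Sum>\<^sub>\<infinity>p. \<alpha> * (coord (R i) p * coord h p) + \<beta> * (coord (block_row m \<nu>) p * coord h p))"
      by (simp add: dot_def)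
    also have "\<dots> = \<alpha> * dot (R i) h + \<beta> * dot (block_row m \<nu>) h"
      by (simp only: infsum_add summable_on_cmult_right dot_summable infsum_cmult_right' dot_def)
    also have "\<dots> = 0"
      using 0 s(1) by (auto simp: dot_h \<alpha>_def)
    finally show ?thesis .
  qed
  then have "row_op R c' = row_op R 0"
    by (intro ell2_eqI) (simp add: near_identity_row_op(1)[OF R(2)] dot_def)
  then have "c' = 0" using R(3) by (simp add: inj_eq)
  then have "c p = 0" for p using c'[of p] by simp
  then have h0: "coord h (m, j) = 0" if "j \<noteq> k" for j
  proof -
    have "c (m, j) = 0" by fact
    then show ?thesis using that \<nu>[of j] by (simp add: c_def)
  qed
  have "dot (R (m, k)) h = coord h (m, k)"
    by (simp add: R(1) s(1) block_row_freq)
  then have hk: "coord h (m, k) = 1" by (simp add: dot_h)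
  have "dot (block_row m \<nu>) h = (\<Sum>\<^sub>\<infinity>p\<in>{(m, k)}. cauchy_kernel k \<nu>)"
    unfolding dot_def by (rule infsum_cong_neutral) (use h0 hk in \<open>auto, metis\<close>)
  also have "\<dots> = B / (\<nu> - freq k)" using \<nu>[of k] by (simp add: cauchy_kernel_def B_def)
  finally show False using 0 \<open>B \<noteq> 0\<close> \<nu>[of k] by simp
qed

lemma summable_on_small_tail:
  fixes f :: "'i \<Rightarrow> real"
  assumes f: "f summable_on UNIV" and "e > 0"
  shows "\<exists>F0. finite F0 \<and> (\<forall>F. finite F \<longrightarrow> F \<inter> F0 = {} \<longrightarrow> sum f F < e)"
proof -
  have "(sum f \<longlongrightarrow> infsum f UNIV) (finite_subsets_at_top UNIV)"
    using has_sum_infsum[OF f] by (simp add: has_sum_def)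
  then have "\<forall>\<^sub>F F in finite_subsets_at_top UNIV. dist (sum f F) (infsum f UNIV) < e / 2"
    using \<open>e > 0\<close> by (intro tendstoD) auto
  then obtain F0 where F0: "finite F0" "\<And>F. finite F \<Longrightarrow> F0 \<subseteq> F \<Longrightarrow> dist (sum f F) (infsum f UNIV) < e / 2"
    unfolding eventually_finite_subsets_at_top by auto
  have "sum f F < e" if "finite F" "F \<inter> F0 = {}" for F
  proof -
    have "sum f (F \<union> F0) = sum f F + sum f F0" using that F0(1) by (intro sum.union_disjoint)
    moreover have "dist (sum f (F \<union> F0)) (infsum f UNIV) < e / 2" "dist (sum f F0) (infsum f UNIV) < e / 2"
      using that F0 by auto
    ultimately show ?thesis unfolding dist_real_def by linarith
  qed
  then show ?thesis using F0(1) by blast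
qed

text \<open>Outside a finite set of indices the rows form, taken together, a small perturbation of
the unit vectors. The finitely many others start out as unit vectors and are exchanged
one at a time. A row to be exchanged either has \<open>\<delta> = 0\<close>, and then
nothing changes, or its new node avoids all points \<open>2\<pi>ij\<close> by
hypothesis.\<close>

proposition block_rows_invertible:
  fixes \<delta> :: "'n::finite \<times> int \<Rightarrow> complex"
  assumes \<delta>: "sqsum \<delta>"
    and distinct: "\<And>m j k. freq j + \<delta> (m, j) = freq k + \<delta> (m, k) \<Longrightarrow> j = k"
    and avoid: "\<And>m j k. freq j + \<delta> (m, j) = freq k \<Longrightarrow> j = k"
  defines "R \<equiv> \<lambda>i. block_row (fst i) (freq (snd i) + \<delta> i)"
  shows "near_identity R" "bdd_invertible (row_op R)"
proof -
  define s where "s = (\<lambda>S i. if i \<in> S then freq (snd i) + \<delta> i else freq (snd i))"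
  define Q where "Q = (\<lambda>S i. block_row (fst i) (s S i))"
  define C where "C = exp (norm (Abs_ell2 \<delta>))"
  have Q_le: "norm (Q S i - unit_vec i) \<le> C * cmod (\<delta> i)" for S i
  proof -
    have "cmod (\<delta> i) \<le> norm (Abs_ell2 \<delta>)"
      using cmod_coord_le_norm[of "Abs_ell2 \<delta>" i] \<delta> by simp
    then have "exp (cmod (\<delta> i)) * cmod (\<delta> i) \<le> C * cmod (\<delta> i)"
      by (intro mult_right_mono) (auto simp: C_def)
    with norm_block_row_diff_le[of "fst i" "snd i" "\<delta> i"] show ?thesis
      by (auto simp: Q_def s_def block_row_freq C_def)
  qed
  have near: "near_identity (Q S)" for S
    unfolding near_identity_def
  proof (rule summable_on_comparison_test)
    show "(\<lambda>i. C\<^sup>2 * (cmod (\<delta> i))\<^sup>2) summable_on UNIV"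
      using \<delta> unfolding sqsum_def by (rule summable_on_cmult_right)
    show "(norm (Q S i - unit_vec i))\<^sup>2 \<le> C\<^sup>2 * (cmod (\<delta> i))\<^sup>2" for i
      using power_mono[OF Q_le[of S i], of 2] by (simp add: power_mult_distrib)
  qed auto
  have id: "near_identity (unit_vec :: 'n \<times> int \<Rightarrow> _)"
    "bdd_invertible (row_op (unit_vec :: 'n \<times> int \<Rightarrow> _))"
  proof -
    show n: "near_identity (unit_vec :: 'n \<times> int \<Rightarrow> _)" by (simp add: near_identity_def)
    have "row_op unit_vec = (\<lambda>x :: ('n \<times> int) ell2. x)"
      by (intro ext ell2_eqI) (simp add: near_identity_row_op(1)[OF n])
    then show "bdd_invertible (row_op (unit_vec :: 'n \<times> int \<Rightarrow> _))"
      by (auto intro!: bdd_invertibleI[of _ 1] bounded_linear_ident)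
  qed
  obtain \<epsilon> where "\<epsilon> > 0" and \<epsilon>: "\<And>R' :: 'n \<times> int \<Rightarrow> ('n \<times> int) ell2.
      (\<And>F. finite F \<Longrightarrow> L2_set (\<lambda>i. norm (R' i - unit_vec i)) F \<le> \<epsilon>) \<Longrightarrow> bdd_invertible (row_op R')"
    using row_op_perturb[OF id] by metis
  \<comment> \<open>outside \<open>F0\<close> all rows can be replaced at once, since \<open>C\<close> times the tail of \<open>\<delta>\<close> is below \<open>\<epsilon>\<close>\<close>
  obtain F0 where "finite F0" and F0: "\<And>F. finite F \<Longrightarrow> F \<inter> F0 = {} \<Longrightarrow> (\<Sum>i\<in>F. (cmod (\<delta> i))\<^sup>2) < (\<epsilon> / C)\<^sup>2"
    using summable_on_small_tail[OF \<delta>[unfolded sqsum_def], of "(\<epsilon> / C)\<^sup>2"] \<open>\<epsilon> > 0\<close> by (auto simp: C_def)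
  have "bdd_invertible (row_op (Q (- F0 \<union> G)))" if "finite G" for G
    using that
  proof (induction G)
    case empty
    have "L2_set (\<lambda>i. norm (Q (- F0 \<union> {}) i - unit_vec i)) F \<le> \<epsilon>" if "finite F" for F
    proof -
      have "L2_set (\<lambda>i. norm (Q (- F0 \<union> {}) i - unit_vec i)) F
          = L2_set (\<lambda>i. norm (Q (- F0 \<union> {}) i - unit_vec i)) (F - F0)"
        unfolding L2_set_def using that
        by (intro arg_cong[of _ _ sqrt] sum.mono_neutral_right) (auto simp: Q_def s_def block_row_freq)
      also have "\<dots> \<le> L2_set (\<lambda>i. C * cmod (\<delta> i)) (F - F0)"
        by (intro L2_set_mono Q_le) auto
      also have "\<dots> = C * L2_set (\<lambda>i. cmod (\<delta> i)) (F - F0)"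
        by (simp add: L2_set_right_distrib C_def)
      also have "\<dots> \<le> C * (\<epsilon> / C)"
        unfolding L2_set_def
        using less_imp_le[OF F0[of "F - F0"]] that \<open>\<epsilon> > 0\<close>
        by (intro mult_left_mono real_le_lsqrt) (auto simp: C_def sum_nonneg Diff_disjoint Int_commute)
      finally show ?thesis by (simp add: C_def)
    qed
    then show ?case by (rule \<epsilon>)
  next
    case (insert i G)
    obtain m k where i: "i = (m, k)" by (cases i)
    show ?case
    proof (cases "i \<in> - F0 \<union> G \<or> \<delta> i = 0")
      case True
      then have "Q (- F0 \<union> insert i G) = Q (- F0 \<union> G)" by (auto simp: Q_def s_def fun_eq_iff)
      then show ?thesis using insert.IH by simp
    next
      case False
      define S where "S = - F0 \<union> G"
      obtain h where h: "row_op (Q S) h = unit_vec (m, k)"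
        using insert.IH unfolding S_def bdd_invertible_def by (metis surjD)
      have inj: "inj (row_op (Q S))"
      proof -
        obtain r where r: "bounded_linear (row_op (Q S))" "r > 0" "\<And>x. r * norm x \<le> norm (row_op (Q S) x)"
          using insert.IH unfolding S_def bdd_invertible_def by blast
        then interpret bounded_linear "row_op (Q S)" by simp
        show ?thesis
        proof (rule injI)
          fix x y assume "row_op (Q S) x = row_op (Q S) y"
          then have "r * norm (x - y) \<le> 0" using r(3)[of "x - y"] by (simp add: diff)
          then show "x = y" using \<open>r > 0\<close> by (simp add: mult_le_0_iff)
        qed
      qed
      have \<nu>: "freq k + \<delta> (m, k) \<noteq> freq j" for j
        using avoid[of k m j] False by (auto simp: i)
      have "dot (block_row m (freq k + \<delta> (m, k))) h \<noteq> 0"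
      proof (rule block_row_swap_nonzero[OF _ near inj h])
        show "Q S i = block_row (fst i) (s S i)" for i by (simp add: Q_def)
        show "s S (m, k) = freq k" using False by (simp add: s_def S_def i)
        show "s S (m, j) \<noteq> freq k + \<delta> (m, k)" for j
          using distinct[of j m k] \<nu>[of j] False by (auto simp: s_def S_def i)
      qed (rule \<nu>)
      moreover have "Q (- F0 \<union> insert i G) (m, k) = block_row m (freq k + \<delta> (m, k))"
        by (simp add: Q_def s_def i)
      moreover have "Q (- F0 \<union> insert i G) p = Q S p" if "p \<noteq> (m, k)" for p
        using that by (simp add: Q_def s_def S_def i)
      ultimately show ?thesis
        using row_op_replace_row[OF near insert.IH near _ h[unfolded S_def]] by (simp add: S_def)
    qed
  qed
  from this[OF \<open>finite F0\<close>] have "bdd_invertible (row_op (Q UNIV))" by (simp add: Un_commute)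
  moreover have "Q UNIV = R" by (simp add: Q_def s_def R_def)
  ultimately show "near_identity R" "bdd_invertible (row_op R)" using near[of UNIV] by auto
qed

section \<open>Interpolation by vector-valued exponentials\<close>

lemma infsum_block:
  fixes f :: "'n::finite \<times> int \<Rightarrow> complex"
  assumes "f summable_on UNIV"
  shows "infsum f UNIV = (\<Sum>l\<in>UNIV. \<Sum>\<^sub>\<infinity>j. f (l, j))"
proof -
  have "infsum f UNIV = infsum (\<lambda>(l, j). f (l, j)) (Sigma UNIV (\<lambda>_. UNIV))"
    by simp
  also have "\<dots> = (\<Sum>\<^sub>\<infinity>l. \<Sum>\<^sub>\<infinity>j. f (l, j))"
    by (rule infsum_Sigma'_banach[symmetric]) (use assms in simp)
  finally show ?thesis by simp
qed

text \<open>The left-hand side applies \<open>v\<close> to the transform of the vector function with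
components \<open>g\<^sub>l\<close>, damped by
\<open>e\<^bsup>-a\<^sub>l\<theta>\<^esup>\<close> and mixed by \<open>W\<close>.
Damping shifts the argument of the transform, mixing replaces \<open>v\<close> by
\<open>v W\<close>.\<close>

lemma sum_laplace_eq_dot:
  fixes g :: "'n::finite \<Rightarrow> real \<Rightarrow> complex" and W :: "'i::finite \<Rightarrow> 'n \<Rightarrow> complex"
  assumes g: "\<And>l. L2_fun (g l)"
    and c: "\<And>l s. laplace (g l) s = (\<Sum>\<^sub>\<infinity>j. coord c (l, j) * cauchy_kernel j s)"
  shows "(\<Sum>i\<in>UNIV. v i * laplace (\<lambda>\<theta>. \<Sum>l\<in>UNIV. W i l * (exp (- a l * of_real \<theta>) * g l \<theta>)) s)
    = dot (kernel_row (\<lambda>l. \<Sum>i\<in>UNIV. v i * W i l) (\<lambda>l. s - a l)) c"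
proof -
  define w where "w = (\<lambda>l. \<Sum>i\<in>UNIV. v i * W i l)"
  have "laplace (\<lambda>\<theta>. \<Sum>l\<in>UNIV. W i l * (exp (- a l * of_real \<theta>) * g l \<theta>)) s
      = (\<Sum>l\<in>UNIV. W i l * laplace (g l) (s - a l))" for i
  proof (subst laplace_sum)
    have "laplace (\<lambda>\<theta>. exp (- a l * of_real \<theta>) * g l \<theta>) s = laplace (g l) (s - a l)" for l
      using laplace_exp_mult[of "- a l" "g l" s] by simp
    then show "(\<Sum>l\<in>UNIV. laplace (\<lambda>\<theta>. W i l * (exp (- a l * of_real \<theta>) * g l \<theta>)) s)
        = (\<Sum>l\<in>UNIV. W i l * laplace (g l) (s - a l))"
      by (simp only: laplace_cmult)
  qed (intro L2_fun_cmult L2_fun_exp_mult g)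
  then have "(\<Sum>i\<in>UNIV. v i * laplace (\<lambda>\<theta>. \<Sum>l\<in>UNIV. W i l * (exp (- a l * of_real \<theta>) * g l \<theta>)) s)
      = (\<Sum>i\<in>UNIV. \<Sum>l\<in>UNIV. v i * W i l * laplace (g l) (s - a l))"
    by (simp add: sum_distrib_left mult.assoc)
  also have "\<dots> = (\<Sum>l\<in>UNIV. w l * laplace (g l) (s - a l))"
    by (subst sum.swap) (simp add: w_def sum_distrib_right)
  also have "\<dots> = (\<Sum>l\<in>UNIV. \<Sum>\<^sub>\<infinity>j. coord (kernel_row w (\<lambda>l. s - a l)) (l, j) * coord c (l, j))"
    by (simp add: c mult.assoc infsum_cmult_right' mult.commute[of "coord c _"])
  also have "\<dots> = dot (kernel_row w (\<lambda>l. s - a l)) c"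
    unfolding dot_def by (rule infsum_block[symmetric]) (rule dot_summable)
  finally show ?thesis by (simp add: w_def)
qed

lemma lambda_tilde_freq: "lambda_tilde \<mu> k = lambda_tilde \<mu> 0 + freq k"
  by (simp add: lambda_tilde_def freq_def algebra_simps)

text \<open>Unique solvability of the moment problem with nodes \<open>lam\<close> and directions
\<open>d\<close>. The unknown \<open>f\<close> is a column of the neutral kernel, and
uniqueness is up to null sets.\<close>

definition interpolating :: "('n::finite \<Rightarrow> int \<Rightarrow> complex) \<Rightarrow> ('n \<Rightarrow> int \<Rightarrow> complex^'n) \<Rightarrow> bool" where
  "interpolating lam d \<longleftrightarrow>
    (\<forall>y. sqsum y \<longrightarrow> (\<exists>f. (\<forall>i. L2_fun (f i)) \<and>
        (\<forall>m k. (\<Sum>i\<in>UNIV. cnj (d m k $ i) * laplace (f i) (lam m k)) = y (m, k)))) \<and>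
    (\<forall>f. (\<forall>i. L2_fun (f i)) \<longrightarrow>
        (\<forall>m k. (\<Sum>i\<in>UNIV. cnj (d m k $ i) * laplace (f i) (lam m k)) = 0) \<longrightarrow>
        (\<forall>i. AE \<theta> in unit_interval. f i \<theta> = 0))"

text \<open>For \<open>d = z\<close> the weights \<open>z\<^sub>m\<^sup>* W\<close> are unit vectors
and the system is block diagonal. The rows for \<open>d\<close> and \<open>z\<close>
differ by \<open>O(\<parallel>d - z\<^sub>m\<parallel>)\<close>, with a uniform constant
because the nodes lie in a vertical strip.\<close>

proposition exponential_interpolation:
  fixes \<mu> :: "'n::finite \<Rightarrow> complex" and z :: "'n \<Rightarrow> complex^'n" and lam :: "'n \<Rightarrow> int \<Rightarrow> complex"
    and W :: "'n \<Rightarrow> 'n \<Rightarrow> complex"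
  assumes zW: "\<And>m l. (\<Sum>i\<in>UNIV. cnj (z m $ i) * W i l) = (if l = m then 1 else 0)"
    and Wz: "\<And>i i'. (\<Sum>l\<in>UNIV. W i l * cnj (z l $ i')) = (if i' = i then 1 else 0)"
    and distinct: "\<And>m. inj (lam m)"
    and close: "sqsum (\<lambda>p. lam (fst p) (snd p) - lambda_tilde (\<mu> (fst p)) (snd p))"
    and avoid: "\<And>m j k. lam m j = lambda_tilde (\<mu> m) k \<Longrightarrow> j = k"
  shows "\<exists>\<epsilon>>0. \<forall>d :: 'n \<Rightarrow> int \<Rightarrow> complex^'n.
    (\<forall>F. finite F \<longrightarrow> L2_set (\<lambda>p. norm (d (fst p) (snd p) - z (fst p))) F \<le> \<epsilon>) \<longrightarrow>
    interpolating lam d"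
proof -
  define a where "a = (\<lambda>l. lambda_tilde (\<mu> l) 0)"
  define \<delta> where "\<delta> = (\<lambda>p. lam (fst p) (snd p) - lambda_tilde (\<mu> (fst p)) (snd p))"
  define Rz where "Rz = (\<lambda>p. block_row (fst p) (freq (snd p) + \<delta> p))"
  have lam: "lam m k = a m + freq k + \<delta> (m, k)" for m k
    using lambda_tilde_freq[of "\<mu> m" k] by (simp add: a_def \<delta>_def)
  have \<delta>: "sqsum \<delta>"
      "\<And>m j k. freq j + \<delta> (m, j) = freq k + \<delta> (m, k) \<Longrightarrow> j = k"
      "\<And>m j k. freq j + \<delta> (m, j) = freq k \<Longrightarrow> j = k"
  proof -
    show "sqsum \<delta>" using close by (simp add: \<delta>_def)
    show "j = k" if "freq j + \<delta> (m, j) = freq k + \<delta> (m, k)" for m j k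
      using that distinct[of m] lam[of m j] lam[of m k] by (auto simp: inj_def add.assoc)
    show "j = k" if "freq j + \<delta> (m, j) = freq k" for m j k
      using that avoid[of m j k] lam[of m j] lambda_tilde_freq[of "\<mu> m" k] by (simp add: a_def add.assoc)
  qed
  have Rz: "near_identity Rz" "bdd_invertible (row_op Rz)"
    unfolding Rz_def by (rule block_rows_invertible[OF \<delta>(1)]; erule \<delta>)+
  define weight where "weight = (\<lambda>(v :: complex^'n) l. \<Sum>i\<in>UNIV. cnj (v $ i) * W i l)"
  define R where "R = (\<lambda>(d :: 'n \<Rightarrow> int \<Rightarrow> complex^'n) p.
      kernel_row (weight (d (fst p) (snd p))) (\<lambda>l. lam (fst p) (snd p) - a l))"
  define \<kappa> where "\<kappa> = (\<Sum>l\<in>UNIV. \<Sum>i\<in>UNIV. cmod (W i l))"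
  have weight_le: "cmod (weight v l) \<le> norm v * \<kappa>" for v l
  proof -
    have "cmod (weight v l) \<le> (\<Sum>i\<in>UNIV. cmod (v $ i) * cmod (W i l))"
      unfolding weight_def by (rule order_trans[OF norm_sum]) (simp add: norm_mult)
    also have "\<dots> \<le> (\<Sum>i\<in>UNIV. norm v * cmod (W i l))"
      by (intro sum_mono mult_right_mono Finite_Cartesian_Product.norm_nth_le) auto
    also have "\<dots> = norm v * (\<Sum>i\<in>UNIV. cmod (W i l))" by (simp add: sum_distrib_left)
    also have "\<dots> \<le> norm v * \<kappa>"
      unfolding \<kappa>_def by (intro mult_left_mono member_le_sum sum_nonneg) auto
    finally show ?thesis .
  qed
  \<comment> \<open>a bound for the real parts of all shifted nodes\<close>
  define G where "G = norm (Abs_ell2 \<delta>) + 2 * (\<Sum>l\<in>UNIV. \<bar>Re (a l)\<bar>)"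
  have Re_le: "\<bar>Re (lam m k - a l)\<bar> \<le> G" for m k l
  proof -
    have "cmod (\<delta> (m, k)) \<le> norm (Abs_ell2 \<delta>)"
      using cmod_coord_le_norm[of "Abs_ell2 \<delta>" "(m, k)"] close by (simp add: \<delta>_def)
    moreover have "\<bar>Re (a l)\<bar> \<le> (\<Sum>l\<in>UNIV. \<bar>Re (a l)\<bar>)" for l
      by (rule member_le_sum) auto
    from this[of l] this[of m] have "\<bar>Re (a l)\<bar> + \<bar>Re (a m)\<bar> \<le> 2 * (\<Sum>l\<in>UNIV. \<bar>Re (a l)\<bar>)" by simp
    ultimately show ?thesis
      using abs_Re_le_cmod[of "\<delta> (m, k)"] unfolding G_def lam by simp
  qed
  \<comment> \<open>the summand one only makes \<open>Q\<close> positive, so that it can be divided by\<close>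
  define Q where "Q = sqrt (real CARD('n)) * (\<kappa> * exp G) + 1"
  have "\<kappa> \<ge> 0" by (simp add: \<kappa>_def sum_nonneg)
  then have "Q > 0" by (simp add: Q_def add_nonneg_pos)
  have R_le: "norm (R d p - Rz p) \<le> Q * norm (d (fst p) (snd p) - z (fst p))" for d p
  proof -
    obtain m k where p: "p = (m, k)" by (cases p)
    define q where "q = d m k - z m"
    have wz: "weight (d m k) l = weight q l + (if l = m then 1 else 0)" for l
      using zW[of m l] by (simp add: weight_def q_def algebra_simps sum_subtractf)
    have "R d p - Rz p = kernel_row (weight q) (\<lambda>l. lam m k - a l) - kernel_row (\<lambda>_. 0) (\<lambda>_. 0)"
      by (rule ell2_eqI) (simp add: R_def Rz_def p wz lam algebra_simps)
    also have "norm \<dots> \<le> sqrt (\<Sum>l\<in>(UNIV :: 'n set). (norm q * \<kappa> * exp G)\<^sup>2)"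
    proof (rule norm_kernel_row_diff_le)
      fix l \<theta> assume "\<theta> \<in> {-1..0::real}"
      then have "cmod (exp ((lam m k - a l) * of_real \<theta>)) \<le> exp G"
        by (rule order_trans[OF cmod_exp_le]) (simp only: exp_le_cancel_iff Re_le)
      then show "cmod (weight q l * exp ((lam m k - a l) * of_real \<theta>) - 0 * exp (0 * of_real \<theta>)) \<le> norm q * \<kappa> * exp G"
        using weight_le[of q l] \<open>\<kappa> \<ge> 0\<close> by (auto simp only: norm_mult mult_zero_left diff_zero intro!: mult_mono) auto
    qed
    also have "\<dots> = sqrt (real CARD('n)) * (\<kappa> * exp G) * norm q"
      using \<open>\<kappa> \<ge> 0\<close> by (simp add: real_sqrt_mult)
    also have "\<dots> \<le> Q * norm q" by (simp add: Q_def distrib_right)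
    finally show ?thesis by (simp add: p q_def)
  qed
  obtain \<epsilon> where "\<epsilon> > 0" and \<epsilon>: "\<And>R'. (\<And>F. finite F \<Longrightarrow> L2_set (\<lambda>i. norm (R' i - Rz i)) F \<le> \<epsilon>) \<Longrightarrow>
      near_identity R' \<and> bdd_invertible (row_op R')"
    using row_op_perturb[OF Rz] by metis
  show ?thesis
    unfolding interpolating_def
  proof (intro exI[of _ "\<epsilon> / Q"] conjI allI impI)
    show "\<epsilon> / Q > 0" using \<open>\<epsilon> > 0\<close> \<open>Q > 0\<close> by simp
    fix d :: "'n \<Rightarrow> int \<Rightarrow> complex^'n"
    assume d: "\<forall>F. finite F \<longrightarrow> L2_set (\<lambda>p. norm (d (fst p) (snd p) - z (fst p))) F \<le> \<epsilon> / Q"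
    have "near_identity (R d) \<and> bdd_invertible (row_op (R d))"
    proof (rule \<epsilon>)
      fix F :: "('n \<times> int) set" assume "finite F"
      have "L2_set (\<lambda>i. norm (R d i - Rz i)) F \<le> L2_set (\<lambda>p. Q * norm (d (fst p) (snd p) - z (fst p))) F"
        by (intro L2_set_mono R_le) auto
      also have "\<dots> = Q * L2_set (\<lambda>p. norm (d (fst p) (snd p) - z (fst p))) F"
        using \<open>Q > 0\<close> by (simp add: L2_set_right_distrib)
      also have "\<dots> \<le> Q * (\<epsilon> / Q)" using d \<open>finite F\<close> \<open>Q > 0\<close> by (intro mult_left_mono) auto
      finally show "L2_set (\<lambda>i. norm (R d i - Rz i)) F \<le> \<epsilon>" using \<open>Q > 0\<close> by simp
    qed
    then have R: "near_identity (R d)" "bdd_invertible (row_op (R d))" by auto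
    {
      fix y :: "'n \<times> int \<Rightarrow> complex" assume y: "sqsum y"
      obtain c where c: "row_op (R d) c = Abs_ell2 y"
        using R(2) unfolding bdd_invertible_def by (metis surjD)
      have "sqsum (\<lambda>j. coord c (l, j))" for l
      proof -
        obtain B where B: "\<And>F. finite F \<Longrightarrow> (\<Sum>i\<in>F. (cmod (coord c i))\<^sup>2) \<le> B"
          using sqsumE_sum[OF sqsum_coord[of c]] by blast
        show ?thesis
        proof (rule sqsumI_sum)
          show "(\<Sum>j\<in>F. (cmod (coord c (l, j)))\<^sup>2) \<le> B" if "finite F" for F
            using B[of "Pair l ` F"] that by (simp add: sum.reindex inj_on_def)
        qed
      qed
      then have "\<exists>g. L2_fun g \<and> (\<forall>s. laplace g s = (\<Sum>\<^sub>\<infinity>j. coord c (l, j) * cauchy_kernel j s))" for l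
        by (rule riesz_fischer)
      then obtain g where g: "\<And>l. L2_fun (g l)"
          "\<And>l s. laplace (g l) s = (\<Sum>\<^sub>\<infinity>j. coord c (l, j) * cauchy_kernel j s)" by metis
      define f where "f = (\<lambda>i \<theta>. \<Sum>l\<in>UNIV. W i l * (exp (- a l * of_real \<theta>) * g l \<theta>))"
      have "(\<Sum>i\<in>UNIV. cnj (d m k $ i) * laplace (f i) (lam m k)) = y (m, k)" for m k
      proof -
        have "(\<Sum>i\<in>UNIV. cnj (d m k $ i) * laplace (f i) (lam m k)) = dot (R d (m, k)) c"
          unfolding f_def R_def weight_def using sum_laplace_eq_dot[OF g] by simp
        also have "\<dots> = coord (row_op (R d) c) (m, k)" by (simp add: near_identity_row_op(1)[OF R(1)])
        finally show ?thesis by (simp add: c y)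
      qed
      moreover have "L2_fun (f i)" for i
        unfolding f_def by (intro L2_fun_sum L2_fun_cmult L2_fun_exp_mult g)
      ultimately show "\<exists>f. (\<forall>i. L2_fun (f i)) \<and>
          (\<forall>m k. (\<Sum>i\<in>UNIV. cnj (d m k $ i) * laplace (f i) (lam m k)) = y (m, k))" by blast
    }
    {
      fix f :: "'n \<Rightarrow> real \<Rightarrow> complex" and i
      assume f: "\<forall>i. L2_fun (f i)"
        and 0: "\<forall>m k. (\<Sum>i\<in>UNIV. cnj (d m k $ i) * laplace (f i) (lam m k)) = 0"
      define g where "g = (\<lambda>l \<theta>. exp (a l * of_real \<theta>) * (\<Sum>i\<in>UNIV. cnj (z l $ i) * f i \<theta>))"
      have g: "L2_fun (g l)" for l
        unfolding g_def using f by (intro L2_fun_sum L2_fun_cmult L2_fun_exp_mult) auto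
      have fg: "f i \<theta> = (\<Sum>l\<in>UNIV. W i l * (exp (- a l * of_real \<theta>) * g l \<theta>))" for i \<theta>
      proof -
        have "exp (- a l * of_real \<theta>) * g l \<theta> = (\<Sum>i\<in>UNIV. cnj (z l $ i) * f i \<theta>)" for l
          by (simp add: g_def exp_minus flip: mult.assoc)
        then have "(\<Sum>l\<in>UNIV. W i l * (exp (- a l * of_real \<theta>) * g l \<theta>))
            = (\<Sum>l\<in>UNIV. \<Sum>i'\<in>UNIV. W i l * cnj (z l $ i') * f i' \<theta>)"
          by (simp only: sum_distrib_left mult.assoc)
        also have "\<dots> = (\<Sum>i'\<in>UNIV. (\<Sum>l\<in>UNIV. W i l * cnj (z l $ i')) * f i' \<theta>)"
          by (subst sum.swap) (simp add: sum_distrib_right)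
        also have "\<dots> = f i \<theta>" by (simp add: Wz if_distrib[of "\<lambda>x. x * _"] cong: if_cong)
        finally show ?thesis by simp
      qed
      define c where "c = Abs_ell2 (\<lambda>p. laplace (g (fst p)) (freq (snd p)))"
      have "sqsum (\<lambda>p. laplace (g (fst p)) (freq (snd p)))"
        by (rule sqsum_prod) (simp add: sqsum_laplace_freq g)
      then have c: "coord c p = laplace (g (fst p)) (freq (snd p))" for p by (simp add: c_def)
      have gc: "laplace (g l) s = (\<Sum>\<^sub>\<infinity>j. coord c (l, j) * cauchy_kernel j s)" for l s
        using laplace_eq_infsum[OF g[of l], of s] by (simp add: c)
      have f_eq: "f i = (\<lambda>\<theta>. \<Sum>l\<in>UNIV. W i l * (exp (- a l * of_real \<theta>) * g l \<theta>))" for i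
        by (intro ext fg)
      have "dot (R d (m, k)) c = (\<Sum>i\<in>UNIV. cnj (d m k $ i) * laplace (f i) (lam m k))" for m k
        unfolding R_def weight_def f_eq fst_conv snd_conv
        by (rule sum_laplace_eq_dot[OF g gc, symmetric])
      then have "row_op (R d) c = 0"
        using 0 by (intro ell2_eqI) (auto simp: near_identity_row_op(1)[OF R(1)])
      moreover obtain r where "r > 0" "\<And>x. r * norm x \<le> norm (row_op (R d) x)"
        using R(2) unfolding bdd_invertible_def by blast
      from this(2)[of c] have "r * norm c \<le> norm (row_op (R d) c)" .
      ultimately have "norm c \<le> 0" using \<open>r > 0\<close> by (simp add: mult_le_0_iff)
      then have "coord c p = 0" for p by simp
      then have "laplace (g l) (freq j) = 0" for l j using c[of "(l, j)"] by simp
      then have "AE \<theta> in unit_interval. g l \<theta> = 0" for l by (rule fourier_unique[OF g])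
      then have "AE \<theta> in unit_interval. \<forall>l. g l \<theta> = 0" by (simp add: AE_all_countable)
      then show "AE \<theta> in unit_interval. f i \<theta> = 0"
        by eventually_elim (simp add: fg)
    }
  qed
qed

text \<open>\<open>W\<close> is the inverse of the matrix with rows
\<open>z\<^sub>m\<^sup>*\<close>.\<close>

lemma independent_rows_inverse:
  fixes z :: "'n::finite \<Rightarrow> complex^'n"
  assumes "inj z" "vec.independent (range z)"
  shows "\<exists>W. (\<forall>m l. (\<Sum>i\<in>UNIV. cnj (z m $ i) * W i l) = (if l = m then 1 else 0)) \<and>
    (\<forall>i i'. (\<Sum>l\<in>UNIV. W i l * cnj (z l $ i')) = (if i' = i then 1 else 0))"
proof -
  define Z :: "complex^'n^'n" where "Z = (\<chi> m i. cnj (z m $ i))"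
  have "\<exists>W. Z ** W = mat 1"
    unfolding matrix_right_invertible_independent_rows
  proof (intro allI impI)
    fix c and m :: 'n
    assume c: "(\<Sum>i\<in>UNIV. c i *s row i Z) = 0"
    have "(\<Sum>i\<in>UNIV. cnj (c i) *s z i) = 0"
    proof (subst vec_eq_iff, rule allI)
      fix j
      have "cnj ((\<Sum>i\<in>UNIV. c i *s row i Z) $ j) = 0" by (simp add: c)
      then show "(\<Sum>i\<in>UNIV. cnj (c i) *s z i) $ j = 0 $ j"
        by (simp add: Z_def row_def)
    qed
    then have "(\<Sum>v\<in>range z. cnj (c (inv z v)) *s v) = 0"
      using \<open>inj z\<close> by (simp add: sum.reindex)
    then have "cnj (c (inv z (z m))) = 0"
      using vec.independentD[OF assms(2), of "range z" "\<lambda>v. cnj (c (inv z v))" "z m"] by simp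
    then show "c m = 0" using \<open>inj z\<close> by simp
  qed
  then obtain W where W: "Z ** W = mat 1" by blast
  then have W': "W ** Z = mat 1" by (simp add: matrix_left_right_inverse)
  show ?thesis
  proof (intro exI[of _ "\<lambda>i l. W $ i $ l"] conjI allI)
    show "(\<Sum>i\<in>UNIV. cnj (z m $ i) * W $ i $ l) = (if l = m then 1 else 0)" for m l
      using arg_cong[OF W, of "\<lambda>A. A $ m $ l"] by (simp add: matrix_matrix_mult_def mat_def Z_def)
    show "(\<Sum>l\<in>UNIV. W $ i $ l * cnj (z l $ i')) = (if i' = i then 1 else 0)" for i i'
      using arg_cong[OF W', of "\<lambda>A. A $ i $ i'"] by (simp add: matrix_matrix_mult_def mat_def Z_def)
  qed
qed

section \<open>The characteristic matrix\<close>

lemma L2_fun_cong: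
  "(\<And>\<theta>. \<theta> \<in> {-1..0} \<Longrightarrow> f \<theta> = g \<theta>) \<Longrightarrow> L2_fun f \<longleftrightarrow> L2_fun g"
  unfolding L2_fun_def
  by (intro conj_cong measurable_cong Bochner_Integration.integrable_cong) auto

lemma integral_initial_segment:
  fixes f :: "real \<Rightarrow> 'b::{banach, second_countable_topology}"
  assumes "\<theta> \<in> {-1..0}"
  shows "(LINT t|lebesgue_on {-1..\<theta>}. f t) = (LINT t|unit_interval. indicator {..\<theta>} t *\<^sub>R f t)"
proof -
  have "(LINT t|lebesgue_on {-1..\<theta>}. f t) = (LINT t|lebesgue. indicator {-1..\<theta>} t *\<^sub>R f t)"
    by (rule integral_restrict_space) simp
  also have "\<dots> = (LINT t|lebesgue. indicator {-1..0} t *\<^sub>R (indicator {..\<theta>} t *\<^sub>R f t))"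
    using assms by (intro Bochner_Integration.integral_cong) (auto simp: indicator_def)
  also have "\<dots> = (LINT t|unit_interval. indicator {..\<theta>} t *\<^sub>R f t)"
    by (rule integral_restrict_space[symmetric]) simp
  finally show ?thesis .
qed

lemma integrable_initial_segment:
  fixes f :: "real \<Rightarrow> complex"
  assumes "\<theta> \<in> {-1..0}" "L2_fun f"
  shows "integrable (lebesgue_on {-1..\<theta>}) f"
proof -
  have "set_integrable lebesgue {-1..0} f"
    unfolding set_integrable_def
    using L2_fun_integrable[OF assms(2)] by (simp add: integrable_restrict_space)
  then have "set_integrable lebesgue {-1..\<theta>} f"
    by (rule set_integrable_subset) (use assms(1) in auto)
  then show ?thesis
    unfolding set_integrable_def by (simp add: integrable_restrict_space)
qed

definition primitive :: "(real \<Rightarrow> complex) \<Rightarrow> real \<Rightarrow> complex" where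
  "primitive f \<theta> = (LINT t|lebesgue_on {-1..\<theta>}. f t)"

lemma ident_measurable_unit_interval [measurable]: "(\<lambda>t. t) \<in> borel_measurable unit_interval"
  by (simp add: measurable_completion measurable_restrict_space1)

text \<open>Integration by parts, carried out with Fubini's theorem because the primitive need not
be differentiable everywhere. The boundary term at \<open>0\<close> vanishes by the zero
mean.\<close>

lemma laplace_primitive:
  assumes f: "L2_fun f" and mean: "(LINT t|unit_interval. f t) = 0"
  shows "L2_fun (primitive f)" "laplace f s = - s * laplace (primitive f) s"
proof -
  interpret P: pair_sigma_finite unit_interval unit_interval
    by (intro pair_sigma_finite.intro I.sigma_finite_measure_axioms)
  note [measurable] = L2_fun_measurable[OF f] continuous_measurable_unit_interval
  define k where "k = (\<lambda>\<theta> t. if t \<le> \<theta> then f t else 0)"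
  have km [measurable]: "case_prod k \<in> borel_measurable (unit_interval \<Otimes>\<^sub>M unit_interval)"
    unfolding k_def by measurable
  have prim: "primitive f \<theta> = (LINT t|unit_interval. k \<theta> t)" if "\<theta> \<in> {-1..0}" for \<theta>
    unfolding primitive_def integral_initial_segment[OF that]
    by (intro Bochner_Integration.integral_cong) (auto simp: k_def)
  have "(\<lambda>\<theta>. LINT t|unit_interval. k \<theta> t) \<in> borel_measurable unit_interval"
    by measurable
  then have pm: "primitive f \<in> borel_measurable unit_interval"
    using prim by (subst measurable_cong[where g="\<lambda>\<theta>. LINT t|unit_interval. k \<theta> t"]) auto
  have k_int: "integrable unit_interval (k \<theta>)" for \<theta>
    by (rule Bochner_Integration.integrable_bound[OF L2_fun_integrable[OF f]])
       (auto simp: k_def intro!: measurable_If)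
  have b: "cmod (primitive f \<theta>) \<le> (LINT t|unit_interval. cmod (f t))" if "\<theta> \<in> {-1..0}" for \<theta>
  proof -
    have "cmod (primitive f \<theta>) \<le> (LINT t|unit_interval. cmod (k \<theta> t))"
      unfolding prim[OF that] by (rule integral_norm_bound)
    also have "\<dots> \<le> (LINT t|unit_interval. cmod (f t))"
      by (intro integral_mono integrable_norm k_int L2_fun_integrable f) (auto simp: k_def)
    finally show ?thesis .
  qed
  show "L2_fun (primitive f)"
    using L2_fun_mult_bounded[OF L2_fun_const[of 1] pm b] by simp
  show "laplace f s = - s * laplace (primitive f) s"
  proof (cases "s = 0")
    case True
    then show ?thesis using mean by (simp add: laplace_def)
  next
    case False
    define h where "h = (\<lambda>\<theta> t. exp (s * complex_of_real \<theta>) * k \<theta> t)"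
    have em [measurable]: "(\<lambda>\<theta>. exp (s * complex_of_real \<theta>)) \<in> borel_measurable unit_interval"
      by (intro continuous_measurable_unit_interval continuous_intros)
    have hm: "case_prod h \<in> borel_measurable (unit_interval \<Otimes>\<^sub>M unit_interval)"
    proof -
      have "(\<lambda>p. exp (s * complex_of_real (fst p)) * case_prod k p) \<in> borel_measurable (unit_interval \<Otimes>\<^sub>M unit_interval)"
        by (intro borel_measurable_times km measurable_compose[OF measurable_fst em])
      then show ?thesis by (simp add: h_def case_prod_beta)
    qed
    have "integrable (unit_interval \<Otimes>\<^sub>M unit_interval) (\<lambda>p. exp \<bar>Re s\<bar> * f (snd p))"
    proof (rule P.Fubini_integrable)
      show "(\<lambda>p. exp \<bar>Re s\<bar> * f (snd p)) \<in> borel_measurable (unit_interval \<Otimes>\<^sub>M unit_interval)"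
        by (intro borel_measurable_times borel_measurable_const measurable_compose[OF measurable_snd L2_fun_measurable[OF f]])
    qed (simp_all add: L2_fun_integrable f)
    then have "integrable (unit_interval \<Otimes>\<^sub>M unit_interval) (case_prod h)"
    proof (rule Bochner_Integration.integrable_bound[OF _ hm])
      show "AE p in unit_interval \<Otimes>\<^sub>M unit_interval. norm (case_prod h p) \<le> norm (exp \<bar>Re s\<bar> * f (snd p))"
      proof (rule AE_I2)
        fix p assume "p \<in> space (unit_interval \<Otimes>\<^sub>M unit_interval)"
        then have "fst p \<in> {-1..0}" by (auto simp: space_pair_measure)
        from cmod_exp_le[OF this, of s]
        show "norm (case_prod h p) \<le> norm (exp \<bar>Re s\<bar> * f (snd p))"
          by (cases p) (auto simp: h_def k_def norm_mult intro!: mult_right_mono)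
      qed
    qed
    note fub = P.Fubini_integral[OF this]
    have "laplace (primitive f) s = (LINT \<theta>|unit_interval. LINT t|unit_interval. h \<theta> t)"
      unfolding laplace_def h_def
      by (intro Bochner_Integration.integral_cong) (auto simp: prim)
    also have "\<dots> = (LINT t|unit_interval. LINT \<theta>|unit_interval. h \<theta> t)"
      by (rule fub[symmetric])
    also have "\<dots> = (LINT t|unit_interval. (1 / s) * f t - (1 / s) * (exp (s * of_real t) * f t))"
    proof (intro Bochner_Integration.integral_cong refl)
      fix t :: real assume "t \<in> space unit_interval"
      then have t: "-1 \<le> t" "t \<le> 0" by auto
      have "(LINT \<theta>|unit_interval. h \<theta> t)
          = (LINT \<theta>|lebesgue. indicator {-1..0} \<theta> *\<^sub>R h \<theta> t)"
        by (rule integral_restrict_space) simp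
      also have "\<dots> = (LINT \<theta>|lebesgue. indicator {t..0} \<theta> *\<^sub>R (exp (s * of_real \<theta>) * f t))"
        using t by (intro Bochner_Integration.integral_cong) (auto simp: indicator_def h_def k_def)
      also have "\<dots> = (LINT \<theta>|lebesgue_on {t..0}. exp (s * of_real \<theta>) * f t)"
        by (rule integral_restrict_space[symmetric]) simp
      also have "\<dots> = (LINT \<theta>|lebesgue_on {t..0}. exp (s * of_real \<theta>)) * f t" by simp
      also have "(LINT \<theta>|lebesgue_on {t..0}. exp (s * of_real \<theta>)) = integral {t..0} (\<lambda>\<theta>. exp (s * of_real \<theta>))"
        by (intro lebesgue_integral_eq_integral continuous_imp_integrable_real continuous_intros) auto
      also have "\<dots> = exp (s * of_real 0) / s - exp (s * of_real t) / s"
      proof (rule integral_unique, rule fundamental_theorem_of_calculus)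
        show "((\<lambda>\<theta>. exp (s * complex_of_real \<theta>) / s) has_vector_derivative exp (s * of_real \<theta>)) (at \<theta> within {t..0})" for \<theta>
          using False by (auto intro!: derivative_eq_intros has_vector_derivative_real_field simp: field_simps)
      qed (rule t)
      finally show "(LINT \<theta>|unit_interval. h \<theta> t) = (1 / s) * f t - (1 / s) * (exp (s * of_real t) * f t)"
        by (simp add: algebra_simps)
    qed
    also have "\<dots> = (1 / s) * (LINT t|unit_interval. f t) - (1 / s) * laplace f s"
      unfolding laplace_def
      by (subst Bochner_Integration.integral_diff)
         (auto intro!: L2_fun_integrable L2_fun_cmult[of f] L2_fun_cmult[OF L2_fun_exp_mult] f simp del: times_divide_eq_left)
    finally show ?thesis using False mean by (simp add: field_simps)
  qed
qed

text \<open>The integral of a matrix function is zero by convention when the function is not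
integrable, so integrability of the whole matrix has to be assembled from its entries
first.\<close>

lemma integral_matrix_component:
  fixes A :: "real \<Rightarrow> complex^'n::finite^'m::finite"
  assumes "\<And>i j. integrable M (\<lambda>\<theta>. A \<theta> $ i $ j)"
  shows "(LINT \<theta>|M. A \<theta>) $ i $ j = (LINT \<theta>|M. A \<theta> $ i $ j)"
proof -
  have ax: "bounded_linear (\<lambda>x. axis i (axis j x) :: complex^'n^'m)" for i j
    by (intro linear_conv_bounded_linear[THEN iffD1] linearI) (auto simp: vec_eq_iff axis_def)
  have "A \<theta> = (\<Sum>i\<in>UNIV. \<Sum>j\<in>UNIV. axis i (axis j (A \<theta> $ i $ j)))" for \<theta>
  proof -
    have "(\<Sum>j'\<in>UNIV. axis i' (axis j' (A \<theta> $ i' $ j')) $ i $ j) = (if i' = i then A \<theta> $ i $ j else 0)" for i i' j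
      by (cases "i' = i") (simp_all add: axis_def)
    then show ?thesis by (simp add: vec_eq_iff)
  qed
  moreover have "integrable M (\<lambda>\<theta>. \<Sum>i\<in>UNIV. \<Sum>j\<in>UNIV. axis i (axis j (A \<theta> $ i $ j)) :: complex^'n^'m)"
    by (intro Bochner_Integration.integrable_sum integrable_bounded_linear[OF ax] assms)
  ultimately have "integrable M A" by presburger
  then have "(LINT \<theta>|M. A \<theta> $ i $ j) = (LINT \<theta>|M. A \<theta>) $ i $ j"
    using integral_bounded_linear[OF bounded_linear_compose[OF bounded_linear_vec_nth[of j] bounded_linear_vec_nth[of i]]]
    by blast
  then show ?thesis by simp
qed

lemma char_matrix_component:
  assumes A2: "L2_matrix A2" and A3: "L2_matrix A3"
  shows "char_matrix A1 A2 A3 s $ i $ j = (if i = j then s else 0) - s * exp (- s) * A1 $ i $ j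
    - s * laplace (\<lambda>\<theta>. A2 \<theta> $ i $ j) s - laplace (\<lambda>\<theta>. A3 \<theta> $ i $ j) s"
proof -
  have L: "L2_fun (\<lambda>\<theta>. A2 \<theta> $ i $ j)" "L2_fun (\<lambda>\<theta>. A3 \<theta> $ i $ j)" for i j
    using assms by (auto simp: L2_matrix_def)
  have "(LINT \<theta>|unit_interval. map_matrix (\<lambda>a. s * exp (s * of_real \<theta>) * a) (A2 \<theta>)) $ i $ j
      = s * laplace (\<lambda>\<theta>. A2 \<theta> $ i $ j) s"
    by (subst integral_matrix_component)
       (auto simp: laplace_def mult.assoc intro!: L2_fun_integrable L2_fun_cmult L2_fun_exp_mult L)
  moreover have "(LINT \<theta>|unit_interval. map_matrix (\<lambda>a. exp (s * of_real \<theta>) * a) (A3 \<theta>)) $ i $ j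
      = laplace (\<lambda>\<theta>. A3 \<theta> $ i $ j) s"
    by (subst integral_matrix_component)
       (auto simp: laplace_def intro!: L2_fun_integrable L2_fun_exp_mult L)
  ultimately show ?thesis by (simp add: char_matrix_def mat_def)
qed

lemma neutral_kernel_component:
  assumes A3: "L2_matrix A3" and "\<theta> \<in> {-1..0}"
  shows "neutral_kernel A2 A3 \<theta> $ i $ j = A2 \<theta> $ i $ j - primitive (\<lambda>t. A3 t $ i $ j) \<theta>"
  using assms unfolding neutral_kernel_def primitive_def L2_matrix_def
  by (simp add: integral_matrix_component integrable_initial_segment)

text \<open>Integrating the term with \<open>A3\<close> by parts extracts the factor
\<open>s\<close> from the whole characteristic matrix.\<close>

lemma char_matrix_neutral_kernel:
  assumes A2: "L2_matrix A2" and A3: "L2_matrix A3" and mean: "zero_mean A3"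
  shows "L2_matrix (neutral_kernel A2 A3)"
    "char_matrix A1 A2 A3 s $ i $ j = s * ((if i = j then 1 else 0) - exp (- s) * A1 $ i $ j
      - laplace (\<lambda>\<theta>. neutral_kernel A2 A3 \<theta> $ i $ j) s)"
proof -
  have L: "L2_fun (\<lambda>\<theta>. A2 \<theta> $ i $ j)" "L2_fun (\<lambda>\<theta>. A3 \<theta> $ i $ j)" for i j
    using A2 A3 by (auto simp: L2_matrix_def)
  have "(LINT \<theta>|unit_interval. A3 \<theta> $ i $ j) = 0" for i j
    using mean integral_matrix_component[of unit_interval A3 i j] L(2)
    by (simp add: zero_mean_def L2_fun_integrable)
  note prim = laplace_primitive[OF L(2) this]
  have K: "neutral_kernel A2 A3 \<theta> $ i $ j = A2 \<theta> $ i $ j - primitive (\<lambda>t. A3 t $ i $ j) \<theta>"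
    if "\<theta> \<in> {-1..0}" for \<theta> i j
    using neutral_kernel_component[OF A3 that] .
  have Ld: "L2_fun (\<lambda>\<theta>. A2 \<theta> $ i $ j - primitive (\<lambda>t. A3 t $ i $ j) \<theta>)" for i j
    by (intro L2_fun_diff L prim)
  have "L2_fun (\<lambda>\<theta>. neutral_kernel A2 A3 \<theta> $ i $ j)" for i j
    by (rule L2_fun_cong[where g="\<lambda>\<theta>. A2 \<theta> $ i $ j - primitive (\<lambda>t. A3 t $ i $ j) \<theta>", THEN iffD2])
       (rule K, assumption, rule Ld)
  then show "L2_matrix (neutral_kernel A2 A3)" by (simp add: L2_matrix_def)
  have "laplace (\<lambda>\<theta>. neutral_kernel A2 A3 \<theta> $ i $ j) s
      = laplace (\<lambda>\<theta>. A2 \<theta> $ i $ j - primitive (\<lambda>t. A3 t $ i $ j) \<theta>) s"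
    unfolding laplace_def by (intro Bochner_Integration.integral_cong) (auto simp: K)
  also have "\<dots> = laplace (\<lambda>\<theta>. A2 \<theta> $ i $ j) s - laplace (primitive (\<lambda>t. A3 t $ i $ j)) s"
    by (rule laplace_diff[OF L(1) prim(1)])
  finally have K_laplace: "laplace (\<lambda>\<theta>. neutral_kernel A2 A3 \<theta> $ i $ j) s
      = laplace (\<lambda>\<theta>. A2 \<theta> $ i $ j) s - laplace (primitive (\<lambda>t. A3 t $ i $ j)) s" .
  show "char_matrix A1 A2 A3 s $ i $ j = s * ((if i = j then 1 else 0) - exp (- s) * A1 $ i $ j
      - laplace (\<lambda>\<theta>. neutral_kernel A2 A3 \<theta> $ i $ j) s)"
    unfolding char_matrix_component[OF A2 A3] prim(2) K_laplace by (simp add: algebra_simps)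
qed

lemma det_eq_0_if_left_kernel:
  fixes M :: "complex^'n::finite^'n"
  assumes "v v* M = 0" "v \<noteq> 0"
  shows "det M = 0"
proof (rule ccontr)
  assume "det M \<noteq> 0"
  then obtain N where "M ** N = mat 1" by (auto simp: invertible_det_nz[symmetric] invertible_def)
  then have "v = (v v* M) v* N" by (simp add: vector_matrix_mul_assoc)
  with assms show False by simp
qed

lemma sqsum_nat_tendsto_0:
  assumes "sqsum f"
  shows "(\<lambda>n. f (int n)) \<longlonglongrightarrow> 0"
proof (rule LIMSEQ_I)
  fix e :: real assume "e > 0"
  then obtain F0 where F0: "finite F0" "\<And>F. finite F \<Longrightarrow> F \<inter> F0 = {} \<Longrightarrow> (\<Sum>j\<in>F. (cmod (f j))\<^sup>2) < e\<^sup>2"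
    using summable_on_small_tail[OF assms[unfolded sqsum_def], of "e\<^sup>2"] by auto
  have "finite {n. int n \<in> F0}"
    using finite_vimageI[OF F0(1), of int] by (simp add: vimage_def)
  then obtain N where N: "\<forall>n\<in>{n. int n \<in> F0}. n < N" using finite_nat_set_iff_bounded by blast
  have "cmod (f (int n)) < e" if "n \<ge> N" for n
  proof -
    have "int n \<notin> F0" using N that by auto
    then have "(cmod (f (int n)))\<^sup>2 < e\<^sup>2" using F0(2)[of "{int n}"] by simp
    then show ?thesis using \<open>e > 0\<close> by (simp add: power_less_imp_less_base)
  qed
  then show "\<exists>N. \<forall>n\<ge>N. norm (f (int n) - 0) < e" by auto
qed

text \<open>On the lattice \<open>2\<pi>in\<close> this is the decay of Fourier coefficients; off
the lattice, \<open>e\<^bsup>\<delta>\<theta>\<^esup>\<close> tends to one uniformly.\<close>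

lemma laplace_tendsto_0:
  assumes g: "L2_fun g" and \<delta>: "\<delta> \<longlonglongrightarrow> 0"
  shows "(\<lambda>n. laplace g (a + freq (int n) + \<delta> n)) \<longlonglongrightarrow> 0"
proof -
  define G where "G = (\<lambda>\<theta>. exp (a * of_real \<theta>) * g \<theta>)"
  have G: "L2_fun G" unfolding G_def by (rule L2_fun_exp_mult[OF g])
  define D where "D = (\<lambda>n \<theta>. (exp (\<delta> n * of_real \<theta>) - 1) * G \<theta>)"
  have D: "L2_fun (D n)" for n
    unfolding D_def by (intro L2_fun_mult_continuous G continuous_intros)
  have eq: "laplace g (a + freq (int n) + \<delta> n) = laplace G (freq (int n)) + laplace (D n) (freq (int n))" for n
  proof -
    have "laplace G (freq (int n)) + laplace (D n) (freq (int n))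
        = laplace (\<lambda>\<theta>. G \<theta> + D n \<theta>) (freq (int n))" by (simp add: laplace_add G D)
    also have "(\<lambda>\<theta>. G \<theta> + D n \<theta>) = (\<lambda>\<theta>. exp ((a + \<delta> n) * of_real \<theta>) * g \<theta>)"
      by (simp add: D_def G_def fun_eq_iff algebra_simps exp_add)
    finally show ?thesis by (simp only: laplace_exp_mult add_ac)
  qed
  have lim1: "(\<lambda>n. laplace G (freq (int n))) \<longlonglongrightarrow> 0"
    by (rule sqsum_nat_tendsto_0) (rule sqsum_laplace_freq[OF G])
  have lim2: "(\<lambda>n. laplace (D n) (freq (int n))) \<longlonglongrightarrow> 0"
  proof (rule Lim_null_comparison)
    have "(\<lambda>n. exp (cmod (\<delta> n)) * cmod (\<delta> n) * sqrt (sq_int G)) \<longlonglongrightarrow> exp (cmod 0) * cmod 0 * sqrt (sq_int G)"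
      by (intro tendsto_intros \<delta>)
    then show "(\<lambda>n. exp (cmod (\<delta> n)) * cmod (\<delta> n) * sqrt (sq_int G)) \<longlonglongrightarrow> 0" by simp
    have "cmod (laplace (D n) (freq (int n))) \<le> exp (cmod (\<delta> n)) * cmod (\<delta> n) * sqrt (sq_int G)" for n
    proof -
      define M where "M = exp (cmod (\<delta> n)) * cmod (\<delta> n)"
      have M: "cmod (exp (\<delta> n * of_real \<theta>) - 1) \<le> M" if "\<theta> \<in> {-1..0}" for \<theta>
        using cmod_exp_minus_one_le[OF that] by (simp add: M_def)
      have "sq_int (D n) \<le> (LINT \<theta>|unit_interval. M\<^sup>2 * (cmod (G \<theta>))\<^sup>2)"
        by (intro integral_mono L2_fun_sq_integrable D integrable_mult_right G)
           (auto simp: D_def norm_mult power_mult_distrib intro!: mult_right_mono power_mono M)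
      then have "sqrt (sq_int (D n)) \<le> M * sqrt (sq_int G)"
        using real_sqrt_le_mono[of "sq_int (D n)" "M\<^sup>2 * sq_int G"] by (simp add: real_sqrt_mult M_def)
      then show ?thesis using cmod_laplace_le[OF D, of n "freq (int n)"] by (simp add: M_def)
    qed
    then show "\<forall>\<^sub>F n in sequentially. norm (laplace (D n) (freq (int n)))
        \<le> exp (cmod (\<delta> n)) * cmod (\<delta> n) * sqrt (sq_int G)" by simp
  qed
  show ?thesis unfolding eq using tendsto_add[OF lim1 lim2] by simp
qed

lemma exp_lambda_tilde:
  assumes "\<mu> \<noteq> 0"
  shows "exp (lambda_tilde \<mu> k) = \<mu>"
proof -
  have "exp (lambda_tilde \<mu> k) = of_real (cmod \<mu>) * exp (\<i> * of_real (Arg \<mu>)) * exp (freq k)"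
    using assms by (simp add: lambda_tilde_def freq_def exp_add distrib_left exp_of_real mult_ac)
  also have "\<dots> = \<mu>" using Arg_eq[OF assms] by simp
  finally show ?thesis .
qed

lemma exp_minus_eq:
  assumes "\<mu> \<noteq> 0"
  shows "exp (- s) = inverse \<mu> * exp (- (s - lambda_tilde \<mu> k))"
proof -
  have "exp s = \<mu> * exp (s - lambda_tilde \<mu> k)"
    using assms by (simp add: exp_diff exp_lambda_tilde)
  then show ?thesis by (simp only: exp_minus inverse_mult_distrib)
qed

lemma left_kernel_iff:
  "cnj_vec v v* M = 0 \<longleftrightarrow> (\<forall>j. (\<Sum>i\<in>UNIV. cnj (v $ i) * M $ i $ j) = 0)"
  by (simp add: vec_eq_iff vector_matrix_mult_def cnj_vec_def mult.commute)

lemma sqsum_norm_bound: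
  fixes p :: "'i \<Rightarrow> 'a::real_normed_vector"
  assumes "(\<lambda>i. (norm (p i))\<^sup>2) summable_on UNIV" "\<And>i. cmod (g i) \<le> C * norm (p i)"
  shows "sqsum g"
proof (rule sqsum_bounded_mult)
  show "sqsum (\<lambda>i. of_real (norm (p i)))" using assms(1) by (simp add: sqsum_def)
  show "cmod (g i) \<le> C * cmod (of_real (norm (p i)))" for i using assms(2) by simp
qed

text \<open>For \<open>d = z\<^sub>m\<close> and \<open>e\<^bsup>\<lambda>\<^esup> =
\<mu>\<^sub>m\<close> the data would vanish, by the choice of \<open>A\<close>. They are
therefore of the order of \<open>\<parallel>d - z\<^sub>m\<parallel>\<close> plus the
distance between \<open>\<lambda>\<close> and its unperturbed node.\<close>

lemma sqsum_target:
  fixes z :: "'n::finite \<Rightarrow> complex^'n" and A :: "complex^'n^'n"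
  assumes \<mu>: "\<And>m. \<mu> m \<noteq> 0"
    and zA: "\<And>m j. (\<Sum>i\<in>UNIV. cnj (z m $ i) * A $ i $ j) = \<mu> m * cnj (z m $ j)"
    and close: "\<And>m. sqsum (\<lambda>k. lam m k - lambda_tilde (\<mu> m) k)"
    and d: "\<And>m. (\<lambda>k. (norm (d m k - z m))\<^sup>2) summable_on UNIV"
  shows "sqsum (\<lambda>p. \<Sum>i\<in>UNIV. cnj (d (fst p) (snd p) $ i) *
    ((if i = j then 1 else 0) - exp (- lam (fst p) (snd p)) * A $ i $ j))"
proof (rule sqsum_prod)
  fix m
  define \<delta> where "\<delta> = (\<lambda>k. lam m k - lambda_tilde (\<mu> m) k)"
  have \<delta>: "sqsum \<delta>" using close[of m] by (simp add: \<delta>_def)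
  define C where "C = exp (norm (Abs_ell2 \<delta>))"
  have C: "exp (cmod (\<delta> k)) \<le> C" for k
    using cmod_coord_le_norm[of "Abs_ell2 \<delta>" k] \<delta> by (simp add: C_def)
  define p where "p = (\<lambda>k. d m k - z m)"
  have e: "exp (- lam m k) = exp (- \<delta> k) / \<mu> m" for k
    using exp_minus_eq[OF \<mu>, of "lam m k" m k] by (simp only: \<delta>_def divide_inverse mult.commute)
  have s1: "sqsum (\<lambda>k. (1 - exp (- \<delta> k)) * cnj (z m $ j))"
  proof (rule sqsum_bounded_mult[OF \<delta>])
    fix k
    have "cmod (1 - exp (- \<delta> k)) \<le> exp (cmod (\<delta> k)) * cmod (\<delta> k)"
      using cmod_exp_minus_one_le[of "-1" "\<delta> k"] by (simp add: norm_minus_commute)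
    also have "\<dots> \<le> C * cmod (\<delta> k)" using C by (rule mult_right_mono) simp
    finally have "cmod (1 - exp (- \<delta> k)) * cmod (z m $ j) \<le> C * cmod (\<delta> k) * cmod (z m $ j)"
      by (rule mult_right_mono) simp
    then show "cmod ((1 - exp (- \<delta> k)) * cnj (z m $ j)) \<le> C * cmod (z m $ j) * cmod (\<delta> k)"
      by (simp add: norm_mult mult_ac)
  qed
  have s2: "sqsum (\<lambda>k. \<Sum>i\<in>UNIV. cnj (p k $ i) * ((if i = j then 1 else 0) - exp (- lam m k) * A $ i $ j))"
  proof (rule sqsum_norm_bound[of p])
    show "(\<lambda>k. (norm (p k))\<^sup>2) summable_on UNIV" using d by (simp add: p_def)
    fix k
    have "cmod (exp (- \<delta> k)) \<le> C"
      using C[of k] by (intro order_trans[OF norm_exp]) simp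
    then have el: "cmod (exp (- lam m k)) \<le> C / cmod (\<mu> m)"
      unfolding e norm_divide by (rule divide_right_mono) simp
    have "cmod ((if i = j then 1 else 0) - exp (- lam m k) * A $ i $ j) \<le> 1 + C / cmod (\<mu> m) * cmod (A $ i $ j)" for i
    proof -
      have "cmod ((if i = j then 1 else 0) - exp (- lam m k) * A $ i $ j)
          \<le> cmod (if i = j then 1 else 0) + cmod (exp (- lam m k)) * cmod (A $ i $ j)"
        using norm_triangle_ineq4[of "if i = j then 1 else 0" "exp (- lam m k) * A $ i $ j"] by (simp only: norm_mult)
      also have "\<dots> \<le> 1 + C / cmod (\<mu> m) * cmod (A $ i $ j)"
        by (intro add_mono mult_right_mono el) auto
      finally show ?thesis .
    qed
    then have "cmod (\<Sum>i\<in>UNIV. cnj (p k $ i) * ((if i = j then 1 else 0) - exp (- lam m k) * A $ i $ j))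
        \<le> (\<Sum>i\<in>UNIV. norm (p k) * (1 + C / cmod (\<mu> m) * cmod (A $ i $ j)))"
      by (intro order_trans[OF norm_sum] sum_mono)
         (auto simp only: norm_mult complex_mod_cnj intro!: mult_mono Finite_Cartesian_Product.norm_nth_le norm_ge_zero)
    then show "cmod (\<Sum>i\<in>UNIV. cnj (p k $ i) * ((if i = j then 1 else 0) - exp (- lam m k) * A $ i $ j))
        \<le> (\<Sum>i\<in>UNIV. 1 + C / cmod (\<mu> m) * cmod (A $ i $ j)) * norm (p k)"
      unfolding mult.commute[of _ "norm (p k)"] sum_distrib_left .
  qed
  have "(\<Sum>i\<in>UNIV. cnj (d m k $ i) * ((if i = j then 1 else 0) - exp (- lam m k) * A $ i $ j))
      = (1 - exp (- \<delta> k)) * cnj (z m $ j)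
        + (\<Sum>i\<in>UNIV. cnj (p k $ i) * ((if i = j then 1 else 0) - exp (- lam m k) * A $ i $ j))" for k
  proof -
    have "(\<Sum>i\<in>UNIV. cnj (z m $ i) * ((if i = j then 1 else 0) - exp (- lam m k) * A $ i $ j))
        = cnj (z m $ j) - exp (- lam m k) * (\<Sum>i\<in>UNIV. cnj (z m $ i) * A $ i $ j)"
      by (simp add: right_diff_distrib sum_subtractf sum_distrib_left mult_ac if_distrib[of "(*) _"] cong: if_cong)
    also have "\<dots> = (1 - exp (- \<delta> k)) * cnj (z m $ j)"
      using \<mu>[of m] by (simp add: zA e algebra_simps)
    finally show ?thesis
      by (simp add: p_def left_diff_distrib sum_subtractf)
  qed
  then show "sqsum (\<lambda>k. \<Sum>i\<in>UNIV. cnj (d (fst (m, k)) (snd (m, k)) $ i) *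
      ((if i = j then 1 else 0) - exp (- lam (fst (m, k)) (snd (m, k))) * A $ i $ j))"
    using sqsum_add[OF s1 s2] by simp
qed

text \<open>At a nonzero node the factor in front of the characteristic matrix can be cancelled. At
the node zero the matrix vanishes and imposes no condition.\<close>

lemma spectral_assignment_interpolation:
  assumes "spectral_assignment lam d A1 A2 A3" "zero_mean A3" "lam m k \<noteq> 0"
  shows "(\<Sum>i\<in>UNIV. cnj (d m k $ i) * ((if i = j then 1 else 0) - exp (- lam m k) * A1 $ i $ j
    - laplace (\<lambda>\<theta>. neutral_kernel A2 A3 \<theta> $ i $ j) (lam m k))) = 0"
proof -
  have A: "L2_matrix A2" "L2_matrix A3" "cnj_vec (d m k) v* char_matrix A1 A2 A3 (lam m k) = 0"
    using assms(1) by (auto simp: spectral_assignment_def)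
  have "(\<Sum>i\<in>UNIV. cnj (d m k $ i) * char_matrix A1 A2 A3 (lam m k) $ i $ j) = 0"
    using A(3) unfolding left_kernel_iff by blast
  then have "lam m k * (\<Sum>i\<in>UNIV. cnj (d m k $ i) * ((if i = j then 1 else 0) - exp (- lam m k) * A1 $ i $ j
    - laplace (\<lambda>\<theta>. neutral_kernel A2 A3 \<theta> $ i $ j) (lam m k))) = 0"
    unfolding char_matrix_neutral_kernel(2)[OF A(1,2) assms(2)] sum_distrib_left
    by (simp only: mult.left_commute)
  then show ?thesis using assms(3) by simp
qed

lemma eventually_lam_nonzero:
  fixes lam :: "int \<Rightarrow> complex"
  assumes "inj lam"
  shows "\<forall>\<^sub>F n in sequentially. lam (int n) \<noteq> 0"
proof (cases "\<exists>k. lam k = 0")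
  case True
  then obtain k where "lam k = 0" by blast
  then have "lam (int n) \<noteq> 0" if "n > nat \<bar>k\<bar>" for n
    using injD[OF assms, of "int n" k] that by auto
  then show ?thesis
    using eventually_gt_at_top[of "nat \<bar>k\<bar>"] by (rule eventually_mono[rotated])
qed auto

text \<open>In the difference of the two interpolation conditions the kernel contributes a term that
tends to zero along the nodes. In the limit only \<open>z\<^sub>m\<^sup>* (A1 - B1) =
0\<close> remains, and the vectors \<open>z\<^sub>m\<close> span the space.\<close>

lemma neutral_matrix_unique:
  fixes z :: "'n::finite \<Rightarrow> complex^'n" and lam :: "'n \<Rightarrow> int \<Rightarrow> complex"
  assumes \<mu>: "\<And>m. \<mu> m \<noteq> 0"
    and Wz: "\<And>i i'. (\<Sum>l\<in>UNIV. W i l * cnj (z l $ i')) = (if i' = i then 1 else 0)"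
    and lam: "\<And>m. inj (lam m)"
    and close: "\<And>m. sqsum (\<lambda>k. lam m k - lambda_tilde (\<mu> m) k)"
    and d: "\<And>m. (\<lambda>k. (norm (d m k - z m))\<^sup>2) summable_on UNIV"
    and A: "spectral_assignment lam d A1 A2 A3" "zero_mean A3"
    and B: "spectral_assignment lam d B1 B2 B3" "zero_mean B3"
  shows "A1 = B1"
proof -
  define D where "D = (\<lambda>i j. A1 $ i $ j - B1 $ i $ j)"
  define K where "K = (\<lambda>i j \<theta>. neutral_kernel A2 A3 \<theta> $ i $ j - neutral_kernel B2 B3 \<theta> $ i $ j)"
  have L: "L2_fun (\<lambda>\<theta>. neutral_kernel A2 A3 \<theta> $ i $ j)" "L2_fun (\<lambda>\<theta>. neutral_kernel B2 B3 \<theta> $ i $ j)" for i j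
    using char_matrix_neutral_kernel(1)[of A2 A3] char_matrix_neutral_kernel(1)[of B2 B3] A B
    by (auto simp: spectral_assignment_def L2_matrix_def)
  have K: "L2_fun (K i j)" for i j unfolding K_def by (intro L2_fun_diff L)
  have eq: "(\<Sum>i\<in>UNIV. cnj (d m k $ i) * (exp (- lam m k) * D i j + laplace (K i j) (lam m k))) = 0"
    if "lam m k \<noteq> 0" for m k j
    using spectral_assignment_interpolation[OF A that, of j] spectral_assignment_interpolation[OF B that, of j]
    by (simp add: K_def D_def laplace_diff L algebra_simps sum.distrib sum_subtractf)
  have zD: "(\<Sum>i\<in>UNIV. cnj (z m $ i) * D i j) = 0" for m j
  proof -
    define \<delta> where "\<delta> = (\<lambda>k. lam m k - lambda_tilde (\<mu> m) k)"
    have \<delta>: "(\<lambda>n. \<delta> (int n)) \<longlonglongrightarrow> 0"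
      using close[of m] by (intro sqsum_nat_tendsto_0) (simp add: \<delta>_def)
    have lam_eq: "lam m k = lambda_tilde (\<mu> m) 0 + freq k + \<delta> k" for k
      using lambda_tilde_freq[of "\<mu> m" k] by (simp add: \<delta>_def)
    have "(\<lambda>n. inverse (\<mu> m) * exp (- \<delta> (int n))) \<longlonglongrightarrow> inverse (\<mu> m) * exp (- 0)"
      by (intro tendsto_intros \<delta>)
    moreover have "exp (- lam m k) = inverse (\<mu> m) * exp (- \<delta> k)" for k
      using exp_minus_eq[OF \<mu>, of "lam m k" m k] by (simp only: \<delta>_def)
    ultimately have lim_e: "(\<lambda>n. exp (- lam m (int n))) \<longlonglongrightarrow> inverse (\<mu> m)"
      by simp
    have lim_K: "(\<lambda>n. laplace (K i j) (lam m (int n))) \<longlonglongrightarrow> 0" for i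
      unfolding lam_eq by (rule laplace_tendsto_0[OF K \<delta>])
    have "sqsum (\<lambda>k. of_real (norm (d m k - z m)))"
      using d[of m] by (simp add: sqsum_def)
    then have "(\<lambda>n. complex_of_real (norm (d m (int n) - z m))) \<longlonglongrightarrow> of_real 0"
      using sqsum_nat_tendsto_0 by simp
    then have "(\<lambda>n. norm (d m (int n) - z m)) \<longlonglongrightarrow> 0"
      unfolding tendsto_of_real_iff .
    then have lim_d: "(\<lambda>n. d m (int n)) \<longlonglongrightarrow> z m"
      by (simp add: tendsto_norm_zero_iff LIM_zero_iff)
    have "(\<lambda>n. \<Sum>i\<in>UNIV. cnj (d m (int n) $ i) * (exp (- lam m (int n)) * D i j + laplace (K i j) (lam m (int n))))
        \<longlonglongrightarrow> (\<Sum>i\<in>UNIV. cnj (z m $ i) * (inverse (\<mu> m) * D i j + 0))"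
      by (intro tendsto_intros lim_d lim_e lim_K)
    moreover have "(\<lambda>n. \<Sum>i\<in>UNIV. cnj (d m (int n) $ i) * (exp (- lam m (int n)) * D i j + laplace (K i j) (lam m (int n))))
        \<longlonglongrightarrow> 0"
      using eventually_lam_nonzero[OF lam[of m]]
      by (rule_tac tendsto_eventually) (auto elim!: eventually_mono intro: eq)
    ultimately have "(\<Sum>i\<in>UNIV. cnj (z m $ i) * (inverse (\<mu> m) * D i j + 0)) = 0"
      by (rule LIMSEQ_unique)
    then have "inverse (\<mu> m) * (\<Sum>i\<in>UNIV. cnj (z m $ i) * D i j) = 0"
      by (simp add: sum_distrib_left mult.left_commute)
    then show ?thesis using \<mu>[of m] by simp
  qed
  have "D i j = 0" for i j
  proof -
    have "D i j = (\<Sum>i'\<in>UNIV. (\<Sum>l\<in>UNIV. W i l * cnj (z l $ i')) * D i' j)"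
      by (simp add: Wz if_distrib[of "\<lambda>x. x * _"] cong: if_cong)
    also have "\<dots> = (\<Sum>l\<in>UNIV. W i l * (\<Sum>i'\<in>UNIV. cnj (z l $ i') * D i' j))"
      by (simp add: sum_distrib_right sum_distrib_left mult.assoc, subst sum.swap, rule refl)
    finally show ?thesis by (simp add: zD)
  qed
  then show ?thesis by (simp add: vec_eq_iff D_def)
qed

section \<open>Assignment of spectrum and degenerating vectors\<close>

text \<open>Existence takes \<open>A3 = 0\<close>, so that \<open>A2\<close> is the neutral kernel.
Its columns are found one by one. The bound \<open>e\<close> from the interpolation
theorem refers to the double square sum, hence the division by the number of blocks.\<close>

theorem theorem5p4:
  fixes \<mu> :: "'n::finite \<Rightarrow> complex"
    and z :: "'n \<Rightarrow> complex^'n"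
    and lam :: "'n \<Rightarrow> int \<Rightarrow> complex"
  assumes "inj \<mu>" and "\<And>m. \<mu> m \<noteq> 0"
    and "\<And>m. z m \<noteq> 0" and "inj z" and "vec.independent (range z)"
    and "inj (\<lambda>(m, k). lam m k)"
    and "\<And>m. (\<lambda>k. (cmod (lam m k - lambda_tilde (\<mu> m) k))\<^sup>2) summable_on UNIV"
    and "\<And>m0 k0 m k. lam m0 k0 = lambda_tilde (\<mu> m) k \<Longrightarrow> m0 = m \<and> k0 = k"
  shows "\<exists>\<epsilon>>0. \<forall>d :: 'n \<Rightarrow> int \<Rightarrow> complex^'n.
    (\<forall>m k. d m k \<noteq> 0) \<and>
    (\<forall>m. (\<lambda>k. (norm (d m k - z m))\<^sup>2) summable_on UNIV \<and>
         (\<Sum>\<^sub>\<infinity>k. (norm (d m k - z m))\<^sup>2) < \<epsilon>) \<longrightarrow>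
    (\<exists>A1 A2 A3. spectral_assignment lam d A1 A2 A3) \<and>
    (\<exists>A1 A2 A3. spectral_assignment lam d A1 A2 A3 \<and> zero_mean A3) \<and>
    (\<forall>A1 A2 A3 B1 B2 B3.
      spectral_assignment lam d A1 A2 A3 \<and> zero_mean A3 \<and>
      spectral_assignment lam d B1 B2 B3 \<and> zero_mean B3 \<longrightarrow>
      A1 = B1 \<and>
      ((\<forall>m k. lam m k \<noteq> 0) \<longrightarrow>
        (AE \<theta> in lebesgue_on {-1..0}. neutral_kernel A2 A3 \<theta> = neutral_kernel B2 B3 \<theta>) \<and>
        char_matrix A1 A2 A3 = char_matrix B1 B2 B3))"
proof -
  note \<mu> = assms(2)
  obtain W where zW: "\<And>m l. (\<Sum>i\<in>UNIV. cnj (z m $ i) * W i l) = (if l = m then 1 else 0)"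
    and Wz: "\<And>i i'. (\<Sum>l\<in>UNIV. W i l * cnj (z l $ i')) = (if i' = i then 1 else 0)"
    using independent_rows_inverse[OF assms(4,5)] by blast
  have lam: "inj (lam m)" for m
    using assms(6) by (auto simp: inj_def)
  have close: "sqsum (\<lambda>k. lam m k - lambda_tilde (\<mu> m) k)" for m
    using assms(7) by (simp add: sqsum_def)
  have close': "sqsum (\<lambda>p. lam (fst p) (snd p) - lambda_tilde (\<mu> (fst p)) (snd p))"
    by (rule sqsum_prod) (simp add: close)
  have avoid: "j = k" if "lam m j = lambda_tilde (\<mu> m) k" for m j k
    using assms(8)[OF that] by blast
  have "\<exists>e>0. \<forall>d :: 'n \<Rightarrow> int \<Rightarrow> complex^'n.
    (\<forall>F. finite F \<longrightarrow> L2_set (\<lambda>p. norm (d (fst p) (snd p) - z (fst p))) F \<le> e) \<longrightarrow> interpolating lam d"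
    by (rule exponential_interpolation[OF zW Wz lam close']) (erule avoid)
  then obtain e where "e > 0" and e: "\<forall>d :: 'n \<Rightarrow> int \<Rightarrow> complex^'n.
    (\<forall>F. finite F \<longrightarrow> L2_set (\<lambda>p. norm (d (fst p) (snd p) - z (fst p))) F \<le> e) \<longrightarrow> interpolating lam d"
    by blast
  define \<epsilon> where "\<epsilon> = e\<^sup>2 / real CARD('n)"
  have "\<epsilon> > 0" using \<open>e > 0\<close> by (simp add: \<epsilon>_def)
  have main: "(\<exists>A1 A2 A3. spectral_assignment lam d A1 A2 A3 \<and> zero_mean A3) \<and>
    (\<forall>A1 A2 A3 B1 B2 B3.
      spectral_assignment lam d A1 A2 A3 \<and> zero_mean A3 \<and>
      spectral_assignment lam d B1 B2 B3 \<and> zero_mean B3 \<longrightarrow>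
      A1 = B1 \<and>
      ((\<forall>m k. lam m k \<noteq> 0) \<longrightarrow>
        (AE \<theta> in unit_interval. neutral_kernel A2 A3 \<theta> = neutral_kernel B2 B3 \<theta>) \<and>
        char_matrix A1 A2 A3 = char_matrix B1 B2 B3))"
    if d0: "\<And>m k. d m k \<noteq> 0" and ds: "\<And>m. (\<lambda>k. (norm (d m k - z m))\<^sup>2) summable_on UNIV"
      and d\<epsilon>: "\<And>m. (\<Sum>\<^sub>\<infinity>k. (norm (d m k - z m))\<^sup>2) < \<epsilon>" for d :: "'n \<Rightarrow> int \<Rightarrow> complex^'n"
  proof -
    have "L2_set (\<lambda>p. norm (d (fst p) (snd p) - z (fst p))) F \<le> e" if "finite F" for F
    proof -
      have "(\<Sum>p\<in>F. (norm (d (fst p) (snd p) - z (fst p)))\<^sup>2) \<le> (\<Sum>l\<in>(UNIV :: 'n set). \<epsilon>)"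
      proof (rule sum_prod_le[OF that])
        fix m and G :: "int set" assume "finite G"
        then have "(\<Sum>k\<in>G. (norm (d m k - z m))\<^sup>2) \<le> (\<Sum>\<^sub>\<infinity>k. (norm (d m k - z m))\<^sup>2)"
          by (intro finite_sum_le_infsum ds) auto
        with d\<epsilon>[of m] show "(\<Sum>k\<in>G. (norm (d (fst (m, k)) (snd (m, k)) - z (fst (m, k))))\<^sup>2) \<le> \<epsilon>" by simp
      qed simp
      also have "\<dots> = e\<^sup>2" by (simp add: \<epsilon>_def)
      finally show ?thesis
        unfolding L2_set_def using \<open>e > 0\<close> by (intro real_le_lsqrt) (auto simp: sum_nonneg)
    qed
    with e have interp: "interpolating lam d" by blast
    define A1 :: "complex^'n^'n" where "A1 = (\<chi> i j. \<Sum>l\<in>UNIV. W i l * \<mu> l * cnj (z l $ j))"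
    have zA: "(\<Sum>i\<in>UNIV. cnj (z m $ i) * A1 $ i $ j) = \<mu> m * cnj (z m $ j)" for m j
    proof -
      have "(\<Sum>i\<in>UNIV. cnj (z m $ i) * A1 $ i $ j)
          = (\<Sum>l\<in>UNIV. (\<Sum>i\<in>UNIV. cnj (z m $ i) * W i l) * (\<mu> l * cnj (z l $ j)))"
        by (simp add: A1_def sum_distrib_left sum_distrib_right mult.assoc, subst sum.swap, rule refl)
      then show ?thesis by (simp add: zW if_distrib[of "\<lambda>x. x * _"] cong: if_cong)
    qed
    have "\<exists>f. (\<forall>i. L2_fun (f i)) \<and> (\<forall>m k. (\<Sum>i\<in>UNIV. cnj (d m k $ i) * laplace (f i) (lam m k))
        = (\<Sum>i\<in>UNIV. cnj (d m k $ i) * ((if i = j then 1 else 0) - exp (- lam m k) * A1 $ i $ j)))" for j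
      using interp[unfolded interpolating_def, THEN conjunct1, rule_format, OF sqsum_target[where j=j, OF \<mu> zA close ds]] by simp
    then obtain f where f: "\<And>j i. L2_fun (f j i)"
      "\<And>j m k. (\<Sum>i\<in>UNIV. cnj (d m k $ i) * laplace (f j i) (lam m k))
        = (\<Sum>i\<in>UNIV. cnj (d m k $ i) * ((if i = j then 1 else 0) - exp (- lam m k) * A1 $ i $ j))"
      by metis
    define A2 :: "real \<Rightarrow> complex^'n^'n" where "A2 = (\<lambda>\<theta>. \<chi> i j. f j i \<theta>)"
    have A2: "L2_matrix A2" "L2_matrix (\<lambda>_. 0 :: complex^'n^'n)"
      using f(1) by (simp_all add: L2_matrix_def A2_def)
    have kern: "cnj_vec (d m k) v* char_matrix A1 A2 (\<lambda>_. 0) (lam m k) = 0" for m k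
      unfolding left_kernel_iff
    proof
      fix j
      have "char_matrix A1 A2 (\<lambda>_. 0) (lam m k) $ i $ j
          = lam m k * (((if i = j then 1 else 0) - exp (- lam m k) * A1 $ i $ j) - laplace (f j i) (lam m k))" for i
        unfolding char_matrix_component[OF A2]
        using laplace_cmult[of 0 "\<lambda>_. 0" "lam m k"] by (simp add: A2_def algebra_simps)
      then have "(\<Sum>i\<in>UNIV. cnj (d m k $ i) * char_matrix A1 A2 (\<lambda>_. 0) (lam m k) $ i $ j)
          = lam m k * ((\<Sum>i\<in>UNIV. cnj (d m k $ i) * ((if i = j then 1 else 0) - exp (- lam m k) * A1 $ i $ j))
            - (\<Sum>i\<in>UNIV. cnj (d m k $ i) * laplace (f j i) (lam m k)))"
        by (simp only: sum_distrib_left sum_subtractf[symmetric] right_diff_distrib mult.left_commute)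
      then show "(\<Sum>i\<in>UNIV. cnj (d m k $ i) * char_matrix A1 A2 (\<lambda>_. 0) (lam m k) $ i $ j) = 0"
        by (simp only: f(2) diff_self mult_zero_right)
    qed
    have "cnj_vec (d m k) \<noteq> 0" for m k
      using d0[of m k] by (auto simp: cnj_vec_def vec_eq_iff)
    then have "det (char_matrix A1 A2 (\<lambda>_. 0) (lam m k)) = 0" for m k
      by (rule det_eq_0_if_left_kernel[OF kern])
    with kern A2 have "spectral_assignment lam d A1 A2 (\<lambda>_. 0)"
      unfolding spectral_assignment_def by blast
    moreover have "zero_mean (\<lambda>_. 0 :: complex^'n^'n)" by (simp add: zero_mean_def)
    ultimately have ex: "\<exists>A1 A2 A3. spectral_assignment lam d A1 A2 A3 \<and> zero_mean A3" by blast
    have un: "A1 = B1 \<and> ((\<forall>m k. lam m k \<noteq> 0) \<longrightarrow>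
        (AE \<theta> in unit_interval. neutral_kernel A2 A3 \<theta> = neutral_kernel B2 B3 \<theta>) \<and>
        char_matrix A1 A2 A3 = char_matrix B1 B2 B3)"
      if A: "spectral_assignment lam d A1 A2 A3" "zero_mean A3"
        and B: "spectral_assignment lam d B1 B2 B3" "zero_mean B3" for A1 A2 A3 B1 B2 B3
    proof (intro conjI impI)
      show A1B1: "A1 = B1" by (rule neutral_matrix_unique[OF \<mu> Wz lam close ds A B])
      have AL: "L2_matrix A2" "L2_matrix A3" and BL: "L2_matrix B2" "L2_matrix B3"
        using A B by (auto simp: spectral_assignment_def)
      note NA = char_matrix_neutral_kernel[OF AL A(2)] and NB = char_matrix_neutral_kernel[OF BL B(2)]
      have L: "L2_fun (\<lambda>\<theta>. neutral_kernel A2 A3 \<theta> $ i $ j)" "L2_fun (\<lambda>\<theta>. neutral_kernel B2 B3 \<theta> $ i $ j)" for i j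
        using NA(1) NB(1) by (auto simp: L2_matrix_def)
      assume nz: "\<forall>m k. lam m k \<noteq> 0"
      define K where "K = (\<lambda>j i \<theta>. neutral_kernel A2 A3 \<theta> $ i $ j - neutral_kernel B2 B3 \<theta> $ i $ j)"
      have "(\<Sum>i\<in>UNIV. cnj (d m k $ i) * laplace (K j i) (lam m k)) = 0" for m k j
        using spectral_assignment_interpolation[OF A nz[rule_format], of m k j]
          spectral_assignment_interpolation[OF B nz[rule_format], of m k j]
        by (simp add: A1B1 K_def laplace_diff L right_diff_distrib sum_subtractf)
      moreover have KL: "L2_fun (K j i)" for j i unfolding K_def by (intro L2_fun_diff L)
      ultimately have "AE \<theta> in unit_interval. K j i \<theta> = 0" for j i
        using interp[unfolded interpolating_def, THEN conjunct2, rule_format, of "K j" i] by blast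
      then have "AE \<theta> in unit_interval. \<forall>j i. K j i \<theta> = 0" by (simp add: AE_all_countable)
      then show AE: "AE \<theta> in unit_interval. neutral_kernel A2 A3 \<theta> = neutral_kernel B2 B3 \<theta>"
        by eventually_elim (simp add: K_def vec_eq_iff)
      show "char_matrix A1 A2 A3 = char_matrix B1 B2 B3"
      proof
        fix s
        have "laplace (\<lambda>\<theta>. neutral_kernel A2 A3 \<theta> $ i $ j) s = laplace (\<lambda>\<theta>. neutral_kernel B2 B3 \<theta> $ i $ j) s" for i j
          unfolding laplace_def
          by (intro integral_cong_AE L2_fun_measurable L2_fun_exp_mult L)
             (use AE in eventually_elim, simp)
        then show "char_matrix A1 A2 A3 s = char_matrix B1 B2 B3 s"
          by (simp add: vec_eq_iff NA(2) NB(2) A1B1)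
      qed
    qed
    show ?thesis using ex un by blast
  qed
  show ?thesis
    by (rule exI[of _ \<epsilon>], rule conjI[OF \<open>\<epsilon> > 0\<close>]) (use main in blast)
qed

end
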